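(* Let $\Omega\subset\mathbb{R}^2$ be a bounded simply connected domain and $\psi:\partial\Omega\to\mathbb{R}$ a continuous function such that $(\Omega,\psi)$ satisfies a bounded slope condition. Let $f$ be an admissible Lagrangean, and suppose $f$ is approximated, uniformly on $[0,\infty)$, by a sequence of functions $f_n$, $n\in\mathbb{N}$, each strictly convex, in $C^1([0,+\infty))\cap C^{2,\lambda}_{loc}((0,+\infty))$, with $f_n'(0)=0$. Let $u_n$ be the minimizer of $\int_\Omega f_n(|\nabla w|)\,dx\,dy$ among $w\in\mathrm{Lip}(\overline\Omega)$ with $w=\psi$ on $\partial\Omega$, and let $v_n$ be the unique Lipschitz continuous function with $\int_\Omega v_n=0$ satisfying, in the sense of distributions in $\Omega$, $$\partial_x v_n=-f_n'(|\nabla u_n|)\frac{\partial_y u_n}{|\nabla u_n|},\qquad \partial_y v_n=f_n'(|\nabla u_n|)\frac{\partial_x u_n}{|\nabla u_n|}.$$ Assume that, for each $n$, $\rho f_n''(\rho)/f_n'(\rho)$ converges to a positive constant as $\rho\to0^+$, and let $\alpha_n(\rho)=\rho f_n''(\rho)/f_n'(\rho)$ for $\rho>0$, $\alpha_n(0)=\lim_{\rho\to0^+}\rho f_n''(\rho)/f_n'(\rho)$. Let $g_n'$ be the inverse function of $f_n'$, and assume that $\alpha_n\circ g_n'$ converges to a function $\beta$ uniformly on the compact subsets of $[0,+\infty)$. Let $v$ be a function obtained as the uniform limit in $\Omega$ of a subsequence of $(v_n)_{n\in\mathbb{N}}$. If, in addition, the functions $\alpha_n$ converge to $\alpha$ uniformly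 on every compact subset of $[0,+\infty)$, where $\alpha(\rho)=\rho f''(\rho)/f'(\rho)$ for $\rho>0$ and $\alpha(0)=0$, then $v$ is a viscosity solution of $$-\big[1-\alpha(g'(|\nabla v|))\big]\Delta_\infty v-|\nabla v|^2\,\alpha(g'(|\nabla v|))\,\Delta v=0\quad\text{in }\Omega,$$ where $g(r)=\sup\{r\rho-f(\rho):\rho\ge0\}$.
   Context: An admissible Lagrangean is a function $f:[0,+\infty)\to\mathbb{R}$ that is strictly convex, belongs to $C^1([0,+\infty))\cap C^{2,\lambda}_{loc}((0,+\infty))$ for some $0<\lambda<1$, satisfies $f'(0)>0$, and is such that $\rho f''(\rho)/f'(\rho)$ has finite limits as $\rho\to0^+$ and as $\rho\to+\infty$, the limit at $+\infty$ being strictly positive. $\mathrm{Lip}(\overline\Omega)$ is the space of Lipschitz continuous functions on $\overline\Omega$. The pair $(\Omega,\psi)$ satisfies a bounded slope condition (with constant $Q>0$) if for every $x_0\in\partial\Omega$ there exist two affine functions $L^+,L^-$ such that $L^-\le\psi\le L^+$ on $\partial\Omega$, $L^-(x_0)=\psi(x_0)=L^+(x_0)$, and $\sup_{x,y\in\Omega,\,x\ne y}\frac{|L^\pm(x)-L^\pm(y)|}{|x-y|}\le Q$. The right-hand sides of the system defining $v_n$ are understood to be $0$ where $\nabla u_n=0$. $\Delta_\infty v=\langle\nabla^2v\,\nabla v,\nabla v\rangle$. Viscosity solutions are meant in the usual (Crandall–Ishii–Lions) sense. *)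

theory Defs
  imports "HOL-Analysis.Analysis"
begin

text \<open>
  A function on \<open>[0, \<infinity>)\<close> is represented by a function of type \<^typ>\<open>real \<Rightarrow> real\<close> whose values on the
  negative axis are irrelevant.  The derivative is therefore taken within \<open>[0, \<infinity>)\<close>: it is one-sided
  at \<open>0\<close> and the ordinary derivative at positive arguments.
\<close>

definition hderiv :: "(real \<Rightarrow> real) \<Rightarrow> real \<Rightarrow> real" where
  "hderiv f \<rho> = vector_derivative f (at \<rho> within {0..})"

definition strictly_convex_on :: "'a::real_vector set \<Rightarrow> ('a \<Rightarrow> real) \<Rightarrow> bool" where
  "strictly_convex_on S f \<longleftrightarrow> convex S \<and>
     (\<forall>x\<in>S. \<forall>y\<in>S. \<forall>t. x \<noteq> y \<and> 0 < t \<and> t < 1 \<longrightarrow>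
        f ((1 - t) *\<^sub>R x + t *\<^sub>R y) < (1 - t) * f x + t * f y)"

definition C1_halfline :: "(real \<Rightarrow> real) \<Rightarrow> bool" where
  "C1_halfline f \<longleftrightarrow> (\<forall>\<rho>\<ge>0. f differentiable (at \<rho> within {0..})) \<and> continuous_on {0..} (hderiv f)"

definition C2_loc_hoelder :: "real \<Rightarrow> (real \<Rightarrow> real) \<Rightarrow> bool" where
  "C2_loc_hoelder \<theta> f \<longleftrightarrow>
     (\<forall>\<rho>>0. f differentiable (at \<rho>) \<and> hderiv f differentiable (at \<rho>)) \<and>
     (\<forall>K. compact K \<and> K \<subseteq> {0<..} \<longrightarrow>
        (\<exists>C. \<forall>x\<in>K. \<forall>y\<in>K. \<bar>deriv (hderiv f) x - deriv (hderiv f) y\<bar> \<le> C * \<bar>x - y\<bar> powr \<theta>))"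

definition regular_strictly_convex :: "(real \<Rightarrow> real) \<Rightarrow> bool" where
  "regular_strictly_convex f \<longleftrightarrow> strictly_convex_on {0..} f \<and> C1_halfline f \<and>
     (\<exists>\<theta>. 0 < \<theta> \<and> \<theta> < 1 \<and> C2_loc_hoelder \<theta> f)"

definition elasticity :: "(real \<Rightarrow> real) \<Rightarrow> real \<Rightarrow> real" where
  "elasticity f \<rho> = \<rho> * deriv (hderiv f) \<rho> / hderiv f \<rho>"

definition admissible_lagrangean :: "(real \<Rightarrow> real) \<Rightarrow> bool" where
  "admissible_lagrangean f \<longleftrightarrow> regular_strictly_convex f \<and> hderiv f 0 > 0 \<and>
     (\<exists>l. (elasticity f \<longlongrightarrow> l) (at_right 0)) \<and>
     (\<exists>l>0. (elasticity f \<longlongrightarrow> l) at_top)"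

definition conjugate_halfline :: "(real \<Rightarrow> real) \<Rightarrow> real \<Rightarrow> real" where
  "conjugate_halfline f r = (SUP \<rho>\<in>{0..}. r * \<rho> - f \<rho>)"

definition Lip :: "'a::metric_space set \<Rightarrow> ('a \<Rightarrow> real) set" where
  "Lip S = {w. \<exists>L. L-lipschitz_on S w}"

text \<open>The slope bound \<open>sup |L x - L y| / |x - y| \<le> Q\<close> is the statement that \<open>L\<close> is \<open>Q\<close>-Lipschitz.\<close>

definition bounded_slope_condition :: "'a::euclidean_space set \<Rightarrow> ('a \<Rightarrow> real) \<Rightarrow> bool" where
  "bounded_slope_condition \<Omega> \<psi> \<longleftrightarrow> (\<exists>Q>0. \<forall>x\<^sub>0\<in>frontier \<Omega>. \<exists>Lp Lm.
     (\<exists>a b. Lp = (\<lambda>x. a \<bullet> x + b)) \<and> (\<exists>a b. Lm = (\<lambda>x. a \<bullet> x + b)) \<and>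
     (\<forall>x\<in>frontier \<Omega>. Lm x \<le> \<psi> x \<and> \<psi> x \<le> Lp x) \<and>
     Lm x\<^sub>0 = \<psi> x\<^sub>0 \<and> \<psi> x\<^sub>0 = Lp x\<^sub>0 \<and>
     Q-lipschitz_on \<Omega> Lp \<and> Q-lipschitz_on \<Omega> Lm)"

text \<open>
  The gradient is the classical one, set to \<open>0\<close> at points of non-differentiability.  It is only used
  for Lipschitz functions, for which these points form a null set (Rademacher) and the classical
  gradient agrees almost everywhere with the weak one.
\<close>

definition grad :: "('a::euclidean_space \<Rightarrow> real) \<Rightarrow> 'a \<Rightarrow> 'a" where
  "grad u x = (if \<exists>D. GDERIV u x :> D then THE D. GDERIV u x :> D else 0)"

definition minimizes_gradient_integral ::
    "'a::euclidean_space set \<Rightarrow> ('a \<Rightarrow> real) \<Rightarrow> (real \<Rightarrow> real) \<Rightarrow> ('a \<Rightarrow> real) \<Rightarrow> bool" where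
  "minimizes_gradient_integral \<Omega> \<psi> f u \<longleftrightarrow>
     u \<in> Lip (closure \<Omega>) \<and> (\<forall>x\<in>frontier \<Omega>. u x = \<psi> x) \<and>
     (\<forall>w \<in> Lip (closure \<Omega>). (\<forall>x\<in>frontier \<Omega>. w x = \<psi> x) \<longrightarrow>
        (LINT x:\<Omega>|lebesgue. f (norm (grad u x))) \<le> (LINT x:\<Omega>|lebesgue. f (norm (grad w x))))"

definition partial :: "'n::finite \<Rightarrow> (real^'n \<Rightarrow> real) \<Rightarrow> real^'n \<Rightarrow> real" where
  "partial i \<phi> x = frechet_derivative \<phi> (at x) (axis i 1)"

text \<open>\<open>C\<^sup>k\<close> on the whole space: differentiable with all first partial derivatives of class \<open>C\<^sup>k\<^sup>-\<^sup>1\<close>.\<close>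

primrec Ck :: "nat \<Rightarrow> (real^'n::finite \<Rightarrow> real) \<Rightarrow> bool" where
  "Ck 0 \<phi> \<longleftrightarrow> continuous_on UNIV \<phi>"
| "Ck (Suc k) \<phi> \<longleftrightarrow> (\<forall>x. \<phi> differentiable (at x)) \<and> (\<forall>i. Ck k (partial i \<phi>))"

definition test_functions :: "(real^'n::finite) set \<Rightarrow> (real^'n \<Rightarrow> real) set" where
  "test_functions \<Omega> = {\<phi>. (\<forall>k. Ck k \<phi>) \<and> compact (closure {x. \<phi> x \<noteq> 0}) \<and> closure {x. \<phi> x \<noteq> 0} \<subseteq> \<Omega>}"

definition locally_integrable :: "'a::euclidean_space set \<Rightarrow> ('a \<Rightarrow> real) \<Rightarrow> bool" where
  "locally_integrable \<Omega> h \<longleftrightarrow> (\<forall>K. compact K \<and> K \<subseteq> \<Omega> \<longrightarrow> set_integrable lebesgue K h)"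

text \<open>\<open>\<partial>\<^sub>i v = h\<close> in the sense of distributions in \<open>\<Omega>\<close>, for locally integrable \<open>v\<close> and \<open>h\<close>.\<close>

definition distributional_partial ::
    "(real^'n::finite) set \<Rightarrow> 'n \<Rightarrow> (real^'n \<Rightarrow> real) \<Rightarrow> (real^'n \<Rightarrow> real) \<Rightarrow> bool" where
  "distributional_partial \<Omega> i v h \<longleftrightarrow> locally_integrable \<Omega> v \<and> locally_integrable \<Omega> h \<and>
     (\<forall>\<phi>\<in>test_functions \<Omega>.
        - (LINT x:\<Omega>|lebesgue. v x * partial i \<phi> x) = (LINT x:\<Omega>|lebesgue. h x * \<phi> x))"

text \<open>
  \<open>\<phi>\<close> is of class \<open>C\<^sup>2\<close> on the open set \<open>\<Omega>\<close>, with gradient \<open>D\<phi>\<close> and Hessian \<open>H\<phi>\<close> there.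
\<close>

definition C2_with ::
    "(real^'n::finite) set \<Rightarrow> (real^'n \<Rightarrow> real) \<Rightarrow> (real^'n \<Rightarrow> real^'n) \<Rightarrow> (real^'n \<Rightarrow> real^'n^'n) \<Rightarrow> bool" where
  "C2_with \<Omega> \<phi> D\<phi> H\<phi> \<longleftrightarrow>
     (\<forall>x\<in>\<Omega>. GDERIV \<phi> x :> D\<phi> x \<and> (D\<phi> has_derivative (\<lambda>h. H\<phi> x *v h)) (at x)) \<and>
     continuous_on \<Omega> H\<phi>"

text \<open>
  Viscosity solutions of \<open>F(\<nabla>v, \<nabla>\<^sup>2v) = 0\<close> for an open set \<open>\<Omega>\<close> and an operator \<open>F\<close> that is degenerate
  elliptic, i.e. nonincreasing in the Hessian: touching from above gives \<open>F \<le> 0\<close>, touching from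
  below \<open>F \<ge> 0\<close>.
\<close>

definition viscosity_solution ::
    "(real^'n::finite) set \<Rightarrow> (real^'n \<Rightarrow> real^'n^'n \<Rightarrow> real) \<Rightarrow> (real^'n \<Rightarrow> real) \<Rightarrow> bool" where
  "viscosity_solution \<Omega> F v \<longleftrightarrow> continuous_on \<Omega> v \<and>
     (\<forall>\<phi> D\<phi> H\<phi>. C2_with \<Omega> \<phi> D\<phi> H\<phi> \<longrightarrow> (\<forall>x\<^sub>0\<in>\<Omega>.
        ((\<forall>\<^sub>F x in at x\<^sub>0. v x - \<phi> x \<le> v x\<^sub>0 - \<phi> x\<^sub>0) \<longrightarrow> F (D\<phi> x\<^sub>0) (H\<phi> x\<^sub>0) \<le> 0) \<and>
        ((\<forall>\<^sub>F x in at x\<^sub>0. v x - \<phi> x \<ge> v x\<^sub>0 - \<phi> x\<^sub>0) \<longrightarrow> F (D\<phi> x\<^sub>0) (H\<phi> x\<^sub>0) \<ge> 0)))"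

end

theory Submission
  imports Defs
begin

text \<open>
  Write \<open>F = f\<^sub>n'\<close>.  At almost every point the system for \<open>v\<^sub>n\<close> says that \<open>\<nabla>v\<^sub>n\<close> is the quarter turn of
  \<open>F(|\<nabla>u\<^sub>n|) \<nabla>u\<^sub>n / |\<nabla>u\<^sub>n|\<close>.  For large \<open>n\<close> the function \<open>F\<close> is an increasing bijection of \<open>[0, \<infinity>)\<close>
  with inverse \<open>g\<^sub>n'\<close>, and the system can be solved for \<open>\<nabla>u\<^sub>n\<close>: the quarter turn of \<open>\<nabla>u\<^sub>n\<close> is the
  flux \<open>g\<^sub>n'(|\<nabla>v\<^sub>n|) \<nabla>v\<^sub>n / |\<nabla>v\<^sub>n|\<close>.  The quarter turn of a gradient has no divergence, so \<open>v\<^sub>n\<close> is a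
  weak solution of
  \<open>div (g\<^sub>n'(|\<nabla>v|) \<nabla>v / |\<nabla>v|) = 0\<close>.  Expanding the divergence of the same flux along a smooth function
  with nonvanishing gradient gives, up to a positive factor, the operator of the theorem with
  \<open>\<alpha>\<^sub>n \<circ> g\<^sub>n'\<close> in place of \<open>\<alpha> \<circ> g'\<close>.

  The viscosity property is a comparison argument.  Let \<open>\<phi>\<close> touch \<open>v\<close> from above at \<open>x\<^sub>0\<close>.  If
  \<open>\<nabla>\<phi>(x\<^sub>0) = 0\<close>, both terms of the operator vanish.  Otherwise, if the required inequality failed, then
  near \<open>x\<^sub>0\<close> and for large \<open>n\<close> the function \<open>\<phi> + \<gamma>|x - x\<^sub>0|\<^sup>2 + c\<close> with small \<open>\<gamma> > 0\<close> would be a weak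
  supersolution of the equation of \<open>v\<^sub>n\<close>, and \<open>c\<close> could be chosen such that it lies above \<open>v\<^sub>n\<close> near the
  boundary of a small ball but below \<open>v\<^sub>n\<close> at the centre \<open>x\<^sub>0\<close>.  Testing both weak formulations with the
  positive part of the difference contradicts the strict monotonicity of the flux
  (\<open>conjugate_comparison\<close>, \<open>touching_from_above\<close>).  Touching from below is the same statement for
  \<open>-u\<^sub>n\<close>, \<open>-v\<^sub>n\<close> and \<open>-\<phi>\<close>.

  As \<open>f\<^sub>n''\<close> may vanish, \<open>g\<^sub>n'\<close> need not be differentiable, and the divergence above may not exist.
  Therefore \<open>f\<^sub>n'\<close> is replaced by \<open>f\<^sub>n' + \<epsilon> id\<close>, whose inverse is Lipschitz, and \<open>\<epsilon>\<close> tends to \<open>0\<close> after an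
  integration by parts (\<open>slope_flux_nonneg\<close>).  The elasticity of \<open>f\<^sub>n' + \<epsilon> id\<close> is a convex combination of
  \<open>\<alpha>\<^sub>n\<close> and \<open>1\<close>; evaluated at the inverse slope it converges to \<open>\<alpha> \<circ> g'\<close> as \<open>n \<rightarrow> \<infinity>\<close> and
  \<open>\<epsilon> \<rightarrow> 0\<close>, because slopes of convex functions are stable under uniform convergence
  (\<open>slope_inverse_stable\<close>, \<open>regularized_elasticity_limit\<close>).

  The analytic basis is Rademacher's theorem (\<open>rademacher\<close>): it makes the classical gradients of the
  Lipschitz functions \<open>u\<^sub>n\<close> and \<open>v\<^sub>n\<close> meaningful almost everywhere, and identifies the distributional
  partial derivatives of \<open>v\<^sub>n\<close> with the classical ones (\<open>distributional_partial_lipschitz\<close>).  All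
  integrations by parts come from moving difference quotients from one factor to the other by the
  translation invariance of Lebesgue measure.
\<close>

section \<open>Smooth bumps and the fundamental lemma of the calculus of variations\<close>

text \<open>
  The functions \<open>e\<^sup>-\<^sup>1\<^sup>/\<^sup>t / t\<^sup>m\<close>, extended by \<open>0\<close>.  The powers of \<open>t\<close> are there because the family is then
  closed under differentiation up to linear combinations, which makes smoothness an induction.
\<close>

definition flat_exp :: "nat \<Rightarrow> real \<Rightarrow> real" where
  "flat_exp m t = (if t > 0 then exp (- (1 / t)) / t ^ m else 0)"

text \<open>
  The quadratic bound yields the derivative at \<open>0\<close>; it is the term of index \<open>m + 2\<close> in the series of
  \<open>e\<^sup>1\<^sup>/\<^sup>t\<close>.
\<close>

lemma flat_exp_bound: "\<bar>flat_exp m t\<bar> \<le> fact (m + 2) * t\<^sup>2"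
proof (cases "t > 0")
  case True
  have *: "s ^ (m+2) / fact (m+2) \<le> exp s" if "s \<ge> 0" for s :: real
  proof -
    have "sum (\<lambda>k. s ^ k /\<^sub>R fact k) {m+2} \<le> (\<Sum>k. s ^ k /\<^sub>R fact k)"
      by (intro sum_le_suminf summable_exp_generic) (use that in auto)
    then show ?thesis by (simp add: exp_def divide_inverse mult.commute)
  qed
  have "(1/t) ^ (m+2) / fact (m+2) \<le> exp (1/t)" using True by (intro *) auto
  then have "exp (-(1/t)) \<le> fact (m+2) * t ^ (m+2)"
    using True by (simp add: exp_minus field_simps power_add power2_eq_square del: fact_Suc fact_2 add_2_eq_Suc' flip: power_add)
  then have "exp (-(1/t)) / t ^ m \<le> fact (m+2) * t\<^sup>2"
    using True by (simp add: pos_divide_le_eq power_add mult.commute mult.left_commute del: fact_Suc fact_2 add_2_eq_Suc')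
  then show ?thesis using True by (simp add: flat_exp_def)
qed (auto simp: flat_exp_def)

lemma flat_exp_deriv:
  "(flat_exp m has_real_derivative (flat_exp (m + 2) t - real m * flat_exp (m + 1) t)) (at t)"
proof -
  consider "t > 0" | "t < 0" | "t = 0" by linarith
  then show ?thesis
  proof cases
    case 1
    have "((\<lambda>t. exp (- (1 / t)) / t ^ m) has_real_derivative
        (exp (-(1/t)) * (1/t\<^sup>2)) * inverse (t^m) + exp (-(1/t)) * (- (real m * t ^ (m-1)) / (t^m)\<^sup>2)) (at t)"
      using 1 unfolding divide_inverse
      by (auto intro!: derivative_eq_intros simp: power2_eq_square field_simps)
    also have "(exp (-(1/t)) * (1/t\<^sup>2)) * inverse (t^m) + exp (-(1/t)) * (- (real m * t ^ (m-1)) / (t^m)\<^sup>2)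
       = flat_exp (m + 2) t - real m * flat_exp (m + 1) t"
      using 1 by (cases m) (simp_all add: flat_exp_def field_simps power_add power2_eq_square)
    finally have *: "((\<lambda>t. exp (- (1 / t)) / t ^ m) has_real_derivative (flat_exp (m + 2) t - real m * flat_exp (m + 1) t)) (at t)" .
    show ?thesis
      by (rule has_field_derivative_transform_within_open[OF *, of "{0<..}"])
         (use 1 in \<open>auto simp: flat_exp_def\<close>)
  next
    case 2
    have *: "((\<lambda>t. 0) has_real_derivative (flat_exp (m + 2) t - real m * flat_exp (m + 1) t)) (at t)"
      using 2 by (simp add: flat_exp_def)
    show ?thesis
      by (rule has_field_derivative_transform_within_open[OF *, of "{..<0}"])
         (use 2 in \<open>auto simp: flat_exp_def\<close>)
  next
    case 3
    have "((\<lambda>h. (flat_exp m (0 + h) - flat_exp m 0) / h) \<longlongrightarrow> 0) (at 0)"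
    proof (rule tendsto_rabs_zero_cancel, rule tendsto_sandwich)
      show "\<forall>\<^sub>F h in at 0. 0 \<le> \<bar>(flat_exp m (0 + h) - flat_exp m 0) / h\<bar>" by auto
      have "\<bar>flat_exp m h / h\<bar> \<le> fact (m+2) * \<bar>h\<bar>" if "h \<noteq> 0" for h
      proof -
        have "\<bar>flat_exp m h\<bar> / \<bar>h\<bar> \<le> fact (m+2) * h\<^sup>2 / \<bar>h\<bar>"
          by (intro divide_right_mono flat_exp_bound) auto
        also have "fact (m+2) * h\<^sup>2 / \<bar>h\<bar> = fact (m+2) * (h\<^sup>2 / \<bar>h\<bar>)" by simp
        also have "h\<^sup>2 / \<bar>h\<bar> = \<bar>h\<bar>" using that by (auto simp: power2_eq_square abs_if)
        finally show ?thesis by (simp add: abs_divide)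
      qed
      then show "\<forall>\<^sub>F h in at 0. \<bar>(flat_exp m (0 + h) - flat_exp m 0) / h\<bar> \<le> fact (m+2) * \<bar>h\<bar>"
        by (intro eventually_at_topological[THEN iffD2]) (auto simp: flat_exp_def intro!: exI[of _ UNIV])
      show "((\<lambda>h. fact (m+2) * \<bar>h\<bar>) \<longlongrightarrow> 0) (at (0::real))" by (auto intro!: tendsto_eq_intros)
    qed auto
    then show ?thesis using 3 by (simp add: DERIV_def flat_exp_def)
  qed
qed

text \<open>
  An algebra of functions containing the bumps below and closed under partial derivatives, so that
  each of its members is of class \<open>C\<^sup>k\<close> for every \<open>k\<close>.
\<close>

inductive flat_exp_poly :: "(real^'n::finite \<Rightarrow> real) \<Rightarrow> bool" where
  const: "flat_exp_poly (\<lambda>x. c)"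
| coord: "flat_exp_poly (\<lambda>x. flat_exp m (c * x $ i + d))"
| add: "flat_exp_poly p \<Longrightarrow> flat_exp_poly q \<Longrightarrow> flat_exp_poly (\<lambda>x. p x + q x)"
| mult: "flat_exp_poly p \<Longrightarrow> flat_exp_poly q \<Longrightarrow> flat_exp_poly (\<lambda>x. p x * q x)"

lemma flat_exp_poly_has_derivative:
  assumes "flat_exp_poly p"
  shows "\<exists>P. (\<forall>x. (p has_derivative P x) (at x)) \<and> (\<forall>h. flat_exp_poly (\<lambda>x. P x h))"
  using assms
proof induction
  case (const c)
  show ?case by (rule exI[of _ "\<lambda>x h. 0"]) (auto intro: flat_exp_poly.const)
next
  case (coord m c i d)
  let ?P = "\<lambda>x h. (c * h $ i) * (flat_exp (m+2) (c * x $ i + d) + (- real m) * flat_exp (m+1) (c * x $ i + d))"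
  have "((\<lambda>x. flat_exp m (c * x $ i + d)) has_derivative ?P x) (at x)" for x
  proof -
    have 1: "((\<lambda>x. c * x $ i + d) has_derivative (\<lambda>h. c * h $ i)) (at x)"
      by (auto intro!: derivative_eq_intros bounded_linear.has_derivative[OF bounded_linear_vec_nth])
    show ?thesis
      using has_derivative_compose[OF 1 flat_exp_deriv[of m "c * x $ i + d", unfolded has_field_derivative_def]]
      by (simp add: algebra_simps)
  qed
  moreover have "flat_exp_poly (\<lambda>x. ?P x h)" for h
    by (intro flat_exp_poly.intros)
  ultimately show ?case by (intro exI[of _ ?P]) blast
next
  case (add p q)
  then obtain P Q where "\<forall>x. (p has_derivative P x) (at x)" "\<forall>h. flat_exp_poly (\<lambda>x. P x h)"
    "\<forall>x. (q has_derivative Q x) (at x)" "\<forall>h. flat_exp_poly (\<lambda>x. Q x h)" by blast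
  then show ?case by (intro exI[of _ "\<lambda>x h. P x h + Q x h"]) (auto intro!: flat_exp_poly.intros derivative_intros)
next
  case (mult p q)
  then obtain P Q where "\<forall>x. (p has_derivative P x) (at x)" "\<forall>h. flat_exp_poly (\<lambda>x. P x h)"
    "\<forall>x. (q has_derivative Q x) (at x)" "\<forall>h. flat_exp_poly (\<lambda>x. Q x h)" by blast
  with mult.hyps show ?case
    by (intro exI[of _ "\<lambda>x h. p x * Q x h + P x h * q x"]) (auto intro!: flat_exp_poly.intros has_derivative_mult)
qed

lemma flat_exp_poly_Ck: "flat_exp_poly p \<Longrightarrow> Ck k p"
proof (induction k arbitrary: p)
  case 0
  then obtain P where "\<forall>x. (p has_derivative P x) (at x)" using flat_exp_poly_has_derivative by blast
  then show ?case by (auto intro!: continuous_at_imp_continuous_on has_derivative_continuous)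
next
  case (Suc k)
  then obtain P where P: "\<forall>x. (p has_derivative P x) (at x)" "\<forall>h. flat_exp_poly (\<lambda>x. P x h)"
    using flat_exp_poly_has_derivative by blast
  have "partial i p = (\<lambda>x. P x (axis i 1))" for i
    using frechet_derivative_at[OF P(1)[rule_format], symmetric] by (auto simp: partial_def fun_eq_iff)
  then show ?case using P Suc.IH by (auto simp: differentiable_def)
qed

lemma flat_exp_poly_prod:
  "finite I \<Longrightarrow> (\<And>i. i \<in> I \<Longrightarrow> flat_exp_poly (p i)) \<Longrightarrow> flat_exp_poly (\<lambda>x. \<Prod>i\<in>I. p i x)"
  by (induction I rule: finite_induct) (auto intro!: flat_exp_poly.intros)

text \<open>
  Scaling the argument by \<open>k + 1\<close> pushes each factor to \<open>1\<close> inside the box while it stays \<open>0\<close> outside,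
  so these test functions tend to the indicator function of the open box.
\<close>

definition box_bump :: "real^'n::finite \<Rightarrow> real^'n \<Rightarrow> nat \<Rightarrow> real^'n \<Rightarrow> real" where
  "box_bump a b k x = (\<Prod>i\<in>UNIV. flat_exp 0 (real (Suc k) * (x $ i - a $ i)) * flat_exp 0 (real (Suc k) * (b $ i - x $ i)))"

lemma flat_exp_0_range: "0 \<le> flat_exp 0 t" "flat_exp 0 t \<le> 1"
  by (auto simp: flat_exp_def)

lemma box_bump_range: "0 \<le> box_bump a b k x" "box_bump a b k x \<le> 1"
  unfolding box_bump_def
  by (auto intro!: prod_nonneg prod_le_1 mult_nonneg_nonneg mult_le_one flat_exp_0_range)

lemma box_bump_outside: "x \<notin> box a b \<Longrightarrow> box_bump a b k x = 0"
proof -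
  assume "x \<notin> box a b"
  then obtain i where "x $ i - a $ i \<le> 0 \<or> b $ i - x $ i \<le> 0" by (force simp: mem_box_cart not_less)
  then have "flat_exp 0 (real (Suc k) * (x $ i - a $ i)) * flat_exp 0 (real (Suc k) * (b $ i - x $ i)) = 0"
    by (auto simp: flat_exp_def zero_less_mult_iff)
  then show ?thesis unfolding box_bump_def by (intro prod_zero) auto
qed

lemma box_bump_tendsto:
  fixes a b x :: "real^'n::finite"
  shows "(\<lambda>k. box_bump a b k x) \<longlonglongrightarrow> indicator (box a b) x"
proof (cases "x \<in> box a b")
  case True
  have *: "(\<lambda>k. flat_exp 0 (real (Suc k) * t)) \<longlonglongrightarrow> 1" if "t > 0" for t
  proof -
    have "(\<lambda>k. exp (- (inverse (real (Suc k)) * (1 / t)))) \<longlonglongrightarrow> exp (- (0 * (1/t)))"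
      by (intro tendsto_intros LIMSEQ_inverse_real_of_nat)
    moreover have "exp (- (inverse (real (Suc k)) * (1 / t))) = flat_exp 0 (real (Suc k) * t)" for k
      using that by (simp add: flat_exp_def field_simps del: of_nat_Suc)
    ultimately show ?thesis by (simp del: of_nat_Suc)
  qed
  have "(\<lambda>k. box_bump a b k x) \<longlonglongrightarrow> (\<Prod>i\<in>(UNIV::'n set). 1 * 1)"
    unfolding box_bump_def
  proof (intro tendsto_prod tendsto_mult)
    fix i show "(\<lambda>k. flat_exp 0 (real (Suc k) * (x $ i - a $ i))) \<longlonglongrightarrow> 1"
      "(\<lambda>k. flat_exp 0 (real (Suc k) * (b $ i - x $ i))) \<longlonglongrightarrow> 1"
      using True by (intro *; auto simp: mem_box_cart)+
  qed
  then show ?thesis using True by simp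
qed (simp add: box_bump_outside)

lemma box_bump_test_function:
  fixes a b :: "real^'n::finite"
  assumes "cbox a b \<subseteq> \<Omega>"
  shows "box_bump a b k \<in> test_functions \<Omega>"
proof -
  have "flat_exp_poly (\<lambda>x::real^'n. flat_exp 0 (real (Suc k) * (x $ i - a $ i)))" for i
    using flat_exp_poly.coord[of 0 "real (Suc k)" i "- (real (Suc k) * a $ i)"] by (simp add: right_diff_distrib)
  moreover have "flat_exp_poly (\<lambda>x::real^'n. flat_exp 0 (real (Suc k) * (b $ i - x $ i)))" for i
    using flat_exp_poly.coord[of 0 "- real (Suc k)" i "real (Suc k) * b $ i"]
    by (simp add: right_diff_distrib algebra_simps)
  ultimately have "flat_exp_poly (box_bump a b k)"
    unfolding box_bump_def[abs_def] by (intro flat_exp_poly_prod flat_exp_poly.mult) auto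
  moreover have sub: "closure {x. box_bump a b k x \<noteq> 0} \<subseteq> cbox a b"
  proof (rule closure_minimal)
    show "{x. box_bump a b k x \<noteq> 0} \<subseteq> cbox a b"
      using box_bump_outside[of _ a b k] box_subset_cbox[of a b] by blast
  qed (rule closed_cbox)
  ultimately show ?thesis
    using assms bounded_subset[OF bounded_cbox sub]
    by (auto simp: test_functions_def compact_eq_bounded_closed intro: flat_exp_poly_Ck)
qed

text \<open>
  The bumps show that the integral of \<open>h\<close> over each box in \<open>\<Omega>\<close> vanishes.  Almost every value of \<open>h\<close> is the
  limit of its means over shrinking cubes with corner at that point, hence \<open>0\<close>.
\<close>

lemma AE_zero_if_test_integrals_zero:
  fixes h :: "real^'n::finite \<Rightarrow> real"
  assumes "open \<Omega>" and h: "locally_integrable \<Omega> h"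
    and zero: "\<And>\<phi>. \<phi> \<in> test_functions \<Omega> \<Longrightarrow> (LINT x:\<Omega>|lebesgue. h x * \<phi> x) = 0"
  shows "AE x in lebesgue. x \<in> \<Omega> \<longrightarrow> h x = 0"
proof -
  \<comment> \<open>Dominated convergence along the bumps, with the integrable bound |h| on the closed box.\<close>
  have box0: "(LINT x:box a b|lebesgue. h x) = 0" if ab: "cbox a b \<subseteq> \<Omega>" for a b
  proof -
    have int: "set_integrable lebesgue (cbox a b) h"
      using h ab by (auto simp: locally_integrable_def)
    have "(\<lambda>k. LINT x|lebesgue. box_bump a b k x * (indicator (cbox a b) x * h x)) \<longlonglongrightarrow>
        (LINT x|lebesgue. indicator (box a b) x * (indicator (cbox a b) x * h x))"
    proof (rule integral_dominated_convergence[where w = "\<lambda>x. \<bar>indicator (cbox a b) x * h x\<bar>"])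
      have m: "(\<lambda>x. indicator (cbox a b) x * h x) \<in> borel_measurable lebesgue"
        using int by (auto simp: set_integrable_def)
      have "continuous_on UNIV (box_bump a b k)" for k
        using box_bump_test_function[OF ab, of k] by (auto simp: test_functions_def dest: spec[of _ 0])
      then have "box_bump a b k \<in> borel_measurable lborel" for k
        by (simp add: borel_measurable_continuous_onI)
      then have "box_bump a b k \<in> borel_measurable lebesgue" for k
        by (rule measurable_completion)
      with m show "(\<lambda>x. box_bump a b k x * (indicator (cbox a b) x * h x)) \<in> borel_measurable lebesgue" for k
        by measurable
      show "(\<lambda>x. indicator (box a b) x * (indicator (cbox a b) x * h x)) \<in> borel_measurable lebesgue"
        by (intro borel_measurable_times m borel_measurable_indicator) auto
      show "integrable lebesgue (\<lambda>x. \<bar>indicator (cbox a b) x * h x\<bar>)"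
        using int by (auto simp: set_integrable_def)
      show "AE x in lebesgue. (\<lambda>k. box_bump a b k x * (indicator (cbox a b) x * h x)) \<longlonglongrightarrow>
          indicator (box a b) x * (indicator (cbox a b) x * h x)"
        by (intro AE_I2 tendsto_mult box_bump_tendsto tendsto_const)
      show "AE x in lebesgue. norm (box_bump a b k x * (indicator (cbox a b) x * h x)) \<le> \<bar>indicator (cbox a b) x * h x\<bar>" for k
        using box_bump_range[of a b k]
        by (intro AE_I2) (auto simp: abs_mult intro!: mult_left_le_one_le)
    qed
    moreover have "(LINT x|lebesgue. box_bump a b k x * (indicator (cbox a b) x * h x)) = 0" for k
    proof -
      have "box_bump a b k x * (indicator (cbox a b) x * h x) = indicator \<Omega> x *\<^sub>R (h x * box_bump a b k x)" for x
        using ab box_bump_outside[of x a b k] box_subset_cbox[of a b] by (auto simp: indicator_def)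
      then show ?thesis
        using zero[OF box_bump_test_function[OF ab, of k]] by (simp only: set_lebesgue_integral_def)
    qed
    ultimately have "(LINT x|lebesgue. indicator (box a b) x * (indicator (cbox a b) x * h x)) = 0"
      by (simp add: LIMSEQ_const_iff)
    moreover have "indicator (box a b) x * (indicator (cbox a b) x * h x) = indicator (box a b) x *\<^sub>R h x" for x
      using box_subset_cbox[of a b] by (auto simp: indicator_def)
    ultimately show ?thesis by (simp add: set_lebesgue_integral_def)
  qed
  have local: "negligible {x \<in> box c d. h x \<noteq> 0}" if cd: "cbox c d \<subseteq> \<Omega>" for c d
  proof -
    define H where "H x = (if x \<in> cbox c d then h x else 0)" for x
    have int: "set_integrable lebesgue (cbox c d) h"
      using h cd by (auto simp: locally_integrable_def)
    then have "h absolutely_integrable_on cbox c d" .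
    then have "H absolutely_integrable_on UNIV"
      unfolding H_def by (simp add: absolutely_integrable_restrict_UNIV)
    then have "H integrable_on cbox a b" for a b
      using integrable_on_subcbox set_lebesgue_integral_eq_integral(1) by blast
    then obtain N where N: "negligible N"
      "\<And>x e. \<lbrakk>x \<notin> N; 0 < e\<rbrakk> \<Longrightarrow> \<exists>\<delta>>0. \<forall>t. 0 < t \<and> t < \<delta> \<longrightarrow>
          norm (integral (cbox x (x + t *\<^sub>R One)) H /\<^sub>R t ^ DIM(real^'n) - H x) < e"
      using integrable_ccontinuous_explicit by blast
    have "h x = 0" if x: "x \<in> box c d" "x \<notin> N" for x
    proof -
      have "norm (H x) < e" if e: "e > 0" for e
      proof -
        obtain \<delta> where \<delta>: "\<delta> > 0" "\<And>t. 0 < t \<Longrightarrow> t < \<delta> \<Longrightarrow>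
          norm (integral (cbox x (x + t *\<^sub>R One)) H /\<^sub>R t ^ DIM(real^'n) - H x) < e"
          using N(2)[OF x(2) e] by blast
        have "\<forall>\<^sub>F t in at_right 0. x + t *\<^sub>R One \<in> box c d"
        proof -
          have "((\<lambda>t. x + t *\<^sub>R One) \<longlongrightarrow> x + 0 *\<^sub>R One) (at_right 0)"
            by (intro tendsto_intros)
          then have "((\<lambda>t. x + t *\<^sub>R One) \<longlongrightarrow> x) (at_right 0)" by simp
          then show ?thesis by (rule topological_tendstoD) (use x(1) open_box in auto)
        qed
        moreover have "\<forall>\<^sub>F t in at_right 0. t < \<delta>"
          using \<delta>(1) by (auto simp: eventually_at_right_field)
        moreover have "\<forall>\<^sub>F t in at_right 0. (0::real) < t"
          by (simp add: eventually_at_right_less)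
        ultimately have "\<forall>\<^sub>F t in at_right 0. x + t *\<^sub>R One \<in> box c d \<and> t < \<delta> \<and> (0::real) < t"
          by eventually_elim auto
        then obtain t where t: "x + t *\<^sub>R One \<in> box c d" "t < \<delta>" "t > 0"
          using eventually_happens' trivial_limit_at_right_real by (metis (no_types, lifting))
        have sub: "cbox x (x + t *\<^sub>R One) \<subseteq> cbox c d"
          using x(1) t(1) box_subset_cbox[of c d] by (intro subset_box_imp) (auto simp: mem_box)
        have "integral (cbox x (x + t *\<^sub>R One)) H = integral (cbox x (x + t *\<^sub>R One)) h"
          using sub by (intro integral_cong) (auto simp: H_def)
        also have "\<dots> = integral (box x (x + t *\<^sub>R One)) h"
          by (simp add: integral_open_interval)
        also have "\<dots> = (LINT y:box x (x + t *\<^sub>R One)|lebesgue. h y)"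
        proof (rule set_lebesgue_integral_eq_integral(2)[symmetric])
          show "h absolutely_integrable_on box x (x + t *\<^sub>R One)"
            by (rule set_integrable_subset[OF int])
               (use sub box_subset_cbox[of x "x + t *\<^sub>R One"] in auto)
        qed
        also have "\<dots> = 0" using sub cd by (intro box0) auto
        finally show ?thesis using \<delta>(2)[OF t(3,2)] by simp
      qed
      then have "H x = 0" by (meson less_irrefl norm_not_less_zero zero_less_norm_iff)
      then show ?thesis using x(1) box_subset_cbox[of c d] by (auto simp: H_def)
    qed
    then have "{x \<in> box c d. h x \<noteq> 0} \<subseteq> N" by auto
    then show ?thesis using N(1) negligible_subset by blast
  qed
  have "negligible {x \<in> \<Omega>. h x \<noteq> 0}"
  proof -
    obtain \<D> where \<D>: "countable \<D>" "\<D> \<subseteq> Pow \<Omega>" "\<And>X. X \<in> \<D> \<Longrightarrow> \<exists>a b. X = cbox a b" "\<Union>\<D> = \<Omega>"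
      using open_countable_Union_open_cbox[OF assms(1)] by metis
    have "negligible {x \<in> X. h x \<noteq> 0}" if "X \<in> \<D>" for X
    proof -
      obtain a b where X: "X = cbox a b" "cbox a b \<subseteq> \<Omega>" using \<D>(2,3) \<open>X \<in> \<D>\<close> by blast
      have "{x \<in> X. h x \<noteq> 0} \<subseteq> {x \<in> box a b. h x \<noteq> 0} \<union> (cbox a b - box a b)" using X by auto
      then show ?thesis
        using negligible_subset negligible_Un[OF local[OF X(2)] negligible_frontier_interval] by blast
    qed
    note local = this
    have "{x \<in> \<Omega>. h x \<noteq> 0} = \<Union>((\<lambda>X. {x \<in> X. h x \<noteq> 0}) ` \<D>)" using \<D>(4) by auto
    also have "negligible \<dots>"
      using \<D>(1) local by (intro negligible_countable_Union) auto
    finally show ?thesis .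
  qed
  then have "{x \<in> \<Omega>. h x \<noteq> 0} \<in> null_sets lebesgue" by (simp add: negligible_iff_null_sets)
  then show ?thesis by (rule AE_I') auto
qed

section \<open>Differentiability of Lipschitz functions on the line\<close>

text \<open>
  Both \<open>F\<close> and \<open>x - F x\<close> are increasing, and their Stieltjes measures add up to Lebesgue measure.
\<close>

lemma interval_measure_le_lborel:
  fixes F :: "real \<Rightarrow> real"
  assumes F: "\<And>x y. x \<le> y \<Longrightarrow> F x \<le> F y" "\<And>x y. x \<le> y \<Longrightarrow> F y - F x \<le> y - x"
    and A: "A \<in> sets borel"
  shows "emeasure (interval_measure F) A \<le> emeasure lborel A"
proof -
  have lip: "1-lipschitz_on UNIV F"
  proof (rule lipschitz_onI)
    show "dist (F x) (F y) \<le> 1 * dist x y" for x y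
      using F[of x y] F[of y x] by (cases "x \<le> y") (auto simp: dist_real_def)
  qed auto
  define G where "G x = x - F x" for x
  have contF: "continuous_on S F" for S
    using lipschitz_on_continuous_on[OF lip] continuous_on_subset by blast
  have contG: "continuous_on S G" for S
    unfolding G_def by (intro continuous_intros contF)
  have monoG: "x \<le> y \<Longrightarrow> G x \<le> G y" for x y using F(2)[of x y] by (auto simp: G_def)
  let ?M = "interval_measure F" and ?N = "interval_measure G"
  define S where "S = measure_of UNIV (sets borel) (\<lambda>A. emeasure ?M A + emeasure ?N A)"
  have S: "emeasure S B = emeasure ?M B + emeasure ?N B" if "B \<in> sets borel" for B
    unfolding S_def
  proof (rule emeasure_measure_of_sigma)
    show "sigma_algebra UNIV (sets (borel::real measure))"
      using sets.sigma_algebra_axioms[of "borel::real measure"] by simp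
    show "positive (sets borel) (\<lambda>A. emeasure ?M A + emeasure ?N A)" by (simp add: positive_def)
    show "countably_additive (sets borel) (\<lambda>A. emeasure ?M A + emeasure ?N A)"
      unfolding countably_additive_def
      by (auto simp: suminf_add[symmetric] intro!: arg_cong2[where f="(+)"] suminf_emeasure)
  qed fact
  have setsS: "sets S = sets borel"
    unfolding S_def using sets.sigma_sets_eq[of "borel::real measure"] by (simp add: sets_measure_of_conv)
  have "lborel = S"
  proof (rule lborel_eqI)
    fix l u :: real assume "\<And>b. b \<in> Basis \<Longrightarrow> l \<bullet> b \<le> u \<bullet> b"
    then have lu: "l \<le> u" by simp
    have *: "emeasure (interval_measure K) {l<..<u} = K u - K l"
      if "\<And>x y. x \<le> y \<Longrightarrow> K x \<le> K y" "\<And>S. continuous_on S K" for K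
    proof (cases "l = u")
      case False
      then have "{l<..<u} = {l<..u} - {u..u}" using lu by auto
      then have "emeasure (interval_measure K) {l<..<u} = emeasure (interval_measure K) {l<..u} - emeasure (interval_measure K) {u..u}"
        using lu False that
        by (simp only: ) (intro emeasure_Diff, auto simp: emeasure_interval_measure_Icc simp del: atLeastAtMost_singleton)
      also have "\<dots> = K u - K l"
      proof -
        have "emeasure (interval_measure K) {l<..u} = K u - K l"
          using that lu by (intro emeasure_interval_measure_Ioc) (auto intro: continuous_on_imp_continuous_within)
        moreover have "emeasure (interval_measure K) {u..u} = K u - K u"
          using that by (intro emeasure_interval_measure_Icc) auto
        ultimately show ?thesis by simp
      qed
      finally show ?thesis .
    qed simp
    show "emeasure S (box l u) = (\<Prod>b\<in>Basis. (u - l) \<bullet> b)"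
      using lu F(1)[OF lu] monoG[OF lu]
      by (simp add: S *[OF F(1) contF] *[OF monoG contG] flip: ennreal_plus) (simp add: G_def)
  qed (rule setsS)
  then show ?thesis using S[OF A] by simp
qed

text \<open>
  After adding a linear function and rescaling, the Stieltjes measure of the function is dominated by
  Lebesgue measure, so it has a density.  Lebesgue's differentiation theorem applied to the density
  and to its reflection gives the right and the left derivative, with the same value.
\<close>

lemma lipschitz_real_AE_differentiable:
  fixes F :: "real \<Rightarrow> real"
  assumes "L-lipschitz_on UNIV F"
  shows "AE x in lborel. F differentiable (at x)"
proof -
  define K where "K = L + 1"
  have K: "K > 0" "\<bar>F x - F y\<bar> \<le> K * \<bar>x - y\<bar>" for x y
  proof -
    show "K > 0" using lipschitz_on_nonneg[OF assms] by (simp add: K_def)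
    have "\<bar>F x - F y\<bar> \<le> L * \<bar>x - y\<bar>" using lipschitz_onD[OF assms, of x y] by (simp add: dist_real_def)
    then show "\<bar>F x - F y\<bar> \<le> K * \<bar>x - y\<bar>" by (simp add: K_def distrib_right)
  qed
  \<comment> \<open>Normalised so that both G and x - G x are increasing.\<close>
  define G where "G x = (F x + K * x) / (2 * K)" for x
  have G: "x \<le> y \<Longrightarrow> G x \<le> G y" "x \<le> y \<Longrightarrow> G y - G x \<le> y - x" for x y
  proof -
    have *: "(a + K * x) / (2 * K) \<le> (b + K * y) / (2 * K) \<and> (b + K * y) / (2 * K) - (a + K * x) / (2 * K) \<le> y - x"
      if "x \<le> y" "\<bar>a - b\<bar> \<le> K * \<bar>x - y\<bar>" for a b
    proof -
      have "(b + K * y) / (2 * K) - (a + K * x) / (2 * K) = ((b - a) + K * (y - x)) / (2 * K)"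
        by (simp add: diff_divide_distrib add_divide_distrib right_diff_distrib)
      moreover have "0 \<le> (b - a) + K * (y - x)" "(b - a) + K * (y - x) \<le> (y - x) * (2 * K)"
        using that by (auto simp: algebra_simps abs_le_iff)
      moreover have "((b - a) + K * (y - x)) / (2 * K) \<le> y - x" "0 \<le> ((b - a) + K * (y - x)) / (2 * K)"
        using calculation(2,3) K(1) by (simp_all add: pos_divide_le_eq)
      ultimately show ?thesis by linarith
    qed
    show "x \<le> y \<Longrightarrow> G x \<le> G y" "x \<le> y \<Longrightarrow> G y - G x \<le> y - x"
      using *[OF _ K(2)[of x y]] by (auto simp: G_def)
  qed
  have contG: "continuous_on S G" for S
    unfolding G_def using lipschitz_on_continuous_on[OF assms] K(1)
    by (intro continuous_intros) (auto intro: continuous_on_subset)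
  let ?M = "interval_measure G"
  have "absolutely_continuous lborel ?M"
    unfolding absolutely_continuous_def
  proof
    fix A assume "A \<in> null_sets (lborel::real measure)"
    then show "A \<in> null_sets ?M"
      using interval_measure_le_lborel[of G A] G by (auto simp: null_sets_def)
  qed
  then obtain f where f: "f \<in> borel_measurable lborel" "density lborel f = ?M"
    using sigma_finite_measure.Radon_Nikodym[OF sigma_finite_lborel, of ?M] by auto
  define h where "h x = enn2real (f x)" for x
  have hm[measurable]: "h \<in> borel_measurable borel" using f(1) unfolding h_def by measurable
  have hint: "(h has_integral (G b - G a)) {a..b}" if "a \<le> b" for a b
  proof -
    have e: "(\<integral>\<^sup>+x. f x * indicator {a..b} x \<partial>lborel) = G b - G a"
    proof -
      have "emeasure (density lborel f) {a..b} = (\<integral>\<^sup>+x. f x * indicator {a..b} x \<partial>lborel)"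
        by (rule emeasure_density) (use f(1) in auto)
      moreover have "emeasure ?M {a..b} = G b - G a"
        using that G contG by (intro emeasure_interval_measure_Icc) auto
      ultimately show ?thesis using f(2) by simp
    qed
    have "AE x in lborel. f x * indicator {a..b} x \<noteq> \<infinity>"
      by (rule nn_integral_PInf_AE) (use f(1) e in auto)
    then have "AE x in lborel. f x * indicator {a..b} x = ennreal (h x * indicator {a..b} x)"
      by eventually_elim (auto simp: h_def indicator_def top.not_eq_extremum)
    then have "(\<integral>\<^sup>+x. ennreal (h x * indicator {a..b} x) \<partial>lborel) = G b - G a"
      using e nn_integral_cong_AE by metis
    then have "((\<lambda>x. h x * indicator {a..b} x) has_integral (G b - G a)) UNIV"
    proof (intro nn_integral_has_integral)
      show "(\<lambda>x. h x * indicator {a..b} x) \<in> borel_measurable borel"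
        by (intro borel_measurable_times hm borel_measurable_indicator) auto
      show "0 \<le> h x * indicator {a..b} x" for x by (simp add: h_def)
      show "0 \<le> G b - G a" using G(1)[OF that] by simp
    qed
    moreover have "(\<lambda>x. h x * indicator {a..b} x) = (\<lambda>x. if x \<in> {a..b} then h x else 0)"
      by (auto simp: fun_eq_iff)
    ultimately show ?thesis
      using has_integral_restrict_UNIV[of "{a..b}" h] by simp
  qed
  have hi: "h integrable_on cbox a b" for a b :: real
    using hint[of a b] by (cases "a \<le> b") auto
  obtain N where N: "negligible N" "\<And>x e. \<lbrakk>x \<notin> N; 0 < e\<rbrakk> \<Longrightarrow> \<exists>d>0. \<forall>t. 0 < t \<and> t < d \<longrightarrow>
                         norm(integral (cbox x (x + t *\<^sub>R One)) h /\<^sub>R t ^ DIM(real) - h x) < e"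
    using integrable_ccontinuous_explicit[of h] hi by blast
  have hi': "(\<lambda>x. h (- x)) integrable_on cbox a b" for a b :: real
    using hi[of "-b" "-a"] integrable_reflect[where f=h and b="-a" and a="-b"] by (simp only: minus_minus)
  obtain N' where N': "negligible N'" "\<And>x e. \<lbrakk>x \<notin> N'; 0 < e\<rbrakk> \<Longrightarrow> \<exists>d>0. \<forall>t. 0 < t \<and> t < d \<longrightarrow>
                         norm(integral (cbox x (x + t *\<^sub>R One)) (\<lambda>x. h (-x)) /\<^sub>R t ^ DIM(real) - h (-x)) < e"
    using integrable_ccontinuous_explicit[of "\<lambda>x. h (-x)"] hi' by blast
  have deriv: "(G has_real_derivative h x) (at x)" if x: "x \<notin> N" "- x \<notin> N'" for x
    unfolding DERIV_def LIM_eq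
  proof (intro allI impI)
    fix e :: real assume e: "0 < e"
    obtain d where d: "d > 0" "\<And>t. 0 < t \<Longrightarrow> t < d \<Longrightarrow> \<bar>integral {x..x+t} h / t - h x\<bar> < e"
      using N(2)[OF x(1) e] by (auto simp: divide_inverse mult.commute)
    obtain d' where d': "d' > 0" "\<And>t. 0 < t \<Longrightarrow> t < d' \<Longrightarrow> \<bar>integral {-x..-x+t} (\<lambda>y. h (-y)) / t - h x\<bar> < e"
      using N'(2)[OF x(2) e] by (auto simp: divide_inverse mult.commute)
    have "\<bar>(G (x + t) - G x) / t - h x\<bar> < e" if t: "t \<noteq> 0" "\<bar>t\<bar> < min d d'" for t
    proof (cases "t > 0")
      case True
      then have "integral {x..x+t} h = G (x+t) - G x" using hint[of x "x+t"] by (simp add: integral_unique)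
      then show ?thesis using d(2)[of t] True t by auto
    next
      case False
      then have "integral {x+t..x} h = G x - G (x+t)" using hint[of "x+t" x] by (simp add: integral_unique)
      moreover have "integral {-x..-x+(-t)} (\<lambda>y. h (-y)) = integral {x+t..x} h"
      proof -
        have "{-x..-x+(-t)} = cbox (-x) (-(x+t))" by simp
        then show ?thesis by (simp only: Henstock_Kurzweil_Integration.integral_reflect) simp
      qed
      ultimately have "\<bar>(G x - G (x+t)) / (-t) - h x\<bar> < e" using d'(2)[of "-t"] False t by auto
      moreover have "(G x - G (x+t)) / (-t) = (G (x+t) - G x) / t" using t by (simp add: field_simps)
      ultimately show ?thesis by simp
    qed
    then show "\<exists>s>0. \<forall>xa. xa \<noteq> 0 \<and> norm (xa - 0) < s \<longrightarrow> norm ((G (x + xa) - G x) / xa - h x) < e"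
      using d(1) d'(1) by (intro exI[of _ "min d d'"]) auto
  qed
  have "F differentiable (at x)" if x: "x \<notin> N" "- x \<notin> N'" for x
  proof -
    have "F = (\<lambda>x. 2 * K * G x - K * x)" using K(1) by (auto simp: G_def)
    moreover have "((\<lambda>x. 2 * K * G x - K * x) has_real_derivative (2 * K * h x - K)) (at x)"
      using deriv[OF x] by (auto intro!: derivative_eq_intros)
    ultimately show ?thesis by (auto intro: differentiableI simp: has_field_derivative_def real_differentiable_def)
  qed
  moreover have "AE x in lebesgue. x \<notin> N \<and> - x \<notin> N'"
  proof -
    have "negligible (uminus ` N')" using N'(1)
      by (intro negligible_differentiable_image_negligible) (auto intro!: derivative_intros simp: differentiable_on_def)
    then have "negligible (N \<union> uminus ` N')" using N(1) by (rule negligible_Un[OF _ , rotated])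
    then have "AE x in lebesgue. x \<notin> N \<union> uminus ` N'"
      by (intro AE_not_in) (simp add: negligible_iff_null_sets)
    then show ?thesis by eventually_elim (auto simp: image_iff)
  qed
  ultimately have "AE x in lebesgue. F differentiable (at x)"
    by (rule_tac eventually_mono[of "\<lambda>x. x \<notin> N \<and> - x \<notin> N'"]) blast+
  then show ?thesis by (simp add: AE_completion_iff)
qed

section \<open>Directional derivatives and Rademacher's theorem\<close>

lemma integrable_const_cball: "integrable lborel (\<lambda>x::'a::euclidean_space. c * indicat_real (cball 0 R) x)"
  by (intro integrable_mult_right integrable_real_indicator emeasure_bounded_finite) auto

lemma integrable_AE_bounded_support:
  fixes f :: "'a::euclidean_space \<Rightarrow> real"
  assumes "f \<in> borel_measurable borel" "AE x in lborel. \<bar>f x\<bar> \<le> B \<and> (x \<notin> cball 0 R \<longrightarrow> f x = 0)"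
  shows "integrable lborel f"
proof (rule Bochner_Integration.integrable_bound[OF integrable_const_cball[of B R]])
  show "AE x in lborel. norm (f x) \<le> norm (B * indicat_real (cball 0 R) x)"
    using assms(2) by eventually_elim (auto split: split_indicator)
qed (use assms(1) in simp)

lemma integrable_bounded_times_support:
  fixes h \<phi> :: "'a::euclidean_space \<Rightarrow> real"
  assumes h: "h \<in> borel_measurable borel" "AE x in lborel. \<bar>h x\<bar> \<le> C"
    and \<phi>: "\<phi> \<in> borel_measurable borel" "\<And>x. \<bar>\<phi> x\<bar> \<le> B" "\<And>x. x \<notin> cball 0 R \<Longrightarrow> \<phi> x = 0"
  shows "integrable lborel (\<lambda>x. h x * \<phi> x)"
proof (rule integrable_AE_bounded_support)
  show "AE x in lborel. \<bar>h x * \<phi> x\<bar> \<le> C * B \<and> (x \<notin> cball 0 R \<longrightarrow> h x * \<phi> x = 0)"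
    using h(2)
  proof eventually_elim
    case (elim x)
    then have "\<bar>h x\<bar> * \<bar>\<phi> x\<bar> \<le> C * B" using \<phi>(2)[of x] by (intro mult_mono) auto
    then show ?case using \<phi>(3)[of x] by (auto simp: abs_mult)
  qed
qed (intro borel_measurable_times h \<phi>)

lemma bounded_locally_integrable:
  fixes h :: "'a::euclidean_space \<Rightarrow> real"
  assumes h: "h \<in> borel_measurable borel" "AE x in lborel. \<bar>h x\<bar> \<le> B"
  shows "locally_integrable \<Omega> h"
  unfolding locally_integrable_def
proof (intro allI impI, elim conjE)
  fix C :: "'a set" assume "compact C"
  then obtain R where R: "C \<subseteq> cball 0 R"
    using bounded_subset_ballD[OF compact_imp_bounded, of C 0] ball_subset_cball by blast
  have C: "C \<in> sets borel" using \<open>compact C\<close> by (simp add: borel_compact)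
  have "integrable lborel (\<lambda>x. h x * indicat_real C x)"
    by (rule integrable_bounded_times_support[OF h borel_measurable_indicator[OF C], where B=1 and R=R])
       (use R in \<open>auto split: split_indicator\<close>)
  then have "integrable lborel (\<lambda>x. indicat_real C x *\<^sub>R h x)" by (simp add: mult.commute)
  then show "set_integrable lebesgue C h"
    unfolding set_integrable_def by (subst integrable_completion) (use borel_measurable_integrable in auto)
qed

lemma bounded_support_bounded:
  fixes \<eta> :: "'a::euclidean_space \<Rightarrow> real"
  assumes "continuous_on UNIV \<eta>" "\<And>x. x \<notin> cball 0 R \<Longrightarrow> \<eta> x = 0"
  obtains B where "\<And>x. \<bar>\<eta> x\<bar> \<le> B" "B \<ge> 0"
proof -
  have "bounded (\<eta> ` cball 0 R)"
    by (intro compact_imp_bounded compact_continuous_image continuous_on_subset[OF assms(1)]) auto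
  then obtain B where B: "\<And>x. x \<in> cball 0 R \<Longrightarrow> \<bar>\<eta> x\<bar> \<le> B"
    unfolding bounded_iff by fastforce
  show ?thesis
    by (rule that[of "max B 0"]) (use B assms(2) in \<open>fastforce simp: max_def\<close>)+
qed

lemma integrable_continuous_support:
  fixes f :: "'a::euclidean_space \<Rightarrow> real"
  assumes "continuous_on UNIV f" "\<And>x. x \<notin> cball 0 R \<Longrightarrow> f x = 0"
  shows "integrable lborel f"
proof -
  obtain B where "\<And>x. \<bar>f x\<bar> \<le> B" using bounded_support_bounded[OF assms] by blast
  then show ?thesis
    using assms by (intro integrable_AE_bounded_support[where B=B and R=R] borel_measurable_continuous_onI) auto
qed

lemma lborel_integral_shift:
  fixes f :: "'a::euclidean_space \<Rightarrow> real"
  assumes "f \<in> borel_measurable borel"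
  shows "(LINT x|lborel. f (c + x)) = (LINT x|lborel. f x)"
proof -
  have "(LINT x|distr lborel borel ((+) c). f x) = (LINT x|lborel. f (c + x))"
    by (rule integral_distr) (use assms in auto)
  then show ?thesis by (simp add: lborel_distr_plus)
qed

text \<open>
  Difference quotients along the single sequence \<open>1 / (j + 1)\<close>.  For Lipschitz functions a sequence
  that decreases this slowly controls the full limit, and it keeps measurability a matter of
  countable operations.
\<close>

definition diff_quot :: "'a \<Rightarrow> ('a::euclidean_space \<Rightarrow> real) \<Rightarrow> nat \<Rightarrow> 'a \<Rightarrow> real" where
  "diff_quot w u j x = (u (x + (1 / real (Suc j)) *\<^sub>R w) - u x) * real (Suc j)"

definition dir_deriv :: "'a \<Rightarrow> ('a::euclidean_space \<Rightarrow> real) \<Rightarrow> 'a \<Rightarrow> real" where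
  "dir_deriv w u x = lim (\<lambda>j. diff_quot w u j x)"

lemma diff_quot_bound:
  assumes "L-lipschitz_on UNIV u"
  shows "\<bar>diff_quot w u j x\<bar> \<le> L * norm w"
proof -
  have "\<bar>u (x + (1 / real (Suc j)) *\<^sub>R w) - u x\<bar> \<le> L * norm ((1 / real (Suc j)) *\<^sub>R w)"
    using lipschitz_onD[OF assms, of "x + (1 / real (Suc j)) *\<^sub>R w" x] by (simp add: dist_norm)
  then have "\<bar>diff_quot w u j x\<bar> \<le> L * norm ((1 / real (Suc j)) *\<^sub>R w) * real (Suc j)"
    unfolding diff_quot_def abs_mult by (intro mult_mono) auto
  moreover have "L * norm ((1 / real (Suc j)) *\<^sub>R w) * real (Suc j) = L * norm w"
    by (simp del: of_nat_Suc)
  ultimately show ?thesis by simp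
qed

lemma lipschitz_UNIV_measurable:
  fixes u :: "'a::euclidean_space \<Rightarrow> real"
  shows "L-lipschitz_on UNIV u \<Longrightarrow> u \<in> borel_measurable borel"
  by (intro borel_measurable_continuous_onI lipschitz_on_continuous_on)

lemma diff_quot_measurable:
  "u \<in> borel_measurable borel \<Longrightarrow> diff_quot w u j \<in> borel_measurable borel"
  unfolding diff_quot_def
  by (intro borel_measurable_times borel_measurable_diff borel_measurable_const
      measurable_compose[of "\<lambda>x. x + (1 / real (Suc j)) *\<^sub>R w" borel borel u]) auto

lemma dir_deriv_measurable:
  "u \<in> borel_measurable borel \<Longrightarrow> dir_deriv w u \<in> borel_measurable borel"
  unfolding dir_deriv_def by (intro borel_measurable_lim_metric diff_quot_measurable)

lemma diff_quot_tendsto_has_derivative: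
  assumes "(u has_derivative D) (at x)"
  shows "(\<lambda>j. diff_quot w u j x) \<longlonglongrightarrow> D w"
proof -
  have "((\<lambda>t. x + t *\<^sub>R w) has_derivative (\<lambda>t. t *\<^sub>R w)) (at 0)"
    by (auto intro!: derivative_eq_intros)
  then have "((\<lambda>t. u (x + t *\<^sub>R w)) has_derivative (\<lambda>t. D (t *\<^sub>R w))) (at 0)"
    using has_derivative_compose[of "\<lambda>t. x + t *\<^sub>R w" _ 0 UNIV u D] assms by simp
  moreover have "(\<lambda>t. D (t *\<^sub>R w)) = (*) (D w)"
    using linear_scale[OF has_derivative_linear[OF assms]] by (auto simp: mult.commute)
  ultimately have "((\<lambda>t. u (x + t *\<^sub>R w)) has_real_derivative D w) (at 0)"
    by (simp add: has_field_derivative_def)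
  then have "((\<lambda>h. (u (x + h *\<^sub>R w) - u x) / h) \<longlongrightarrow> D w) (at 0)"
    by (simp add: DERIV_def)
  moreover have "filterlim (\<lambda>j. 1 / real (Suc j)) (at 0) sequentially"
    using LIMSEQ_inverse_real_of_nat unfolding filterlim_at by (simp add: inverse_eq_divide)
  ultimately have "(\<lambda>j. (u (x + (1 / real (Suc j)) *\<^sub>R w) - u x) / (1 / real (Suc j))) \<longlonglongrightarrow> D w"
    by (rule filterlim_compose)
  then show ?thesis by (simp add: diff_quot_def)
qed

lemma dir_deriv_eq: "(u has_derivative D) (at x) \<Longrightarrow> dir_deriv w u x = D w"
  unfolding dir_deriv_def by (intro limI diff_quot_tendsto_has_derivative)

lemma dir_deriv_bound:
  assumes "L-lipschitz_on UNIV u" "(\<lambda>j. diff_quot w u j x) \<longlonglongrightarrow> dir_deriv w u x"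
  shows "\<bar>dir_deriv w u x\<bar> \<le> L * norm w"
  by (rule LIMSEQ_le_const2[OF tendsto_rabs[OF assms(2)]]) (use diff_quot_bound[OF assms(1)] in auto)

text \<open>
  On each line parallel to \<open>w\<close> the exceptional set \<open>N\<close> is a null set by the one-dimensional theorem.
  That \<open>N\<close> is a null set follows without any choice of coordinates: integrate the indicator of
  \<open>x + t w \<in> N\<close> over all \<open>x\<close> and over \<open>0 \<le> t \<le> 1\<close>.  In one order translation invariance gives the
  measure of \<open>N\<close>, in the other order the result is \<open>0\<close>.
\<close>

lemma lipschitz_AE_dir_deriv:
  fixes u :: "'a::euclidean_space \<Rightarrow> real"
  assumes u: "L-lipschitz_on UNIV u"
  shows "AE x in lborel. (\<lambda>j. diff_quot w u j x) \<longlonglongrightarrow> dir_deriv w u x"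
proof -
  have um: "u \<in> borel_measurable borel" by (rule lipschitz_UNIV_measurable[OF u])
  define N where "N = {x. \<not> Cauchy (\<lambda>j. diff_quot w u j x)}"
  have N_sets[measurable]: "N \<in> sets borel"
  proof -
    have "{x \<in> space borel. Cauchy (\<lambda>j. diff_quot w u j x)} \<in> sets borel"
      by (rule sets_Collect_Cauchy[OF diff_quot_measurable[OF um]])
    then have "space borel - {x \<in> space borel. Cauchy (\<lambda>j. diff_quot w u j x)} \<in> sets borel" by blast
    moreover have "space borel - {x \<in> space borel. Cauchy (\<lambda>j. diff_quot w u j x)} = N"
      by (auto simp: N_def)
    ultimately show ?thesis by (simp only:)
  qed
  \<comment> \<open>The difference quotients of the restriction of \<open>u\<close> to a line parallel to \<open>w\<close> are those of \<open>u\<close>.\<close>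
  have line: "AE t in lborel. x + t *\<^sub>R w \<notin> N" for x
  proof -
    have "(L * norm w)-lipschitz_on UNIV (\<lambda>t. u (x + t *\<^sub>R w))"
    proof (rule lipschitz_onI)
      fix s t :: real
      have "dist (u (x + s *\<^sub>R w)) (u (x + t *\<^sub>R w)) \<le> L * norm (s *\<^sub>R w - t *\<^sub>R w)"
        using lipschitz_onD[OF u, of "x + s *\<^sub>R w" "x + t *\<^sub>R w"] by (simp add: dist_norm)
      also have "\<dots> = L * norm w * dist s t"
        by (simp add: scaleR_left_diff_distrib[symmetric] dist_real_def)
      finally show "dist (u (x + s *\<^sub>R w)) (u (x + t *\<^sub>R w)) \<le> L * norm w * dist s t" .
    qed (use lipschitz_on_nonneg[OF u] in simp)
    from lipschitz_real_AE_differentiable[OF this] show ?thesis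
    proof eventually_elim
      case (elim t)
      then obtain D where D: "((\<lambda>t. u (x + t *\<^sub>R w)) has_derivative D) (at t)"
        by (auto simp: differentiable_def)
      from diff_quot_tendsto_has_derivative[OF D, of 1]
      have "(\<lambda>j. diff_quot w u j (x + t *\<^sub>R w)) \<longlonglongrightarrow> D 1"
        by (simp add: diff_quot_def scaleR_add_left add.assoc)
      then show ?case by (auto simp: N_def dest: LIMSEQ_imp_Cauchy)
    qed
  qed
  have "emeasure lborel N = (\<integral>\<^sup>+t. emeasure lborel N * indicator {0..1::real} t \<partial>lborel)"
    by (simp add: nn_integral_cmult)
  also have "\<dots> = (\<integral>\<^sup>+t. (\<integral>\<^sup>+x. indicator N (x + t *\<^sub>R w) * indicator {0..1} t \<partial>lborel) \<partial>lborel)"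
  proof (intro nn_integral_cong)
    fix t :: real
    have "emeasure lborel N = (\<integral>\<^sup>+x. indicator N x \<partial>distr lborel borel ((+) (t *\<^sub>R w)))"
      by (simp add: lborel_distr_plus)
    also have "\<dots> = (\<integral>\<^sup>+x. indicator N (x + t *\<^sub>R w) \<partial>lborel)"
      by (subst nn_integral_distr) (auto simp: add.commute)
    finally have "emeasure lborel N = (\<integral>\<^sup>+x. indicator N (x + t *\<^sub>R w) \<partial>lborel)" .
    then show "emeasure lborel N * indicator {0..1} t = (\<integral>\<^sup>+x. indicator N (x + t *\<^sub>R w) * indicator {0..1} t \<partial>lborel)"
      by (subst nn_integral_multc) auto
  qed
  \<comment> \<open>Tonelli: the inner integral now runs along a line and vanishes.\<close>
  also have "\<dots> = (\<integral>\<^sup>+x. (\<integral>\<^sup>+t. indicator N (x + t *\<^sub>R w) * indicator {0..1} t \<partial>lborel) \<partial>lborel)"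
    by (rule lborel_pair.Fubini') (auto simp: case_prod_beta)
  also have "\<dots> = (\<integral>\<^sup>+(x::'a). 0 \<partial>lborel)"
  proof (intro nn_integral_cong)
    fix x
    have "(\<integral>\<^sup>+t. indicator N (x + t *\<^sub>R w) * indicator {0..1} t \<partial>lborel) = (\<integral>\<^sup>+(t::real). 0 \<partial>lborel)"
      using line[of x] by (intro nn_integral_cong_AE) (auto elim!: eventually_mono simp: indicator_def)
    then show "(\<integral>\<^sup>+t. indicator N (x + t *\<^sub>R w) * indicator {0..1} t \<partial>lborel) = 0" by simp
  qed
  finally have "N \<in> null_sets lborel" by (simp add: null_sets_def)
  then have "AE x in lborel. x \<notin> N" by (rule AE_not_in)
  then show ?thesis
  proof eventually_elim
    case (elim x)
    then have "convergent (\<lambda>j. diff_quot w u j x)" by (simp add: N_def Cauchy_convergent_iff)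
    then show ?case by (simp add: dir_deriv_def convergent_LIMSEQ_iff)
  qed
qed

lemma lipschitz_AE_dir_deriv_bound:
  fixes u :: "'a::euclidean_space \<Rightarrow> real"
  assumes u: "L-lipschitz_on UNIV u"
  shows "AE x in lborel. \<bar>dir_deriv w u x\<bar> \<le> L * norm w"
  using lipschitz_AE_dir_deriv[OF u, of w] by eventually_elim (rule dir_deriv_bound[OF u])

lemma diff_quot_outside:
  assumes "\<And>x. x \<notin> cball 0 R \<Longrightarrow> \<eta> x = 0" "x \<notin> cball 0 (R + norm w)"
  shows "diff_quot w \<eta> j x = 0"
proof -
  have "norm ((1 / real (Suc j)) *\<^sub>R w) \<le> norm w"
    by (simp add: field_simps)
  then have "norm x \<le> norm (x + (1 / real (Suc j)) *\<^sub>R w) + norm w"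
    using norm_triangle_ineq4[of "x + (1 / real (Suc j)) *\<^sub>R w" "(1 / real (Suc j)) *\<^sub>R w"] by simp
  then have "x + (1 / real (Suc j)) *\<^sub>R w \<notin> cball 0 R" "x \<notin> cball 0 R"
    using assms(2) norm_ge_zero[of w] by (auto simp del: norm_ge_zero)
  then show ?thesis using assms(1) by (simp add: diff_quot_def)
qed

text \<open>
  Translation invariance of Lebesgue measure moves the shift from \<open>u\<close> to \<open>\<eta>\<close>.
\<close>

lemma diff_quot_integral_by_parts:
  fixes u \<eta> :: "'a::euclidean_space \<Rightarrow> real"
  assumes u: "continuous_on UNIV u" and \<eta>: "continuous_on UNIV \<eta>" "\<And>x. x \<notin> cball 0 R \<Longrightarrow> \<eta> x = 0"
  shows "(LINT x|lborel. diff_quot w u j x * \<eta> x) = (LINT x|lborel. u x * diff_quot (- w) \<eta> j x)"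
proof -
  define c where "c = (1 / real (Suc j)) *\<^sub>R w"
  have int: "integrable lborel (\<lambda>x. u (x + a) * \<eta> (x + b))" for a b
  proof -
    have cont: "continuous_on UNIV (\<lambda>x. u (x + a) * \<eta> (x + b))"
      by (intro continuous_on_mult continuous_on_compose2[OF u] continuous_on_compose2[OF \<eta>(1)] continuous_intros) auto
    have out: "u (x + a) * \<eta> (x + b) = 0" if "x \<notin> cball 0 (R + norm b)" for x
    proof -
      have "norm x \<le> norm (x + b) + norm b" using norm_triangle_ineq4[of "x + b" b] by simp
      then show ?thesis using that \<eta>(2)[of "x + b"] by auto
    qed
    show ?thesis by (rule integrable_continuous_support[OF cont out])
  qed
  have um: "u \<in> borel_measurable borel" "\<eta> \<in> borel_measurable borel"
    using u \<eta> by (auto intro: borel_measurable_continuous_onI)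
  have "(LINT x|lborel. (u (x + c) - u x) * \<eta> x) = (LINT x|lborel. u (x + c) * \<eta> x) - (LINT x|lborel. u x * \<eta> x)"
    using int[of c 0] int[of 0 0] by (subst Bochner_Integration.integral_diff[symmetric]) (auto simp: algebra_simps)
  also have "(LINT x|lborel. u (x + c) * \<eta> x) = (LINT x|lborel. u x * \<eta> (x - c))"
  proof -
    have "(\<lambda>x. u x * \<eta> (x - c)) \<in> borel_measurable borel"
      using borel_measurable_integrable[OF int[of 0 "-c"]] by simp
    from lborel_integral_shift[OF this, of c] show ?thesis by (simp add: add.commute)
  qed
  also have "(LINT x|lborel. u x * \<eta> (x - c)) - (LINT x|lborel. u x * \<eta> x) = (LINT x|lborel. u x * (\<eta> (x - c) - \<eta> x))"
    using int[of 0 "-c"] int[of 0 0] by (subst Bochner_Integration.integral_diff[symmetric]) (auto simp: algebra_simps)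
  finally have "(LINT x|lborel. (u (x + c) - u x) * \<eta> x) * real (Suc j) = (LINT x|lborel. u x * (\<eta> (x - c) - \<eta> x)) * real (Suc j)"
    by simp
  then have "(LINT x|lborel. (u (x + c) - u x) * \<eta> x * real (Suc j)) = (LINT x|lborel. u x * (\<eta> (x - c) - \<eta> x) * real (Suc j))"
    by (simp del: of_nat_Suc)
  then show ?thesis by (simp add: diff_quot_def c_def algebra_simps)
qed

text \<open>
  The derivative of \<open>\<eta>\<close> is taken along \<open>- w\<close> instead of writing \<open>- dir_deriv w \<eta>\<close>, because the two
  one-sided derivatives are known to agree almost everywhere only after Rademacher's theorem.
\<close>

lemma dir_deriv_integral_by_parts:
  fixes u \<eta> :: "'a::euclidean_space \<Rightarrow> real"
  assumes u: "L-lipschitz_on UNIV u" and \<eta>: "K-lipschitz_on UNIV \<eta>" "\<And>x. x \<notin> cball 0 R \<Longrightarrow> \<eta> x = 0"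
  shows "(LINT x|lborel. dir_deriv w u x * \<eta> x) = (LINT x|lborel. u x * dir_deriv (- w) \<eta> x)"
proof -
  have um: "u \<in> borel_measurable borel" "\<eta> \<in> borel_measurable borel"
    using u \<eta> by (auto intro: lipschitz_UNIV_measurable)
  have cont: "continuous_on UNIV u" "continuous_on UNIV \<eta>"
    using u \<eta> lipschitz_on_continuous_on by blast+
  obtain B where B: "\<And>x. \<bar>\<eta> x\<bar> \<le> B" "B \<ge> 0" using bounded_support_bounded[OF cont(2) \<eta>(2)] by blast
  have "compact (u ` cball 0 (R + norm w))"
    by (intro compact_continuous_image continuous_on_subset[OF cont(1)]) auto
  then obtain B' where B': "\<And>x. x \<in> cball 0 (R + norm w) \<Longrightarrow> \<bar>u x\<bar> \<le> B'"
    using compact_imp_bounded[of "u ` cball 0 (R + norm w)"] unfolding bounded_iff by fastforce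
  have "(\<lambda>j. LINT x|lborel. diff_quot w u j x * \<eta> x) \<longlonglongrightarrow> (LINT x|lborel. dir_deriv w u x * \<eta> x)"
  proof (rule integral_dominated_convergence[where w = "\<lambda>x. L * norm w * B * indicator (cball 0 R) x"])
    show "integrable lborel (\<lambda>x. L * norm w * B * indicat_real (cball 0 R) x)"
      by (rule integrable_const_cball)
    show "AE x in lborel. (\<lambda>j. diff_quot w u j x * \<eta> x) \<longlonglongrightarrow> dir_deriv w u x * \<eta> x"
      using lipschitz_AE_dir_deriv[OF u] by eventually_elim (auto intro: tendsto_intros)
    show "AE x in lborel. norm (diff_quot w u j x * \<eta> x) \<le> L * norm w * B * indicator (cball 0 R) x" for j
    proof (rule AE_I2)
      fix x
      have "\<bar>diff_quot w u j x\<bar> * \<bar>\<eta> x\<bar> \<le> (L * norm w) * B"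
        using diff_quot_bound[OF u, of w j x] B by (intro mult_mono) auto
      then show "norm (diff_quot w u j x * \<eta> x) \<le> L * norm w * B * indicator (cball 0 R) x"
        using \<eta>(2)[of x] by (auto simp: indicator_def abs_mult)
    qed
  qed (use dir_deriv_measurable diff_quot_measurable um in \<open>auto intro!: borel_measurable_times\<close>)
  moreover have "(\<lambda>j. LINT x|lborel. u x * diff_quot (- w) \<eta> j x) \<longlonglongrightarrow> (LINT x|lborel. u x * dir_deriv (- w) \<eta> x)"
  proof (rule integral_dominated_convergence[where w = "\<lambda>x. B' * (K * norm w) * indicator (cball 0 (R + norm w)) x"])
    show "integrable lborel (\<lambda>x. B' * (K * norm w) * indicat_real (cball 0 (R + norm w)) x)"
      by (rule integrable_const_cball)
    show "AE x in lborel. (\<lambda>j. u x * diff_quot (- w) \<eta> j x) \<longlonglongrightarrow> u x * dir_deriv (- w) \<eta> x"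
      using lipschitz_AE_dir_deriv[OF \<eta>(1), of "-w"] by eventually_elim (auto intro: tendsto_intros)
    show "AE x in lborel. norm (u x * diff_quot (- w) \<eta> j x) \<le> B' * (K * norm w) * indicator (cball 0 (R + norm w)) x" for j
    proof (rule AE_I2)
      fix x
      show "norm (u x * diff_quot (- w) \<eta> j x) \<le> B' * (K * norm w) * indicator (cball 0 (R + norm w)) x"
      proof (cases "x \<in> cball 0 (R + norm w)")
        case True
        have "\<bar>u x\<bar> * \<bar>diff_quot (- w) \<eta> j x\<bar> \<le> B' * (K * norm w)"
          using diff_quot_bound[OF \<eta>(1), of "-w" j x] B'[OF True] by (intro mult_mono) auto
        then show ?thesis using True by (simp add: abs_mult)
      next
        case False
        then show ?thesis using diff_quot_outside[where \<eta>=\<eta> and R=R and x=x and w="-w" and j=j] \<eta>(2) by simp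
      qed
    qed
  qed (use dir_deriv_measurable diff_quot_measurable um in \<open>auto intro!: borel_measurable_times\<close>)
  ultimately show ?thesis
    using LIMSEQ_unique diff_quot_integral_by_parts[OF cont \<eta>(2), of R w] by auto
qed

lemma test_function_derivative:
  fixes \<phi> :: "real^'n::finite \<Rightarrow> real"
  assumes \<phi>: "\<phi> \<in> test_functions \<Omega>"
  shows "(\<phi> has_derivative (\<lambda>h. \<Sum>i\<in>UNIV. h $ i * partial i \<phi> x)) (at x)"
    and "continuous_on UNIV (partial i \<phi>)"
    and "x \<notin> closure {x. \<phi> x \<noteq> 0} \<Longrightarrow> partial i \<phi> x = 0"
proof -
  let ?D = "frechet_derivative \<phi> (at x)"
  have "Ck (Suc 0) \<phi>" using \<phi> by (simp add: test_functions_def)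
  then have der: "(\<phi> has_derivative ?D) (at x)" and "continuous_on UNIV (partial i \<phi>)"
    by (auto simp: frechet_derivative_works)
  then show "continuous_on UNIV (partial i \<phi>)" by simp
  have lin: "linear ?D" using der by (rule has_derivative_linear)
  have "?D h = (\<Sum>i\<in>UNIV. h $ i * partial i \<phi> x)" for h
  proof -
    have "?D h = ?D (\<Sum>i\<in>UNIV. h $ i *\<^sub>R axis i 1)"
      by (simp add: basis_expansion[of h, unfolded scalar_mult_eq_scaleR])
    then show ?thesis by (simp add: linear_sum[OF lin] linear_scale[OF lin] partial_def)
  qed
  then have "?D = (\<lambda>h. \<Sum>i\<in>UNIV. h $ i * partial i \<phi> x)" by (rule ext)
  then show "(\<phi> has_derivative (\<lambda>h. \<Sum>i\<in>UNIV. h $ i * partial i \<phi> x)) (at x)" using der by simp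
  assume x: "x \<notin> closure {x. \<phi> x \<noteq> 0}"
  have "((\<lambda>x. 0) has_derivative (\<lambda>h. 0)) (at x)" by simp
  then have "(\<phi> has_derivative (\<lambda>h. 0)) (at x)"
    by (rule has_derivative_transform_within_open[of _ _ _ _ "- closure {x. \<phi> x \<noteq> 0}"])
       (use x closure_subset[of "{x. \<phi> x \<noteq> 0}"] in auto)
  then have "?D = (\<lambda>h. 0)" using frechet_derivative_at by metis
  then show "partial i \<phi> x = 0" by (simp add: partial_def)
qed

lemma dir_deriv_test_function:
  "\<phi> \<in> test_functions \<Omega> \<Longrightarrow> dir_deriv w \<phi> x = (\<Sum>i\<in>UNIV. w $ i * partial i \<phi> x)"
  by (rule dir_deriv_eq[OF test_function_derivative(1)])

lemma test_function_lipschitz: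
  fixes \<phi> :: "real^'n::finite \<Rightarrow> real"
  assumes \<phi>: "\<phi> \<in> test_functions \<Omega>"
  obtains K R where "K-lipschitz_on UNIV \<phi>" "\<And>x. x \<notin> cball 0 R \<Longrightarrow> \<phi> x = 0"
    "\<And>i x. x \<notin> cball 0 R \<Longrightarrow> partial i \<phi> x = 0"
proof -
  let ?S = "closure {x. \<phi> x \<noteq> 0}"
  have "compact ?S" using \<phi> by (simp add: test_functions_def)
  then obtain R where "?S \<subseteq> cball 0 R"
    using bounded_subset_ballD[OF compact_imp_bounded, of ?S 0] ball_subset_cball by blast
  then have out: "\<phi> x = 0" "partial i \<phi> x = 0" if "x \<notin> cball 0 R" for x i
    using that closure_subset[of "{x. \<phi> x \<noteq> 0}"] test_function_derivative(3)[OF \<phi>] by blast+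
  have "\<exists>B. \<forall>x. \<bar>partial i \<phi> x\<bar> \<le> B" for i
    using bounded_support_bounded[OF test_function_derivative(2)[OF \<phi>] out(2)] by metis
  then obtain B where B: "\<And>i x. \<bar>partial i \<phi> x\<bar> \<le> B i" by metis
  have on: "onorm (\<lambda>h. \<Sum>i\<in>UNIV. h $ i * partial i \<phi> x) \<le> (\<Sum>i\<in>UNIV. B i)" for x
  proof (rule onorm_le)
    fix h :: "real^'n"
    have "\<bar>\<Sum>i\<in>UNIV. h $ i * partial i \<phi> x\<bar> \<le> (\<Sum>i\<in>UNIV. norm h * B i)"
    proof (rule order_trans[OF sum_abs sum_mono])
      fix i
      show "\<bar>h $ i * partial i \<phi> x\<bar> \<le> norm h * B i"
        unfolding abs_mult using B[of i x] component_le_norm_cart[of h i] by (intro mult_mono) auto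
    qed
    then show "norm (\<Sum>i\<in>UNIV. h $ i * partial i \<phi> x) \<le> (\<Sum>i\<in>UNIV. B i) * norm h"
      by (simp add: sum_distrib_left mult.commute)
  qed
  have "(\<Sum>i\<in>UNIV. B i)-lipschitz_on UNIV \<phi>"
  proof (rule lipschitz_onI)
    show "dist (\<phi> x) (\<phi> y) \<le> (\<Sum>i\<in>UNIV. B i) * dist x y" for x y
      using differentiable_bound[OF convex_UNIV has_derivative_at_withinI[OF test_function_derivative(1)[OF \<phi>]] on, of x y]
      by (simp add: dist_norm)
    show "0 \<le> (\<Sum>i\<in>UNIV. B i)" using B by (intro sum_nonneg) (meson abs_ge_zero order_trans)
  qed
  then show ?thesis using that out by blast
qed

text \<open>
  Linearity in the direction is clear for smooth functions.  Integration by parts transfers it to \<open>u\<close> when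
  tested against smooth functions, and the fundamental lemma removes the test functions.
\<close>

lemma AE_dir_deriv_linear:
  fixes u :: "real^'n::finite \<Rightarrow> real"
  assumes u: "L-lipschitz_on UNIV u"
  shows "AE x in lborel. dir_deriv w u x = w \<bullet> (\<chi> i. dir_deriv (axis i 1) u x)"
proof -
  have um: "u \<in> borel_measurable borel" by (rule lipschitz_UNIV_measurable[OF u])
  define h where "h x = dir_deriv w u x - (\<Sum>i\<in>UNIV. w $ i * dir_deriv (axis i 1) u x)" for x
  have hm: "h \<in> borel_measurable borel" unfolding h_def
    by (intro borel_measurable_diff borel_measurable_sum borel_measurable_times borel_measurable_const dir_deriv_measurable um)
  note bound = lipschitz_AE_dir_deriv_bound[OF u]
  have "AE x in lebesgue. x \<in> UNIV \<longrightarrow> h x = 0"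
  proof (rule AE_zero_if_test_integrals_zero[OF open_UNIV])
    show "locally_integrable UNIV h"
    proof (rule bounded_locally_integrable[OF hm])
      have "AE x in lborel. \<forall>i. \<bar>dir_deriv (axis i 1) u x\<bar> \<le> L"
        unfolding AE_all_countable using bound[of "axis _ 1"] by simp
      with bound[of w] show "AE x in lborel. \<bar>h x\<bar> \<le> L * norm w + (\<Sum>i\<in>UNIV. \<bar>w $ i\<bar> * L)"
      proof eventually_elim
        case (elim x)
        have "\<bar>\<Sum>i\<in>UNIV. w $ i * dir_deriv (axis i 1) u x\<bar> \<le> (\<Sum>i\<in>UNIV. \<bar>w $ i\<bar> * L)"
          by (rule order_trans[OF sum_abs sum_mono]) (use elim(2) in \<open>auto simp: abs_mult intro: mult_left_mono\<close>)
        then show ?case using elim(1) unfolding h_def by linarith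
      qed
    qed
    fix \<phi> :: "real^'n \<Rightarrow> real" assume \<phi>: "\<phi> \<in> test_functions UNIV"
    obtain K R where KR: "K-lipschitz_on UNIV \<phi>" "\<And>x. x \<notin> cball 0 R \<Longrightarrow> \<phi> x = 0"
      "\<And>i x. x \<notin> cball 0 R \<Longrightarrow> partial i \<phi> x = 0"
      using test_function_lipschitz[OF \<phi>] by blast
    have pm: "\<phi> \<in> borel_measurable borel" by (rule lipschitz_UNIV_measurable[OF KR(1)])
    obtain B where B: "\<And>x. \<bar>\<phi> x\<bar> \<le> B"
      using bounded_support_bounded[OF lipschitz_on_continuous_on[OF KR(1)] KR(2)] by blast
    have int: "integrable lborel (\<lambda>x. dir_deriv a u x * \<phi> x)" for a
      by (rule integrable_bounded_times_support[OF dir_deriv_measurable[OF um] bound pm B KR(2)])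
    define I where "I i = (LINT x|lborel. u x * partial i \<phi> x)" for i
    have intI: "integrable lborel (\<lambda>x. u x * partial i \<phi> x)" for i
      by (rule integrable_continuous_support[where R=R])
         (auto intro!: continuous_on_mult lipschitz_on_continuous_on[OF u] test_function_derivative(2)[OF \<phi>] simp: KR(3))
    have parts: "(LINT x|lborel. dir_deriv a u x * \<phi> x) = - (\<Sum>i\<in>UNIV. a $ i * I i)" for a
    proof -
      have "(LINT x|lborel. dir_deriv a u x * \<phi> x) = (LINT x|lborel. u x * dir_deriv (- a) \<phi> x)"
        using dir_deriv_integral_by_parts[OF u KR(1), where R=R] KR(2) by blast
      also have "\<dots> = (LINT x|lborel. (\<Sum>i\<in>UNIV. - a $ i * (u x * partial i \<phi> x)))"
        by (simp add: dir_deriv_test_function[OF \<phi>] sum_distrib_left mult.left_commute)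
      also have "\<dots> = (\<Sum>i\<in>UNIV. - a $ i * I i)"
        unfolding I_def by (subst Bochner_Integration.integral_sum) (auto intro: intI)
      finally show ?thesis by (simp add: sum_negf)
    qed
    have i2: "integrable lborel (\<lambda>x. \<Sum>i\<in>UNIV. w $ i * (dir_deriv (axis i 1) u x * \<phi> x))"
      by (intro Bochner_Integration.integrable_sum integrable_mult_right int)
    have "(LINT x|lborel. h x * \<phi> x) = (LINT x|lborel. dir_deriv w u x * \<phi> x - (\<Sum>i\<in>UNIV. w $ i * (dir_deriv (axis i 1) u x * \<phi> x)))"
      by (simp add: h_def left_diff_distrib sum_distrib_right mult.assoc)
    also have "\<dots> = (LINT x|lborel. dir_deriv w u x * \<phi> x) - (LINT x|lborel. (\<Sum>i\<in>UNIV. w $ i * (dir_deriv (axis i 1) u x * \<phi> x)))"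
      by (rule Bochner_Integration.integral_diff[OF int i2])
    also have "(LINT x|lborel. (\<Sum>i\<in>UNIV. w $ i * (dir_deriv (axis i 1) u x * \<phi> x))) =
        (\<Sum>i\<in>UNIV. w $ i * (LINT x|lborel. dir_deriv (axis i 1) u x * \<phi> x))"
      by (subst Bochner_Integration.integral_sum) (auto intro: int)
    also have "\<dots> = - (\<Sum>i\<in>UNIV. w $ i * I i)"
      by (simp add: parts axis_def if_distrib[of "\<lambda>c. c * _"] sum_negf cong: if_cong)
    finally have "(LINT x|lborel. h x * \<phi> x) = 0" by (simp add: parts)
    moreover have "(LINT x|lebesgue. h x * \<phi> x) = (LINT x|lborel. h x * \<phi> x)"
      by (rule integral_completion) (use borel_measurable_times[OF hm pm] in simp)
    ultimately show "(LINT x:UNIV|lebesgue. h x * \<phi> x) = 0" by (simp add: set_lebesgue_integral_def)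
  qed
  then have "AE x in lborel. h x = 0" by (simp add: AE_completion_iff)
  then show ?thesis by eventually_elim (simp add: h_def inner_vec_def)
qed

text \<open>
  A Lipschitz function whose derivatives along a dense set of directions are given by one vector \<open>g\<close> is
  differentiable: finitely many of the directions approximate the unit sphere, and the Lipschitz
  bound controls both the error in the direction and the error from replacing the length of the
  increment by some \<open>1 / (j + 1)\<close>.
\<close>

lemma gderiv_if_dense_dir_derivs:
  fixes u :: "'a::euclidean_space \<Rightarrow> real"
  assumes u: "L-lipschitz_on UNIV u"
    and dense: "\<And>X. open X \<Longrightarrow> X \<noteq> {} \<Longrightarrow> \<exists>w\<in>D. w \<in> X"
    and lim: "\<And>w. w \<in> D \<Longrightarrow> (\<lambda>j. diff_quot w u j x) \<longlonglongrightarrow> w \<bullet> g"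
  shows "GDERIV u x :> g"
  unfolding gderiv_def has_derivative_at_alt
proof (intro conjI allI impI)
  show "bounded_linear (\<lambda>h. h \<bullet> g)" by (rule bounded_linear_inner_left)
  fix e :: real assume e: "e > 0"
  define C where "C = L + norm g + 1"
  have C: "C > 0" using lipschitz_on_nonneg[OF u] by (simp add: C_def add_nonneg_pos)
  define \<delta> where "\<delta> = min 1 (e / (3 * C))"
  have \<delta>: "\<delta> > 0" "\<delta> \<le> 1" "C * \<delta> \<le> e / 3"
    using e C by (auto simp: \<delta>_def min_def field_simps)
  have "sphere 0 1 \<subseteq> (\<Union>w\<in>D. ball w \<delta>)"
  proof
    fix y :: 'a
    obtain w where "w \<in> D" "w \<in> ball y \<delta>" using dense[of "ball y \<delta>"] \<delta>(1) by auto
    then show "y \<in> (\<Union>w\<in>D. ball w \<delta>)" by (auto simp: dist_commute)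
  qed
  then obtain W where W: "W \<subseteq> D" "finite W" "sphere 0 1 \<subseteq> (\<Union>w\<in>W. ball w \<delta>)"
    using compactE_image[of "sphere 0 1" D "\<lambda>w. ball w \<delta>"] by auto
  have "\<forall>\<^sub>F j in sequentially. \<forall>w\<in>W. \<bar>diff_quot w u j x - w \<bullet> g\<bar> < e / 3"
    unfolding eventually_ball_finite_distrib[OF W(2)]
    using tendstoD[OF lim, of _ "e/3"] W(1) e by (auto simp: dist_real_def)
  then obtain J where J: "\<And>j w. j \<ge> J \<Longrightarrow> w \<in> W \<Longrightarrow> \<bar>diff_quot w u j x - w \<bullet> g\<bar> < e / 3"
    by (auto simp: eventually_sequentially)
  define d where "d = min (1 / (real J + 1)) (e / (6 * C))"
  have d: "d > 0" using e C by (simp add: d_def)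
  have "norm (u y - u x - (y - x) \<bullet> g) \<le> e * norm (y - x)" if y: "norm (y - x) < d" for y
  proof (cases "y = x")
    case False
    define t where "t = norm (y - x)"
    have t: "t > 0" "t < 1 / (real J + 1)" "t < e / (6 * C)" using False y by (auto simp: t_def d_def)
    have "(1 / t) *\<^sub>R (y - x) \<in> sphere 0 1" using t(1) by (simp add: t_def)
    then obtain w where w: "w \<in> W" "dist w ((1 / t) *\<^sub>R (y - x)) < \<delta>" using W(3) by fastforce
    have nw: "norm w \<le> 2"
    proof -
      have "norm w \<le> norm ((1 / t) *\<^sub>R (y - x)) + norm (w - (1 / t) *\<^sub>R (y - x))"
        using norm_triangle_ineq[of "(1 / t) *\<^sub>R (y - x)" "w - (1 / t) *\<^sub>R (y - x)"] by simp
      also have "norm ((1 / t) *\<^sub>R (y - x)) = 1" using t(1) False by (simp add: t_def)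
      finally show ?thesis using w(2) \<delta>(2) unfolding dist_norm by linarith
    qed
    \<comment> \<open>The quotient index whose step \<open>\<tau>\<close> is the largest one below the length \<open>t\<close> of the increment;
      it misses \<open>t\<close> by at most \<open>t\<^sup>2\<close>.\<close>
    define j where "j = nat \<lfloor>1 / t\<rfloor>"
    have rj: "real j \<le> 1 / t" "1 / t < real j + 1"
      using t(1) by (auto simp: j_def of_nat_nat)
    have "real J + 1 < 1 / t" using t(1,2) by (simp add: field_simps)
    then have "j \<ge> J" using rj by linarith
    define \<tau> where "\<tau> = 1 / real (Suc j)"
    have \<tau>: "\<tau> > 0" "\<tau> \<le> t" "t - \<tau> \<le> t * t"
    proof -
      show "\<tau> > 0" by (simp add: \<tau>_def)
      show "\<tau> \<le> t" using rj t(1) by (simp add: \<tau>_def field_simps)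
      have "1 + real j \<le> (1 + t) / t" using rj(1) t(1) by (simp add: field_simps)
      then have "\<tau> \<ge> t / (1 + t)" using t(1) by (simp add: \<tau>_def field_simps)
      moreover have "t - t / (1 + t) \<le> t * t" using t(1) by (simp add: field_simps)
      ultimately show "t - \<tau> \<le> t * t" by linarith
    qed
    have close: "norm (y - x - \<tau> *\<^sub>R w) \<le> t * \<delta> + 2 * (t * t)"
    proof -
      have "y - x - \<tau> *\<^sub>R w = t *\<^sub>R ((1 / t) *\<^sub>R (y - x) - w) + (t - \<tau>) *\<^sub>R w"
        using t(1) by (simp add: algebra_simps)
      then have "norm (y - x - \<tau> *\<^sub>R w) \<le> norm (t *\<^sub>R ((1 / t) *\<^sub>R (y - x) - w)) + norm ((t - \<tau>) *\<^sub>R w)"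
        using norm_triangle_ineq by metis
      also have "\<dots> = t * norm ((1 / t) *\<^sub>R (y - x) - w) + (t - \<tau>) * norm w"
        using t(1) \<tau>(2) by simp
      also have "\<dots> \<le> t * \<delta> + (t * t) * 2"
        using w(2) t(1) \<tau> nw by (intro add_mono mult_mono) (auto simp: dist_norm norm_minus_commute)
      finally show ?thesis by simp
    qed
    have 1: "\<bar>u y - u (x + \<tau> *\<^sub>R w)\<bar> \<le> L * norm (y - x - \<tau> *\<^sub>R w)"
      using lipschitz_onD[OF u, of y "x + \<tau> *\<^sub>R w"] by (simp add: dist_norm diff_diff_eq)
    have 2: "\<bar>u (x + \<tau> *\<^sub>R w) - u x - \<tau> * (w \<bullet> g)\<bar> \<le> \<tau> * (e / 3)"
    proof -
      have "u (x + \<tau> *\<^sub>R w) - u x - \<tau> * (w \<bullet> g) = \<tau> * (diff_quot w u j x - w \<bullet> g)"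
        by (simp add: diff_quot_def \<tau>_def field_simps)
      then show ?thesis using J[OF \<open>j \<ge> J\<close> w(1)] \<tau>(1) by (simp add: abs_mult)
    qed
    have 3: "\<bar>\<tau> * (w \<bullet> g) - (y - x) \<bullet> g\<bar> \<le> norm g * norm (y - x - \<tau> *\<^sub>R w)"
    proof -
      have "\<tau> * (w \<bullet> g) - (y - x) \<bullet> g = - ((y - x - \<tau> *\<^sub>R w) \<bullet> g)" by (simp add: inner_diff_left)
      then show ?thesis using Cauchy_Schwarz_ineq2[of "y - x - \<tau> *\<^sub>R w" g] by (simp add: mult.commute)
    qed
    have "\<bar>u y - u x - (y - x) \<bullet> g\<bar> \<le> (L + norm g) * norm (y - x - \<tau> *\<^sub>R w) + \<tau> * (e / 3)"
      using 1 2 3 unfolding distrib_right by linarith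
    also have "\<dots> \<le> C * (t * \<delta> + 2 * (t * t)) + t * (e / 3)"
      using close \<tau>(2) e C t(1) lipschitz_on_nonneg[OF u] by (intro add_mono mult_mono) (auto simp: C_def)
    also have "\<dots> = t * (C * \<delta> + 2 * (C * t) + e / 3)" by (simp add: algebra_simps)
    also have "\<dots> \<le> t * e"
    proof -
      have "C * t \<le> e / 6" using t(3) C by (simp add: field_simps)
      then show ?thesis using \<delta>(3) t(1) by (intro mult_left_mono) auto
    qed
    finally show ?thesis by (simp add: t_def mult.commute)
  qed simp
  then show "\<exists>d>0. \<forall>y. norm (y - x) < d \<longrightarrow> norm (u y - u x - (y - x) \<bullet> g) \<le> e * norm (y - x)"
    using d by blast
qed

text \<open>
  A Borel measurable representative of the gradient, defined everywhere.  Integrals over \<open>lborel\<close> are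
  stated with it, since the classical gradient set to \<open>0\<close> at exceptional points need not be Borel.
\<close>

definition quot_grad :: "(real^'n::finite \<Rightarrow> real) \<Rightarrow> real^'n \<Rightarrow> real^'n" where
  "quot_grad u x = (\<chi> i. dir_deriv (axis i 1) u x)"

theorem rademacher:
  fixes u :: "real^'n::finite \<Rightarrow> real"
  assumes u: "L-lipschitz_on UNIV u"
  shows "AE x in lborel. GDERIV u x :> quot_grad u x"
proof -
  obtain D :: "(real^'n) set" where D: "countable D" "\<And>X. open X \<Longrightarrow> X \<noteq> {} \<Longrightarrow> \<exists>d\<in>D. d \<in> X"
    using countable_dense_exists[where 'a="real^'n"] by auto
  have "AE x in lborel. \<forall>w\<in>D. (\<lambda>j. diff_quot w u j x) \<longlonglongrightarrow> dir_deriv w u x"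
    using lipschitz_AE_dir_deriv[OF u] D(1) by (simp add: AE_ball_countable)
  moreover have "AE x in lborel. \<forall>w\<in>D. dir_deriv w u x = w \<bullet> (\<chi> i. dir_deriv (axis i 1) u x)"
    using AE_dir_deriv_linear[OF u] D(1) by (simp add: AE_ball_countable)
  ultimately show ?thesis
  proof eventually_elim
    case (elim x)
    show ?case by (rule gderiv_if_dense_dir_derivs[OF u D(2)]) (use elim in \<open>auto simp: quot_grad_def\<close>)
  qed
qed

section \<open>Gradients of Lipschitz functions under the integral sign\<close>

lemma gderiv_unique: "GDERIV u x :> a \<Longrightarrow> GDERIV u x :> b \<Longrightarrow> a = b"
proof -
  assume "GDERIV u x :> a" "GDERIV u x :> b"
  then have "(\<lambda>h. h \<bullet> a) = (\<lambda>h. h \<bullet> b)"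
    unfolding gderiv_def by (rule has_derivative_unique)
  then have "(a - b) \<bullet> a = (a - b) \<bullet> b" by (rule fun_cong)
  then have "(a - b) \<bullet> (a - b) = 0" by (simp add: inner_diff_right)
  then show "a = b" by simp
qed

lemma grad_eq:
  assumes "GDERIV u x :> a"
  shows "grad u x = a"
proof -
  have "(THE D. GDERIV u x :> D) = a"
    using assms by (intro the_equality) (auto dest: gderiv_unique[OF _ assms])
  then show ?thesis using assms unfolding grad_def by metis
qed

lemma dir_deriv_gderiv: "GDERIV u x :> a \<Longrightarrow> dir_deriv w u x = w \<bullet> a"
  unfolding gderiv_def by (rule dir_deriv_eq)

lemma quot_grad_eq: "GDERIV u x :> a \<Longrightarrow> quot_grad u x = a"
  by (simp add: quot_grad_def dir_deriv_gderiv vec_eq_iff inner_axis')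

lemma quot_grad_component_measurable:
  "u \<in> borel_measurable borel \<Longrightarrow> (\<lambda>x. quot_grad u x $ i) \<in> borel_measurable borel"
  by (simp add: quot_grad_def dir_deriv_measurable)

lemma gderiv_bound:
  fixes u :: "'a::euclidean_space \<Rightarrow> real"
  assumes "L-lipschitz_on UNIV u" "GDERIV u x :> a"
  shows "norm a \<le> L"
proof -
  have "\<bar>a \<bullet> a\<bar> \<le> L * norm a"
    using dir_deriv_bound[OF assms(1), of a x] diff_quot_tendsto_has_derivative[OF assms(2)[unfolded gderiv_def], of a]
      dir_deriv_gderiv[OF assms(2), of a] by simp
  then have "norm a * norm a \<le> L * norm a" by (simp add: dot_square_norm power2_eq_square)
  then show ?thesis using lipschitz_on_nonneg[OF assms(1)] by (cases "a = 0") auto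
qed

lemma diff_quot_commute: "diff_quot a (diff_quot b u j) j x = diff_quot b (diff_quot a u j) j x"
  by (simp add: diff_quot_def algebra_simps)

text \<open>
  Moving both difference quotients to the other factor is exact before the limit, so no second
  derivatives appear.
\<close>

lemma integral_dir_deriv_swap:
  fixes u \<eta> :: "'a::euclidean_space \<Rightarrow> real"
  assumes u: "L-lipschitz_on UNIV u" and \<eta>: "K-lipschitz_on UNIV \<eta>" "\<And>x. x \<notin> cball 0 R \<Longrightarrow> \<eta> x = 0"
  shows "(LINT x|lborel. dir_deriv a u x * dir_deriv b \<eta> x) =
    (LINT x|lborel. dir_deriv (- b) u x * dir_deriv (- a) \<eta> x)"
proof -
  have um: "u \<in> borel_measurable borel" "\<eta> \<in> borel_measurable borel"
    using u \<eta> by (auto intro: lipschitz_UNIV_measurable)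
  have cont: "continuous_on UNIV u" "continuous_on UNIV \<eta>"
    using u \<eta> lipschitz_on_continuous_on by blast+
  have contq: "continuous_on UNIV (diff_quot w \<eta> j)" for w j
    unfolding diff_quot_def by (intro continuous_intros continuous_on_compose2[OF cont(2)]) auto
  have out: "diff_quot w \<eta> j x = 0" if "x \<notin> cball 0 (R + norm w)" for w j x
    using diff_quot_outside[where \<eta>=\<eta> and R=R] \<eta>(2) that by blast
  have disc: "(LINT x|lborel. diff_quot a u j x * diff_quot b \<eta> j x) =
      (LINT x|lborel. diff_quot (- b) u j x * diff_quot (- a) \<eta> j x)" for j
  proof -
    have "(LINT x|lborel. diff_quot a u j x * diff_quot b \<eta> j x) =
        (LINT x|lborel. u x * diff_quot (- a) (diff_quot b \<eta> j) j x)"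
      by (rule diff_quot_integral_by_parts[OF cont(1) contq out])
    also have "\<dots> = (LINT x|lborel. u x * diff_quot (- (- b)) (diff_quot (- a) \<eta> j) j x)"
      by (simp add: diff_quot_commute[of b])
    also have "\<dots> = (LINT x|lborel. diff_quot (- b) u j x * diff_quot (- a) \<eta> j x)"
      by (rule diff_quot_integral_by_parts[OF cont(1) contq out, symmetric])
    finally show ?thesis .
  qed
  have lim: "(\<lambda>j. LINT x|lborel. diff_quot c u j x * diff_quot d \<eta> j x) \<longlonglongrightarrow>
      (LINT x|lborel. dir_deriv c u x * dir_deriv d \<eta> x)" for c d
  proof (rule integral_dominated_convergence[where w = "\<lambda>x. (L * norm c) * (K * norm d) * indicator (cball 0 (R + norm d)) x"])
    show "integrable lborel (\<lambda>x. (L * norm c) * (K * norm d) * indicat_real (cball 0 (R + norm d)) x)"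
      by (rule integrable_const_cball)
    show "AE x in lborel. (\<lambda>j. diff_quot c u j x * diff_quot d \<eta> j x) \<longlonglongrightarrow> dir_deriv c u x * dir_deriv d \<eta> x"
      using lipschitz_AE_dir_deriv[OF u, of c] lipschitz_AE_dir_deriv[OF \<eta>(1), of d]
      by eventually_elim (rule tendsto_mult)
    show "AE x in lborel. norm (diff_quot c u j x * diff_quot d \<eta> j x)
        \<le> (L * norm c) * (K * norm d) * indicator (cball 0 (R + norm d)) x" for j
    proof (rule AE_I2)
      fix x
      have "\<bar>diff_quot c u j x\<bar> * \<bar>diff_quot d \<eta> j x\<bar> \<le> (L * norm c) * (K * norm d)"
        using diff_quot_bound[OF u, of c j x] diff_quot_bound[OF \<eta>(1), of d j x] by (intro mult_mono) auto
      then show "norm (diff_quot c u j x * diff_quot d \<eta> j x)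
          \<le> (L * norm c) * (K * norm d) * indicator (cball 0 (R + norm d)) x"
        using out[of x d j] by (cases "x \<in> cball 0 (R + norm d)") (auto simp: abs_mult)
    qed
    show "(\<lambda>x. dir_deriv c u x * dir_deriv d \<eta> x) \<in> borel_measurable lborel"
      using borel_measurable_times[OF dir_deriv_measurable[OF um(1), of c] dir_deriv_measurable[OF um(2), of d]] by simp
    show "(\<lambda>x. diff_quot c u j x * diff_quot d \<eta> j x) \<in> borel_measurable lborel" for j
      using borel_measurable_times[OF diff_quot_measurable[OF um(1), of c j] diff_quot_measurable[OF um(2), of d j]] by simp
  qed
  show ?thesis using lim[of a b] lim[of "- b" "- a"] unfolding disc by (rule LIMSEQ_unique)
qed

text \<open>
  The weak form of \<open>\<partial>\<^sub>i\<partial>\<^sub>j u = \<partial>\<^sub>j\<partial>\<^sub>i u\<close>.  In the plane it says that the quarter turn of \<open>\<nabla>u\<close> is free of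
  divergence.
\<close>

lemma integral_curl_free:
  fixes u \<eta> :: "real^'n::finite \<Rightarrow> real"
  assumes u: "L-lipschitz_on UNIV u" and \<eta>: "K-lipschitz_on UNIV \<eta>" "\<And>x. x \<notin> cball 0 R \<Longrightarrow> \<eta> x = 0"
  shows "(LINT x|lborel. quot_grad u x $ i * quot_grad \<eta> x $ j) =
    (LINT x|lborel. quot_grad u x $ j * quot_grad \<eta> x $ i)"
proof -
  have um: "u \<in> borel_measurable borel" "\<eta> \<in> borel_measurable borel"
    using u \<eta> by (auto intro: lipschitz_UNIV_measurable)
  have "(LINT x|lborel. quot_grad u x $ i * quot_grad \<eta> x $ j) =
      (LINT x|lborel. dir_deriv (axis i 1) u x * dir_deriv (axis j 1) \<eta> x)"
    by (simp add: quot_grad_def)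
  also have "\<dots> = (LINT x|lborel. dir_deriv (- axis j 1) u x * dir_deriv (- axis i 1) \<eta> x)"
    using integral_dir_deriv_swap[OF u \<eta>(1), where R=R] \<eta>(2) by blast
  also have "\<dots> = (LINT x|lborel. quot_grad u x $ j * quot_grad \<eta> x $ i)"
  proof (rule integral_cong_AE)
    show "AE x in lborel. dir_deriv (- axis j 1) u x * dir_deriv (- axis i 1) \<eta> x = quot_grad u x $ j * quot_grad \<eta> x $ i"
      using rademacher[OF u] rademacher[OF \<eta>(1)]
    proof eventually_elim
      case (elim x)
      show ?case
        using dir_deriv_gderiv[OF elim(1), of "- axis j 1"] dir_deriv_gderiv[OF elim(2), of "- axis i 1"]
        by (simp add: inner_axis')
    qed
    show "(\<lambda>x. dir_deriv (- axis j 1) u x * dir_deriv (- axis i 1) \<eta> x) \<in> borel_measurable lborel"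
      using borel_measurable_times[OF dir_deriv_measurable[OF um(1)] dir_deriv_measurable[OF um(2)]] by simp
    show "(\<lambda>x. quot_grad u x $ j * quot_grad \<eta> x $ i) \<in> borel_measurable lborel"
      using borel_measurable_times[OF quot_grad_component_measurable[OF um(1)] quot_grad_component_measurable[OF um(2)]] by simp
  qed
  finally show ?thesis .
qed

lemma integral_dir_deriv_zero:
  fixes \<zeta> :: "'a::euclidean_space \<Rightarrow> real"
  assumes \<zeta>: "K-lipschitz_on UNIV \<zeta>" "\<And>x. x \<notin> cball 0 R \<Longrightarrow> \<zeta> x = 0"
  shows "(LINT x|lborel. dir_deriv w \<zeta> x) = 0"
proof -
  have "0-lipschitz_on UNIV (\<lambda>x::'a. 1::real)" by (rule lipschitz_on_constant)
  from dir_deriv_integral_by_parts[OF this \<zeta>(1), where R=R and w="- w"] \<zeta>(2)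
  have "(LINT x|lborel. dir_deriv (- w) (\<lambda>x. 1) x * \<zeta> x) = (LINT x|lborel. dir_deriv w \<zeta> x)" by simp
  moreover have "dir_deriv (- w) (\<lambda>x. 1) x = 0" for x :: 'a
    by (rule dir_deriv_eq) simp
  ultimately show ?thesis by simp
qed

text \<open>
  Integration by parts against the linear function \<open>x \<bullet> e\<close> shows that the integral of \<open>\<eta>\<close> vanishes.
\<close>

lemma zero_gradient_imp_zero:
  fixes \<eta> :: "real^'n::finite \<Rightarrow> real"
  assumes \<eta>: "K-lipschitz_on UNIV \<eta>" "\<And>x. x \<notin> cball 0 R \<Longrightarrow> \<eta> x = 0"
    and nonneg: "\<And>x. \<eta> x \<ge> 0" and zero: "AE x in lborel. quot_grad \<eta> x = 0"
  shows "\<eta> x = 0"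
proof -
  \<comment> \<open>Any unit vector will do.\<close>
  define e :: "real^'n" where "e = axis undefined 1"
  have e1: "e \<bullet> e = 1" by (simp add: e_def inner_axis_axis)
  have cont: "continuous_on UNIV \<eta>" using \<eta>(1) by (rule lipschitz_on_continuous_on)
  have m: "\<eta> \<in> borel_measurable borel" using \<eta>(1) by (rule lipschitz_UNIV_measurable)
  have int: "integrable lborel \<eta>" by (rule integrable_continuous_support[OF cont \<eta>(2)])
  have lip: "(norm e)-lipschitz_on UNIV (\<lambda>x. x \<bullet> e)"
  proof (rule lipschitz_onI)
    show "dist (x \<bullet> e) (y \<bullet> e) \<le> norm e * dist x y" for x y
      using Cauchy_Schwarz_ineq2[of "x - y" e] by (simp add: dist_norm inner_diff_left mult.commute)
  qed simp
  have "dir_deriv e (\<lambda>x. x \<bullet> e) x = 1" for x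
    using dir_deriv_eq[OF bounded_linear.has_derivative[OF bounded_linear_inner_left has_derivative_ident], of e e x] e1 by simp
  then have "(LINT x|lborel. \<eta> x) = (LINT x|lborel. (x \<bullet> e) * dir_deriv (- e) \<eta> x)"
    using dir_deriv_integral_by_parts[OF lip \<eta>(1), where R=R and w=e] \<eta>(2) by simp
  also have "\<dots> = (LINT (x::real^'n)|lborel. 0)"
  proof (rule integral_cong_AE)
    show "AE x in lborel. (x \<bullet> e) * dir_deriv (- e) \<eta> x = 0"
      using rademacher[OF \<eta>(1)] zero by eventually_elim (simp add: dir_deriv_gderiv)
    have "(\<lambda>x. x \<bullet> e) \<in> borel_measurable borel" by simp
    from borel_measurable_times[OF this dir_deriv_measurable[OF m, of "-e"]]
    show "(\<lambda>x. (x \<bullet> e) * dir_deriv (- e) \<eta> x) \<in> borel_measurable lborel" by simp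
  qed simp
  finally have "(LINT x|lborel. \<eta> x) = 0" by simp
  then have "AE x in lborel. \<eta> x = 0"
    using integral_nonneg_eq_0_iff_AE[OF int] nonneg by auto
  moreover have op: "open {x. \<eta> x \<noteq> 0}"
    using open_Collect_neq[OF cont continuous_on_const] by simp
  ultimately have "{x. \<eta> x \<noteq> 0} \<in> null_sets lborel"
    using AE_iff_null_sets[of "{x. \<eta> x \<noteq> 0}" lborel] by simp
  then have "negligible {x. \<eta> x \<noteq> 0}"
    by (simp add: negligible_iff_null_sets null_sets_completionI)
  with op have "{x. \<eta> x \<noteq> 0} = {}" using open_not_negligible by blast
  then show ?thesis by blast
qed

text \<open>
  McShane's formula \<open>U x = inf\<^sub>y (u y + L |x - y|)\<close>.
\<close>

lemma lipschitz_extension: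
  fixes u :: "'a::metric_space \<Rightarrow> real"
  assumes u: "L-lipschitz_on S u"
  obtains U where "L-lipschitz_on UNIV U" "\<And>x. x \<in> S \<Longrightarrow> U x = u x"
proof (cases "S = {}")
  case True
  have "L-lipschitz_on UNIV (\<lambda>x::'a. 0::real)"
    using lipschitz_on_mono[OF lipschitz_on_constant] lipschitz_on_nonneg[OF u] by blast
  then show ?thesis using that True by blast
next
  case False
  then obtain s where s: "s \<in> S" by blast
  note L0 = lipschitz_on_nonneg[OF u]
  define U where "U x = (INF y\<in>S. u y + L * dist x y)" for x
  have bdd: "bdd_below ((\<lambda>y. u y + L * dist x y) ` S)" for x
  proof (rule bdd_belowI2)
    fix y assume "y \<in> S"
    then have "u s - u y \<le> L * dist s y" using lipschitz_onD[OF u s] by (fastforce simp: dist_real_def)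
    also have "\<dots> \<le> L * (dist x s + dist x y)"
      using L0 by (intro mult_left_mono) (use dist_triangle[of s y x] in \<open>simp_all add: dist_commute\<close>)
    finally show "u s - L * dist x s \<le> u y + L * dist x y" by (simp add: algebra_simps)
  qed
  have le: "U x \<le> U y + L * dist x y" for x y
  proof -
    have "U x - L * dist x y \<le> u z + L * dist y z" if "z \<in> S" for z
    proof -
      have "U x \<le> u z + L * dist x z" unfolding U_def by (rule cINF_lower[OF bdd that])
      also have "\<dots> \<le> u z + L * (dist x y + dist y z)"
        using L0 by (intro add_left_mono mult_left_mono dist_triangle) auto
      finally show ?thesis by (simp add: algebra_simps)
    qed
    then have "U x - L * dist x y \<le> U y" unfolding U_def[of y] by (intro cINF_greatest False)
    then show ?thesis by simp
  qed
  have "L-lipschitz_on UNIV U"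
  proof (rule lipschitz_onI[OF _ L0])
    show "dist (U x) (U y) \<le> L * dist x y" for x y
      using le[of x y] le[of y x] by (auto simp: dist_real_def dist_commute abs_le_iff)
  qed
  moreover have "U x = u x" if x: "x \<in> S" for x
  proof (rule antisym)
    show "U x \<le> u x" using cINF_lower[OF bdd x, of x] by (simp add: U_def)
    show "u x \<le> U x" unfolding U_def
    proof (rule cINF_greatest[OF False])
      fix y assume "y \<in> S"
      then show "u x \<le> u y + L * dist x y" using lipschitz_onD[OF u x, of y] by (auto simp: dist_real_def abs_le_iff)
    qed
  qed
  ultimately show ?thesis using that by blast
qed

lemma gderiv_transform_open:
  assumes "GDERIV U x :> a" "open \<Omega>" "x \<in> \<Omega>" "\<And>y. y \<in> \<Omega> \<Longrightarrow> U y = u y"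
  shows "GDERIV u x :> a"
  using has_derivative_transform_within_open[OF assms(1)[unfolded gderiv_def] assms(2-4)]
  unfolding gderiv_def .

text \<open>
  Both \<open>h\<close> and the classical partial derivative represent the same distribution, so the fundamental
  lemma applies to their difference.
\<close>

lemma distributional_partial_lipschitz:
  fixes v :: "real^'n::finite \<Rightarrow> real"
  assumes \<Omega>: "open \<Omega>" and v: "L-lipschitz_on \<Omega> v" and d: "distributional_partial \<Omega> i v h"
  shows "AE x in lborel. x \<in> \<Omega> \<longrightarrow> h x = grad v x $ i"
proof -
  obtain V where V: "L-lipschitz_on UNIV V" "\<And>x. x \<in> \<Omega> \<Longrightarrow> V x = v x"
    using lipschitz_extension[OF v] by blast
  have Vm: "V \<in> borel_measurable borel" using V(1) by (rule lipschitz_UNIV_measurable)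
  define k where "k x = dir_deriv (axis i 1) V x" for x
  have km: "k \<in> borel_measurable borel" unfolding k_def by (rule dir_deriv_measurable[OF Vm])
  have lk: "locally_integrable \<Omega> k"
    by (rule bounded_locally_integrable[OF km])
       (use lipschitz_AE_dir_deriv_bound[OF V(1), of "axis i 1"] in \<open>simp add: k_def\<close>)
  have "AE x in lebesgue. x \<in> \<Omega> \<longrightarrow> h x - k x = 0"
  proof (rule AE_zero_if_test_integrals_zero[OF \<Omega>])
    have lh: "locally_integrable \<Omega> h" using d by (simp add: distributional_partial_def)
    show "locally_integrable \<Omega> (\<lambda>x. h x - k x)"
      using lh lk unfolding locally_integrable_def by (auto intro: set_integral_diff(1))
    fix \<phi> assume \<phi>: "\<phi> \<in> test_functions \<Omega>"
    obtain K R where KR: "K-lipschitz_on UNIV \<phi>" "\<And>x. x \<notin> cball 0 R \<Longrightarrow> \<phi> x = 0"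
      "\<And>i x. x \<notin> cball 0 R \<Longrightarrow> partial i \<phi> x = 0"
      using test_function_lipschitz[OF \<phi>] by blast
    have pm: "\<phi> \<in> borel_measurable borel" by (rule lipschitz_UNIV_measurable[OF KR(1)])
    have cont: "continuous_on UNIV \<phi>" using KR(1) by (rule lipschitz_on_continuous_on)
    obtain B where B: "\<And>x. \<bar>\<phi> x\<bar> \<le> B" "B \<ge> 0" using bounded_support_bounded[OF cont KR(2)] by blast
    define C where "C = closure {x. \<phi> x \<noteq> 0}"
    have C: "compact C" "C \<subseteq> \<Omega>" "\<And>x. x \<notin> C \<Longrightarrow> \<phi> x = 0"
      using \<phi> closure_subset[of "{x. \<phi> x \<noteq> 0}"] by (auto simp: C_def test_functions_def)
    have part: "dir_deriv (- axis i 1) \<phi> x = - partial i \<phi> x" for x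
      by (simp add: dir_deriv_test_function[OF \<phi>] axis_def if_distrib[of "\<lambda>c. c * _"] sum_negf cong: if_cong)
    have part0: "partial i \<phi> x = 0" if "x \<notin> C" for x
      using test_function_derivative(3)[OF \<phi>] that by (simp add: C_def)
    have pmeas: "partial i \<phi> \<in> borel_measurable borel"
      by (intro borel_measurable_continuous_onI test_function_derivative(2)[OF \<phi>])
    have I1: "(LINT x:\<Omega>|lebesgue. v x * partial i \<phi> x) = (LINT x|lborel. V x * partial i \<phi> x)"
    proof -
      have "indicator \<Omega> x *\<^sub>R (v x * partial i \<phi> x) = V x * partial i \<phi> x" for x
        using V(2)[of x] part0[of x] C(2) by (cases "x \<in> \<Omega>") auto
      then have "(LINT x:\<Omega>|lebesgue. v x * partial i \<phi> x) = (LINT x|lebesgue. V x * partial i \<phi> x)"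
        by (simp only: set_lebesgue_integral_def)
      also have "\<dots> = (LINT x|lborel. V x * partial i \<phi> x)"
        by (rule integral_completion) (use borel_measurable_times[OF Vm pmeas] in simp)
      finally show ?thesis .
    qed
    have I2: "(LINT x|lborel. k x * \<phi> x) = - (LINT x|lborel. V x * partial i \<phi> x)"
      using dir_deriv_integral_by_parts[OF V(1) KR(1), where R=R and w="axis i 1"] KR(2)
      by (simp add: k_def part)
    have I3: "(LINT x:\<Omega>|lebesgue. k x * \<phi> x) = (LINT x|lborel. k x * \<phi> x)"
    proof -
      have "indicator \<Omega> x *\<^sub>R (k x * \<phi> x) = k x * \<phi> x" for x
        using C(3)[of x] C(2) by (cases "x \<in> \<Omega>") auto
      then have "(LINT x:\<Omega>|lebesgue. k x * \<phi> x) = (LINT x|lebesgue. k x * \<phi> x)"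
        by (simp only: set_lebesgue_integral_def)
      also have "\<dots> = (LINT x|lborel. k x * \<phi> x)"
        by (rule integral_completion) (use borel_measurable_times[OF km pm] in simp)
      finally show ?thesis .
    qed
    have ih: "set_integrable lebesgue \<Omega> (\<lambda>x. g x * \<phi> x)" if g: "locally_integrable \<Omega> g" for g
    proof -
      have gC: "integrable lebesgue (\<lambda>x. indicat_real C x *\<^sub>R g x)"
        using g C(1,2) by (auto simp: locally_integrable_def set_integrable_def)
      have "integrable lebesgue (\<lambda>x. (indicat_real C x *\<^sub>R g x) * \<phi> x)"
      proof (rule Bochner_Integration.integrable_bound[OF integrable_mult_right[OF gC, of B]])
        show "(\<lambda>x. (indicat_real C x *\<^sub>R g x) * \<phi> x) \<in> borel_measurable lebesgue"
          using borel_measurable_times[OF borel_measurable_integrable[OF gC] measurable_completion] pm by simp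
        show "AE x in lebesgue. norm ((indicat_real C x *\<^sub>R g x) * \<phi> x) \<le> norm (B * (indicat_real C x *\<^sub>R g x))"
          using B by (intro AE_I2) (auto simp: abs_mult mult.commute intro!: mult_right_mono)
      qed
      moreover have "(indicat_real C x *\<^sub>R g x) * \<phi> x = indicat_real \<Omega> x *\<^sub>R (g x * \<phi> x)" for x
        using C(2) C(3)[of x] by (cases "x \<in> C") auto
      ultimately show ?thesis unfolding set_integrable_def by (simp only:)
    qed
    have "(LINT x:\<Omega>|lebesgue. (h x - k x) * \<phi> x) = (LINT x:\<Omega>|lebesgue. h x * \<phi> x) - (LINT x:\<Omega>|lebesgue. k x * \<phi> x)"
      using set_integral_diff(2)[OF ih[OF lh] ih[OF lk]] by (simp add: left_diff_distrib)
    also have "(LINT x:\<Omega>|lebesgue. h x * \<phi> x) = - (LINT x:\<Omega>|lebesgue. v x * partial i \<phi> x)"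
      using d \<phi> by (auto simp: distributional_partial_def)
    finally show "(LINT x:\<Omega>|lebesgue. (h x - k x) * \<phi> x) = 0" using I1 I2 I3 by simp
  qed
  then have "AE x in lborel. x \<in> \<Omega> \<longrightarrow> h x - k x = 0" by (simp add: AE_completion_iff)
  then show ?thesis using rademacher[OF V(1)]
  proof eventually_elim
    case (elim x)
    show ?case
    proof
      assume x: "x \<in> \<Omega>"
      have "grad v x = quot_grad V x"
        by (rule grad_eq[OF gderiv_transform_open[OF elim(2) \<Omega> x V(2)]])
      then show "h x = grad v x $ i" using elim(1) x by (simp add: k_def quot_grad_def)
    qed
  qed
qed

lemma lipschitz_AE_gderiv:
  fixes u :: "real^'n::finite \<Rightarrow> real"
  assumes "open \<Omega>" "L-lipschitz_on \<Omega> u"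
  shows "AE x in lborel. x \<in> \<Omega> \<longrightarrow> GDERIV u x :> grad u x"
proof -
  obtain U where U: "L-lipschitz_on UNIV U" "\<And>x. x \<in> \<Omega> \<Longrightarrow> U x = u x"
    using lipschitz_extension[OF assms(2)] by blast
  from rademacher[OF U(1)] show ?thesis
  proof eventually_elim
    case (elim x)
    show ?case
    proof
      assume "x \<in> \<Omega>"
      from gderiv_transform_open[OF elim assms(1) this U(2)]
      show "GDERIV u x :> grad u x" by (simp add: grad_eq)
    qed
  qed
qed

section \<open>Slopes of strictly convex functions and the conjugate\<close>

context
  fixes f :: "real \<Rightarrow> real"
  assumes reg: "regular_strictly_convex f"
begin

lemma hderiv_works: "\<rho> \<ge> 0 \<Longrightarrow> (f has_real_derivative hderiv f \<rho>) (at \<rho> within {0..})"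
  using reg unfolding regular_strictly_convex_def C1_halfline_def hderiv_def
  by (auto simp: has_real_derivative_iff_has_vector_derivative vector_derivative_works[symmetric])

lemma hderiv_continuous: "continuous_on {0..} (hderiv f)"
  using reg unfolding regular_strictly_convex_def C1_halfline_def by blast

text \<open>
  The slope inequality at \<open>x\<close> comes from letting \<open>t \<rightarrow> 0\<close> in the definition of convexity.  Applied at the
  midpoint of \<open>x\<close> and \<open>y\<close>, where strict convexity gains something, it becomes strict.
\<close>

lemma above_tangent:
  assumes "x \<ge> 0" "y \<ge> 0" "x \<noteq> y"
  shows "f x + hderiv f x * (y - x) < f y"
proof -
  have strict: "f ((1 - t) * a + t * b) < (1 - t) * f a + t * f b"
    if "a \<ge> 0" "b \<ge> 0" "a \<noteq> b" "0 < t" "t < 1" for a b t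
    using reg that unfolding regular_strictly_convex_def strictly_convex_on_def by fastforce
  have weak: "hderiv f x * (z - x) \<le> f z - f x" if z: "z \<ge> 0" "z \<noteq> x" for z
  proof -
    have "((\<lambda>y. (f y - f x) / (y - x)) \<longlongrightarrow> hderiv f x) (at x within {0..})"
      using hderiv_works[OF assms(1)] by (simp add: has_field_derivative_iff)
    moreover have "filterlim (\<lambda>t. x + t * (z - x)) (at x within {0..}) (at_right 0)"
      unfolding filterlim_at
    proof
      have "\<forall>\<^sub>F t in at_right 0. t \<in> {0<..<1::real}"
        by (rule eventually_at_right_real) simp
      then show "\<forall>\<^sub>F t in at_right 0. x + t * (z - x) \<in> {0..} \<and> x + t * (z - x) \<noteq> x"
      proof eventually_elim
        case (elim t)
        have "x + t * (z - x) = (1 - t) * x + t * z" by (simp add: algebra_simps)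
        then show ?case using elim z assms(1) by auto
      qed
      have "((\<lambda>t. x + t * (z - x)) \<longlongrightarrow> x + 0 * (z - x)) (at_right 0)" by (intro tendsto_intros)
      then show "((\<lambda>t. x + t * (z - x)) \<longlongrightarrow> x) (at_right 0)" by simp
    qed
    ultimately have "((\<lambda>t. (f (x + t * (z - x)) - f x) / (x + t * (z - x) - x)) \<longlongrightarrow> hderiv f x) (at_right 0)"
      by (rule filterlim_compose)
    then have lim: "((\<lambda>t. (f (x + t * (z - x)) - f x) / (x + t * (z - x) - x) * (z - x)) \<longlongrightarrow> hderiv f x * (z - x)) (at_right 0)"
      by (rule tendsto_mult_right)
    show ?thesis
    proof (rule tendsto_upperbound[OF lim])
      have "\<forall>\<^sub>F t in at_right 0. t \<in> {0<..<1::real}"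
        by (rule eventually_at_right_real) simp
      then show "\<forall>\<^sub>F t in at_right 0. (f (x + t * (z - x)) - f x) / (x + t * (z - x) - x) * (z - x) \<le> f z - f x"
      proof eventually_elim
        case (elim t)
        have "f (x + t * (z - x)) = f ((1 - t) * x + t * z)" by (simp add: algebra_simps)
        also have "\<dots> < (1 - t) * f x + t * f z" using elim z assms(1) by (intro strict) auto
        finally have "f (x + t * (z - x)) - f x \<le> t * (f z - f x)" by (simp add: algebra_simps)
        then have "(f (x + t * (z - x)) - f x) / t \<le> f z - f x" using elim by (simp add: field_simps)
        then show ?case using z elim by simp
      qed
    qed simp
  qed
  have "hderiv f x * ((x + y) / 2 - x) \<le> f ((x + y) / 2) - f x"
    using assms by (intro weak) auto
  moreover have "f ((x + y) / 2) < (f x + f y) / 2"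
    using strict[of x y "1/2"] assms by (simp add: field_simps)
  moreover have "hderiv f x * ((x + y) / 2 - x) = hderiv f x * (y - x) / 2"
    by (simp add: field_simps)
  ultimately have "hderiv f x * (y - x) / 2 < (f y - f x) / 2"
    unfolding diff_divide_distrib add_divide_distrib by linarith
  then show ?thesis by simp
qed

lemma hderiv_strict_mono:
  assumes "0 \<le> x" "x < y"
  shows "hderiv f x < hderiv f y"
proof -
  have "f x + hderiv f x * (y - x) < f y" "f y + hderiv f y * (x - y) < f x"
    using assms by (auto intro!: above_tangent)
  then have "hderiv f x * (y - x) < hderiv f y * (y - x)" by (simp add: algebra_simps)
  then show ?thesis using assms by simp
qed

lemma hderiv_less_iff: "0 \<le> x \<Longrightarrow> 0 \<le> y \<Longrightarrow> hderiv f x < hderiv f y \<longleftrightarrow> x < y"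
  by (metis hderiv_strict_mono less_asym less_linear)

lemma hderiv_deriv:
  assumes "\<rho> > 0"
  shows "(hderiv f has_real_derivative deriv (hderiv f) \<rho>) (at \<rho>)"
proof -
  have "hderiv f differentiable (at \<rho>)"
    using reg assms unfolding regular_strictly_convex_def C2_loc_hoelder_def by blast
  then show ?thesis
    by (metis DERIV_deriv_iff_real_differentiable)
qed

lemma deriv_hderiv_nonneg:
  assumes "\<rho> > 0"
  shows "deriv (hderiv f) \<rho> \<ge> 0"
proof (rule ccontr)
  assume "\<not> 0 \<le> deriv (hderiv f) \<rho>"
  then obtain d where d: "d > 0" "\<And>h. h > 0 \<Longrightarrow> h < d \<Longrightarrow> hderiv f (\<rho> + h) < hderiv f \<rho>"
    using DERIV_neg_dec_right[OF hderiv_deriv[OF assms]] by auto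
  have "hderiv f \<rho> < hderiv f (\<rho> + d/2)" using hderiv_strict_mono[of \<rho> "\<rho> + d/2"] assms d(1) by auto
  moreover have "hderiv f (\<rho> + d/2) < hderiv f \<rho>" using d by (intro d(2)) auto
  ultimately show False by simp
qed

lemma deriv_hderiv_continuous: "continuous_on {0<..} (deriv (hderiv f))"
proof (rule continuous_at_imp_continuous_on, rule ballI)
  fix \<rho> :: real assume "\<rho> \<in> {0<..}"
  then have \<rho>: "\<rho> > 0" by simp
  obtain \<theta> where \<theta>: "0 < \<theta>" "C2_loc_hoelder \<theta> f"
    using reg unfolding regular_strictly_convex_def by blast
  have "compact {\<rho>/2..2*\<rho>}" "{\<rho>/2..2*\<rho>} \<subseteq> {0<..}" using \<rho> by auto
  then obtain C where C: "\<And>x y. x \<in> {\<rho>/2..2*\<rho>} \<Longrightarrow> y \<in> {\<rho>/2..2*\<rho>} \<Longrightarrow>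
      \<bar>deriv (hderiv f) x - deriv (hderiv f) y\<bar> \<le> C * \<bar>x - y\<bar> powr \<theta>"
    using \<theta>(2) unfolding C2_loc_hoelder_def by meson
  have "((\<lambda>x. \<bar>deriv (hderiv f) x - deriv (hderiv f) \<rho>\<bar>) \<longlongrightarrow> 0) (at \<rho>)"
  proof (rule tendsto_sandwich[of "\<lambda>_. 0"])
    have "\<forall>\<^sub>F x in at \<rho>. x \<in> {\<rho>/2<..<2*\<rho>}"
      using \<rho> by (intro eventually_at_in_open') auto
    then show "\<forall>\<^sub>F x in at \<rho>. \<bar>deriv (hderiv f) x - deriv (hderiv f) \<rho>\<bar> \<le> C * \<bar>x - \<rho>\<bar> powr \<theta>"
      by eventually_elim (use C[of _ \<rho>] \<rho> in auto)
    have "((\<lambda>x. C * \<bar>x - \<rho>\<bar> powr \<theta>) \<longlongrightarrow> C * 0) (at \<rho>)"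
      using \<theta>(1)
      by (intro tendsto_mult tendsto_const tendsto_zero_powrI[of _ _ "\<lambda>_. \<theta>" \<theta>])
         (auto intro!: tendsto_eq_intros)
    then show "((\<lambda>x. C * \<bar>x - \<rho>\<bar> powr \<theta>) \<longlongrightarrow> 0) (at \<rho>)" by simp
  qed auto
  then have "(deriv (hderiv f) \<longlongrightarrow> deriv (hderiv f) \<rho>) (at \<rho>)"
    by (subst LIM_zero_iff[symmetric]) (rule tendsto_rabs_zero_cancel)
  then show "isCont (deriv (hderiv f)) \<rho>" by (simp add: isCont_def)
qed

lemma elasticity_continuous:
  assumes "hderiv f 0 = 0" "\<rho> > 0"
  shows "isCont (elasticity f) \<rho>"
proof -
  have "continuous_on {0<..} (elasticity f)"
    unfolding elasticity_def[abs_def]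
  proof (intro continuous_intros deriv_hderiv_continuous continuous_on_subset[OF hderiv_continuous] ballI)
    fix x :: real assume "x \<in> {0<..}"
    then show "hderiv f x \<noteq> 0" using hderiv_strict_mono[of 0 x] assms(1) by auto
  qed auto
  then show ?thesis using assms(2) by (simp add: continuous_on_eq_continuous_at)
qed

end

text \<open>
  Beyond some \<open>R\<close> the elasticity exceeds \<open>l / 2 > 0\<close>, that is \<open>f'' \<ge> c / \<rho>\<close>, so \<open>f'\<close> grows at least like
  \<open>c ln \<rho>\<close>.  Thus \<open>f'\<close> attains every value above \<open>f'(0)\<close>.
\<close>

lemma hderiv_admissible_unbounded:
  assumes "admissible_lagrangean f"
  shows "\<exists>\<rho>>0. hderiv f \<rho> \<ge> M"
proof (rule ccontr)
  assume neg: "\<not> ?thesis"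
  have reg: "regular_strictly_convex f" and pos0: "hderiv f 0 > 0"
    using assms by (auto simp: admissible_lagrangean_def)
  obtain l where l: "l > 0" "(elasticity f \<longlongrightarrow> l) at_top"
    using assms by (auto simp: admissible_lagrangean_def)
  have "\<forall>\<^sub>F \<rho> in at_top. elasticity f \<rho> > l / 2"
    using order_tendstoD(1)[OF l(2), of "l/2"] l(1) by simp
  then obtain R0 where R0: "\<And>\<rho>. \<rho> \<ge> R0 \<Longrightarrow> elasticity f \<rho> > l / 2"
    by (auto simp: eventually_at_top_linorder)
  define R where "R = max R0 1"
  have R: "R \<ge> 1" "\<And>\<rho>. \<rho> \<ge> R \<Longrightarrow> elasticity f \<rho> > l / 2" using R0 by (auto simp: R_def)
  define c where "c = l / 2 * hderiv f 0"
  have c: "c > 0" using l(1) pos0 by (simp add: c_def)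
  have grow: "hderiv f R - c * ln R \<le> hderiv f \<rho> - c * ln \<rho>" if "\<rho> \<ge> R" for \<rho>
  proof (rule DERIV_nonneg_imp_nondecreasing[OF that])
    fix x assume x: "R \<le> x" "x \<le> \<rho>"
    then have xp: "x > 0" using R(1) by simp
    have "((\<lambda>x. hderiv f x - c * ln x) has_real_derivative (deriv (hderiv f) x - c * (1 / x))) (at x)"
      using hderiv_deriv[OF reg xp] xp by (auto intro!: derivative_eq_intros)
    moreover have "deriv (hderiv f) x - c * (1 / x) \<ge> 0"
    proof -
      have Fx: "hderiv f 0 < hderiv f x" using hderiv_strict_mono[OF reg, of 0 x] xp by simp
      have "l / 2 * hderiv f x \<le> x * deriv (hderiv f) x"
        using R(2)[OF x(1)] Fx pos0 by (simp add: elasticity_def pos_less_divide_eq)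
      moreover have "c \<le> l / 2 * hderiv f x" using Fx l(1) by (simp add: c_def)
      ultimately have "c \<le> x * deriv (hderiv f) x" by linarith
      then show ?thesis using xp by (simp add: field_simps)
    qed
    ultimately show "\<exists>y. ((\<lambda>x. hderiv f x - c * ln x) has_real_derivative y) (at x) \<and> 0 \<le> y" by blast
  qed
  define \<rho> where "\<rho> = max R (exp ((\<bar>M\<bar> + c * ln R) / c))"
  have "\<rho> \<ge> R" by (simp add: \<rho>_def)
  have "ln \<rho> \<ge> (\<bar>M\<bar> + c * ln R) / c"
    using R(1) by (subst ln_ge_iff) (auto simp: \<rho>_def)
  then have "c * ln \<rho> \<ge> \<bar>M\<bar> + c * ln R" using c by (simp add: pos_divide_le_eq mult.commute)
  moreover have "hderiv f R > 0" using hderiv_strict_mono[OF reg, of 0 R] R(1) pos0 by simp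
  ultimately have "hderiv f \<rho> \<ge> M" using grow[OF \<open>\<rho> \<ge> R\<close>] by linarith
  then show False using neg \<open>\<rho> \<ge> R\<close> R(1) by auto
qed

lemma slope_solvable:
  assumes reg: "regular_strictly_convex f" and unb: "\<And>M. \<exists>\<rho>>0. hderiv f \<rho> \<ge> M"
    and "\<epsilon> \<ge> 0" "hderiv f 0 \<le> r"
  shows "\<exists>\<rho>\<ge>0. hderiv f \<rho> + \<epsilon> * \<rho> = r"
proof -
  obtain b where b: "b > 0" "hderiv f b \<ge> r" using unb by blast
  have "continuous_on {0..b} (\<lambda>\<rho>. hderiv f \<rho> + \<epsilon> * \<rho>)"
    by (intro continuous_intros continuous_on_subset[OF hderiv_continuous[OF reg]]) auto
  then obtain \<rho> where "0 \<le> \<rho>" "hderiv f \<rho> + \<epsilon> * \<rho> = r"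
    using IVT'[of "\<lambda>\<rho>. hderiv f \<rho> + \<epsilon> * \<rho>" 0 r b] b assms(3,4) by (auto simp: add_increasing2)
  then show ?thesis by blast
qed

text \<open>
  The maximality condition for \<open>r \<rho> - f \<rho>\<close> over \<open>\<rho> \<ge> 0\<close>: either \<open>f' \<rho> = r\<close>, or \<open>\<rho> = 0\<close> and \<open>r \<le> f' 0\<close>.
  The second case is the range of slopes where \<open>g'\<close> vanishes.
\<close>

definition dual_point :: "(real \<Rightarrow> real) \<Rightarrow> real \<Rightarrow> real \<Rightarrow> bool" where
  "dual_point f r \<rho> \<longleftrightarrow> \<rho> \<ge> 0 \<and> r \<le> hderiv f \<rho> \<and> (\<rho> > 0 \<longrightarrow> hderiv f \<rho> = r)"

lemma dual_point_exists:
  assumes "admissible_lagrangean f"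
  shows "\<exists>\<rho>. dual_point f r \<rho>"
proof (cases "r \<le> hderiv f 0")
  case True
  then show ?thesis by (auto simp: dual_point_def intro!: exI[of _ 0])
next
  case False
  have "regular_strictly_convex f" using assms by (auto simp: admissible_lagrangean_def)
  then obtain \<rho> where "\<rho> \<ge> 0" "hderiv f \<rho> = r"
    using slope_solvable[of f 0 r] hderiv_admissible_unbounded[OF assms] False by auto
  then show ?thesis by (auto simp: dual_point_def)
qed

lemma dual_point_conjugate:
  assumes reg: "regular_strictly_convex f" and d: "dual_point f r \<rho>"
  shows "conjugate_halfline f r = r * \<rho> - f \<rho>"
    and "\<And>\<sigma>. \<sigma> \<ge> 0 \<Longrightarrow> r * \<sigma> - f \<sigma> \<le> r * \<rho> - f \<rho>"
proof -
  show *: "r * \<sigma> - f \<sigma> \<le> r * \<rho> - f \<rho>" if "\<sigma> \<ge> 0" for \<sigma>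
  proof (cases "\<sigma> = \<rho>")
    case False
    have "f \<rho> + hderiv f \<rho> * (\<sigma> - \<rho>) < f \<sigma>"
      using d that False by (intro above_tangent[OF reg]) (auto simp: dual_point_def)
    moreover have "r * (\<sigma> - \<rho>) \<le> hderiv f \<rho> * (\<sigma> - \<rho>)"
      using d that by (cases "\<rho> > 0") (auto simp: dual_point_def intro: mult_right_mono)
    ultimately show ?thesis by (simp add: algebra_simps)
  qed simp
  show "conjugate_halfline f r = r * \<rho> - f \<rho>"
    unfolding conjugate_halfline_def
    by (intro cSup_eq_maximum) (use d * in \<open>auto simp: dual_point_def\<close>)
qed

text \<open>
  The hypotheses on \<open>\<rho>\<close> say that it maximises \<open>r \<rho> - f\<^sub>n \<rho> - \<epsilon> \<rho>\<^sup>2 / 2\<close>.  Uniform convergence controls secant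
  slopes, and strict convexity of \<open>f\<close> separates \<open>r\<^sub>0\<close> from the secant slopes of \<open>f\<close> on
  \<open>[\<rho>\<^sub>0, \<rho>\<^sub>0 + \<tau>]\<close> and \<open>[\<rho>\<^sub>0 - \<tau>, \<rho>\<^sub>0]\<close>.  The derivatives of \<open>f\<^sub>n\<close> at \<open>\<rho>\<^sub>0 \<plusminus> \<tau>\<close> therefore enclose
  the slope \<open>r\<close>, and \<open>\<rho>\<close> lies between these points.
\<close>

lemma slope_inverse_stable:
  assumes reg: "\<And>n. regular_strictly_convex (fs n)" and regf: "regular_strictly_convex f"
    and lim: "uniform_limit {0..} fs f sequentially"
    and d: "dual_point f r0 \<rho>0" and "\<tau> > 0"
  shows "\<exists>N \<epsilon>0 \<delta>. \<epsilon>0 > 0 \<and> \<delta> > 0 \<and> (\<forall>n\<ge>N. \<forall>\<epsilon> r \<rho>. 0 \<le> \<epsilon> \<and> \<epsilon> \<le> \<epsilon>0 \<and> \<bar>r - r0\<bar> < \<delta> \<and> \<rho> \<ge> 0 \<and>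
     r \<le> hderiv (fs n) \<rho> + \<epsilon> * \<rho> \<and> (\<rho> > 0 \<longrightarrow> hderiv (fs n) \<rho> + \<epsilon> * \<rho> = r) \<longrightarrow> \<bar>\<rho> - \<rho>0\<bar> < \<tau>)"
proof -
  have \<rho>0: "\<rho>0 \<ge> 0" "r0 \<le> hderiv f \<rho>0" "\<rho>0 > 0 \<Longrightarrow> hderiv f \<rho>0 = r0" using d by (auto simp: dual_point_def)
  \<comment> \<open>The gaps between \<open>f\<close> and its tangent at distance \<open>\<tau>\<close> to the right and, if there is room, to
    the left of \<open>\<rho>0\<close>.\<close>
  define up where "up = f (\<rho>0 + \<tau>) - f \<rho>0 - hderiv f \<rho>0 * \<tau>"
  have up: "up > 0"
    using above_tangent[OF regf, of \<rho>0 "\<rho>0 + \<tau>"] \<rho>0(1) \<open>\<tau> > 0\<close> by (simp add: up_def)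
  define dn where "dn = (if \<rho>0 \<ge> \<tau> then f (\<rho>0 - \<tau>) - f \<rho>0 + hderiv f \<rho>0 * \<tau> else 1)"
  have dn: "dn > 0"
  proof (cases "\<rho>0 \<ge> \<tau>")
    case True
    then show ?thesis
      using above_tangent[OF regf, of \<rho>0 "\<rho>0 - \<tau>"] \<rho>0(1) \<open>\<tau> > 0\<close> by (simp add: dn_def)
  qed (simp add: dn_def)
  \<comment> \<open>The gain in slope; it is shared between the error of \<open>f\<^sub>n\<close>, the error in \<open>r\<close> and the term \<open>\<epsilon> \<rho>\<close>.\<close>
  define \<kappa> where "\<kappa> = min up dn / \<tau>"
  have \<kappa>: "\<kappa> > 0" "\<kappa> * \<tau> \<le> up" "\<kappa> * \<tau> \<le> dn" using up dn \<open>\<tau> > 0\<close> by (auto simp: \<kappa>_def)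
  have "\<forall>\<^sub>F n in sequentially. \<forall>\<rho>\<in>{0..}. dist (fs n \<rho>) (f \<rho>) < \<kappa> * \<tau> / 6"
    using lim[unfolded uniform_limit_iff, rule_format, of "\<kappa> * \<tau> / 6"] \<kappa>(1) \<open>\<tau> > 0\<close> by simp
  then obtain N where N: "\<And>n \<rho>. n \<ge> N \<Longrightarrow> \<rho> \<ge> 0 \<Longrightarrow> \<bar>fs n \<rho> - f \<rho>\<bar> < \<kappa> * \<tau> / 6"
    by (auto simp: eventually_sequentially dist_real_def)
  define \<epsilon>0 where "\<epsilon>0 = \<kappa> / (3 * (\<rho>0 + 1))"
  have \<epsilon>0: "\<epsilon>0 > 0" "\<epsilon>0 * \<rho>0 \<le> \<kappa> / 3"
    using \<kappa>(1) \<rho>0(1) by (auto simp: \<epsilon>0_def field_simps)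
  have "\<bar>\<rho> - \<rho>0\<bar> < \<tau>" if n: "n \<ge> N" and \<epsilon>: "0 \<le> \<epsilon>" "\<epsilon> \<le> \<epsilon>0" and r: "\<bar>r - r0\<bar> < \<kappa> / 3" and \<rho>: "\<rho> \<ge> 0"
    "r \<le> hderiv (fs n) \<rho> + \<epsilon> * \<rho>" "\<rho> > 0 \<Longrightarrow> hderiv (fs n) \<rho> + \<epsilon> * \<rho> = r" for n \<epsilon> r \<rho>
  proof -
    have mono: "hderiv (fs n) x \<le> hderiv (fs n) y" if "0 \<le> x" "x \<le> y" for x y
      using hderiv_strict_mono[OF reg[of n], of x y] that by (cases "x = y") auto
    have "\<rho> < \<rho>0 + \<tau>"
    proof (rule ccontr)
      assume c: "\<not> \<rho> < \<rho>0 + \<tau>"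
      then have "hderiv (fs n) (\<rho>0 + \<tau>) \<le> hderiv (fs n) \<rho>" using \<rho>0(1) \<open>\<tau> > 0\<close> by (intro mono) auto
      also have "\<dots> \<le> r"
      proof -
        have "\<rho> > 0" using c \<rho>0(1) \<open>\<tau> > 0\<close> by simp
        from \<rho>(3)[OF this] mult_nonneg_nonneg[OF \<epsilon>(1) \<rho>(1)] show ?thesis by linarith
      qed
      finally have 1: "hderiv (fs n) (\<rho>0 + \<tau>) * \<tau> \<le> r * \<tau>" using \<open>\<tau> > 0\<close> by simp
      have "fs n (\<rho>0 + \<tau>) + hderiv (fs n) (\<rho>0 + \<tau>) * (\<rho>0 - (\<rho>0 + \<tau>)) < fs n \<rho>0"
        using \<rho>0(1) \<open>\<tau> > 0\<close> by (intro above_tangent[OF reg]) auto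
      then have "fs n (\<rho>0 + \<tau>) - fs n \<rho>0 < r * \<tau>" using 1 by simp
      moreover have "\<bar>fs n \<rho>0 - f \<rho>0\<bar> < \<kappa> * \<tau> / 6" "\<bar>fs n (\<rho>0 + \<tau>) - f (\<rho>0 + \<tau>)\<bar> < \<kappa> * \<tau> / 6"
        using N[OF n] \<rho>0(1) \<open>\<tau> > 0\<close> by auto
      moreover have "r * \<tau> \<le> hderiv f \<rho>0 * \<tau> + \<kappa> / 3 * \<tau>"
      proof -
        have "r \<le> hderiv f \<rho>0 + \<kappa> / 3" using r \<rho>0(2) by linarith
        then have "r * \<tau> \<le> (hderiv f \<rho>0 + \<kappa> / 3) * \<tau>" using \<open>\<tau> > 0\<close> by (intro mult_right_mono) auto
        then show ?thesis by (simp add: distrib_right)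
      qed
      moreover have "\<kappa> / 3 * \<tau> = \<kappa> * \<tau> / 3" by simp
      moreover have "\<kappa> * \<tau> > 0" using \<kappa>(1) \<open>\<tau> > 0\<close> by simp
      ultimately show False using \<kappa>(2) up_def by linarith
    qed
    moreover have "\<rho> > \<rho>0 - \<tau>"
    proof (rule ccontr)
      assume c: "\<not> \<rho> > \<rho>0 - \<tau>"
      then have ge: "\<rho>0 \<ge> \<tau>" "\<rho>0 > 0" using \<rho>(1) \<open>\<tau> > 0\<close> by auto
      have "hderiv (fs n) \<rho> \<le> hderiv (fs n) (\<rho>0 - \<tau>)" using c \<rho> by (intro mono) auto
      moreover have "\<epsilon> * \<rho> \<le> \<kappa> / 3"
      proof -
        have "\<epsilon> * \<rho> \<le> \<epsilon>0 * \<rho>0" using \<epsilon> \<rho> c \<open>\<tau> > 0\<close> by (intro mult_mono) auto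
        then show ?thesis using \<epsilon>0 by simp
      qed
      ultimately have "r \<le> hderiv (fs n) (\<rho>0 - \<tau>) + \<kappa> / 3" using \<rho>(2) by linarith
      then have "r0 - \<kappa> / 3 * 2 \<le> hderiv (fs n) (\<rho>0 - \<tau>)" using r by linarith
      then have 1: "(r0 - \<kappa> / 3 * 2) * \<tau> \<le> hderiv (fs n) (\<rho>0 - \<tau>) * \<tau>" using \<open>\<tau> > 0\<close> by (intro mult_right_mono) auto
      have "fs n (\<rho>0 - \<tau>) + hderiv (fs n) (\<rho>0 - \<tau>) * (\<rho>0 - (\<rho>0 - \<tau>)) < fs n \<rho>0"
        using ge \<open>\<tau> > 0\<close> by (intro above_tangent[OF reg]) auto
      then have "(r0 - \<kappa> / 3 * 2) * \<tau> < fs n \<rho>0 - fs n (\<rho>0 - \<tau>)" using 1 by simp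
      moreover have "\<bar>fs n \<rho>0 - f \<rho>0\<bar> < \<kappa> * \<tau> / 6" "\<bar>fs n (\<rho>0 - \<tau>) - f (\<rho>0 - \<tau>)\<bar> < \<kappa> * \<tau> / 6"
        using N[OF n] ge by auto
      moreover have "(r0 - \<kappa> / 3 * 2) * \<tau> = hderiv f \<rho>0 * \<tau> - \<kappa> * \<tau> / 3 * 2"
        using \<rho>0(3)[OF ge(2)] by (simp add: algebra_simps)
      moreover have "dn = f (\<rho>0 - \<tau>) - f \<rho>0 + hderiv f \<rho>0 * \<tau>" using ge by (simp add: dn_def)
      ultimately show False using \<kappa>(3) by linarith
    qed
    ultimately show ?thesis by linarith
  qed
  then show ?thesis using \<epsilon>0(1) \<kappa>(1)
    by (intro exI[of _ N] exI[of _ \<epsilon>0] exI[of _ "\<kappa> / 3"]) auto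
qed

text \<open>
  The maximiser depends continuously on the slope (\<open>slope_inverse_stable\<close> for a constant sequence), and
  maximality at \<open>r\<close> and at \<open>s\<close> bounds the increment of the conjugate from both sides.
\<close>

lemma hderiv_conjugate:
  assumes adm: "admissible_lagrangean f" and "r > 0" and d: "dual_point f r \<rho>"
  shows "hderiv (conjugate_halfline f) r = \<rho>"
proof -
  have reg: "regular_strictly_convex f" using adm by (auto simp: admissible_lagrangean_def)
  obtain P where P: "\<And>s. dual_point f s (P s)" using dual_point_exists[OF adm] by metis
  let ?g = "conjugate_halfline f"
  have close: "\<exists>\<delta>>0. \<forall>s. \<bar>s - r\<bar> < \<delta> \<longrightarrow> \<bar>P s - \<rho>\<bar> < e" if e: "e > 0" for e
  proof -
    have "uniform_limit {0..} (\<lambda>n::nat. f) f sequentially" by (rule uniform_limit_const)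
    from slope_inverse_stable[OF reg reg this d e] obtain N \<epsilon>0 \<delta> where \<delta>: "\<epsilon>0 > 0" "\<delta> > 0"
      and st: "\<And>n \<epsilon> s \<sigma>. n \<ge> (N::nat) \<Longrightarrow> 0 \<le> \<epsilon> \<Longrightarrow> \<epsilon> \<le> \<epsilon>0 \<Longrightarrow> \<bar>s - r\<bar> < \<delta> \<Longrightarrow> \<sigma> \<ge> 0 \<Longrightarrow> s \<le> hderiv f \<sigma> + \<epsilon> * \<sigma> \<Longrightarrow>
        (\<sigma> > 0 \<longrightarrow> hderiv f \<sigma> + \<epsilon> * \<sigma> = s) \<Longrightarrow> \<bar>\<sigma> - \<rho>\<bar> < e"
      by blast
    have "\<bar>P s - \<rho>\<bar> < e" if "\<bar>s - r\<bar> < \<delta>" for s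
      using P[of s] \<delta>(1) that by (intro st[of N 0 s]) (auto simp: dual_point_def)
    then show ?thesis using \<delta>(2) by blast
  qed
  have "(?g has_real_derivative \<rho>) (at r)"
    unfolding has_field_derivative_iff LIM_eq
  proof (intro allI impI)
    fix e :: real assume e: "0 < e"
    obtain \<delta> where \<delta>: "\<delta> > 0" "\<And>s. \<bar>s - r\<bar> < \<delta> \<Longrightarrow> \<bar>P s - \<rho>\<bar> < e / 2" using close[of "e/2"] e by auto
    have "\<bar>(?g s - ?g r) / (s - r) - \<rho>\<bar> < e" if s: "s \<noteq> r" "\<bar>s - r\<bar> < \<delta>" for s
    proof -
      have gs: "?g s = s * P s - f (P s)" "?g r = r * \<rho> - f \<rho>"
        using dual_point_conjugate(1)[OF reg] P d by auto
      have 1: "s * \<rho> - f \<rho> \<le> ?g s" "r * P s - f (P s) \<le> ?g r"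
        using dual_point_conjugate(2)[OF reg P] dual_point_conjugate(2)[OF reg d] P[of s] d gs
        by (auto simp: dual_point_def)
      define D where "D = ?g s - ?g r - \<rho> * (s - r)"
      have D0: "D \<ge> 0" using 1(1) gs by (simp add: D_def algebra_simps)
      have "D \<le> (P s - \<rho>) * (s - r)" using 1(2) gs by (simp add: D_def algebra_simps)
      also have "\<dots> \<le> \<bar>P s - \<rho>\<bar> * \<bar>s - r\<bar>" by (metis abs_ge_self abs_mult)
      also have "\<dots> \<le> e / 2 * \<bar>s - r\<bar>" using \<delta>(2)[OF s(2)] by (intro mult_right_mono) auto
      finally have "\<bar>D\<bar> \<le> e / 2 * \<bar>s - r\<bar>" using D0 by simp
      then have "\<bar>D / (s - r)\<bar> \<le> e / 2" using s(1) by (simp add: field_simps abs_divide)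
      moreover have "D / (s - r) = (?g s - ?g r) / (s - r) - \<rho>" using s(1) by (simp add: D_def field_simps)
      ultimately show ?thesis using e by simp
    qed
    then show "\<exists>t>0. \<forall>x. x \<noteq> r \<and> norm (x - r) < t \<longrightarrow> norm ((?g x - ?g r) / (x - r) - \<rho>) < e"
      using \<delta>(1) by auto
  qed
  then have "(?g has_vector_derivative \<rho>) (at r)"
    by (simp add: has_real_derivative_iff_has_vector_derivative)
  moreover have "at r within {0..} = at r" using \<open>r > 0\<close> by (intro at_within_interior) auto
  ultimately show ?thesis by (simp add: hderiv_def vector_derivative_at)
qed

section \<open>Weak supersolutions and the regularised inverse slope\<close>

lemma cball_subset_cball_0:
  assumes "\<rho> \<le> r"
  shows "cball x0 \<rho> \<subseteq> cball 0 (norm x0 + r)"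
proof
  fix x assume "x \<in> cball x0 \<rho>"
  then show "x \<in> cball 0 (norm x0 + r)"
    using norm_triangle_ineq[of x0 "x - x0"] assms by (simp add: dist_norm norm_minus_commute)
qed

lemma lipschitz_on_ball_bounded:
  fixes f :: "'a::euclidean_space \<Rightarrow> 'b::euclidean_space"
  assumes "C-lipschitz_on (ball x0 r) f"
  obtains M where "\<And>x. x \<in> ball x0 r \<Longrightarrow> norm (f x) \<le> M" "M > 0"
proof -
  have "bounded (f ` ball x0 r)"
    by (rule bounded_uniformly_continuous_image[OF lipschitz_on_uniformly_continuous[OF assms]]) auto
  then show ?thesis using that unfolding bounded_pos by blast
qed

lemma lipschitz_on_scaleR_bounded:
  fixes f :: "'a::metric_space \<Rightarrow> real" and g :: "'a \<Rightarrow> 'b::real_normed_vector"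
  assumes f: "C-lipschitz_on S f" "\<And>x. x \<in> S \<Longrightarrow> \<bar>f x\<bar> \<le> A"
    and g: "D-lipschitz_on S g" "\<And>x. x \<in> S \<Longrightarrow> norm (g x) \<le> B" and "0 \<le> A" "0 \<le> B"
  shows "(A * D + C * B)-lipschitz_on S (\<lambda>x. f x *\<^sub>R g x)"
proof (rule lipschitz_onI)
  show "0 \<le> A * D + C * B"
    using assms lipschitz_on_nonneg[OF f(1)] lipschitz_on_nonneg[OF g(1)] by simp
  fix x y assume xy: "x \<in> S" "y \<in> S"
  have "f x *\<^sub>R g x - f y *\<^sub>R g y = f x *\<^sub>R (g x - g y) + (f x - f y) *\<^sub>R g y"
    by (simp add: algebra_simps)
  then have "dist (f x *\<^sub>R g x) (f y *\<^sub>R g y) \<le> \<bar>f x\<bar> * dist (g x) (g y) + dist (f x) (f y) * norm (g y)"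
    by (metis dist_norm norm_scaleR norm_triangle_ineq real_norm_def)
  also have "\<dots> \<le> A * (D * dist x y) + (C * dist x y) * B"
    using xy assms lipschitz_onD[OF f(1) xy] lipschitz_onD[OF g(1) xy] lipschitz_on_nonneg[OF f(1)]
    by (intro add_mono mult_mono) auto
  finally show "dist (f x *\<^sub>R g x) (f y *\<^sub>R g y) \<le> (A * D + C * B) * dist x y"
    by (simp add: algebra_simps)
qed

text \<open>
  A jump to \<open>0\<close> at the sphere can only start from the smaller ball, and then the gap \<open>r - \<rho>\<close> pays for it.
\<close>

lemma lipschitz_zero_extension:
  fixes f :: "'a::metric_space \<Rightarrow> 'b::real_normed_vector"
  assumes f: "C-lipschitz_on (ball x0 r) f" "\<And>x. x \<in> ball x0 r \<Longrightarrow> norm (f x) \<le> M"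
    and zero: "\<And>x. x \<in> ball x0 r \<Longrightarrow> x \<notin> cball x0 \<rho> \<Longrightarrow> f x = 0" and "\<rho> < r" "0 \<le> M"
  shows "(C + M / (r - \<rho>))-lipschitz_on UNIV (\<lambda>x. if x \<in> ball x0 r then f x else 0)"
proof (rule lipschitz_onI)
  let ?f = "\<lambda>x. if x \<in> ball x0 r then f x else 0"
  have C0: "C \<ge> 0" by (rule lipschitz_on_nonneg[OF f(1)])
  have M0: "0 \<le> M / (r - \<rho>)" using assms by simp
  then show "0 \<le> C + M / (r - \<rho>)" using C0 by simp
  have one: "norm (f x) \<le> (C + M / (r - \<rho>)) * dist x y" if x: "x \<in> ball x0 r" and y: "y \<notin> ball x0 r" for x y
  proof (cases "x \<in> cball x0 \<rho>")
    case True
    have "r - \<rho> \<le> dist x y" using True y dist_triangle[of x0 y x] by simp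
    then have "M / (r - \<rho>) * (r - \<rho>) \<le> (C + M / (r - \<rho>)) * dist x y"
      using C0 M0 \<open>\<rho> < r\<close> by (intro mult_mono) auto
    then show ?thesis using f(2)[OF x] \<open>\<rho> < r\<close> by simp
  next
    case False
    then show ?thesis using zero[OF x False] C0 M0 by simp
  qed
  fix x y
  show "dist (?f x) (?f y) \<le> (C + M / (r - \<rho>)) * dist x y"
  proof (cases "x \<in> ball x0 r"; cases "y \<in> ball x0 r")
    assume xy: "x \<in> ball x0 r" "y \<in> ball x0 r"
    have "dist (f x) (f y) \<le> C * dist x y" by (rule lipschitz_onD[OF f(1) xy])
    also have "\<dots> \<le> (C + M / (r - \<rho>)) * dist x y" using M0 by (intro mult_right_mono) auto
    finally show ?thesis using xy by simp
  next
    assume "x \<in> ball x0 r" "y \<notin> ball x0 r"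
    then show ?thesis using one[of x y] by simp
  next
    assume "x \<notin> ball x0 r" "y \<in> ball x0 r"
    then show ?thesis using one[of y x] by (simp add: dist_commute)
  qed (use C0 M0 in simp)
qed

lemma quot_grad_zero_outside:
  assumes "\<And>x. x \<notin> cball x0 \<rho> \<Longrightarrow> \<eta> x = 0" "x \<notin> cball x0 \<rho>"
  shows "quot_grad \<eta> x = 0"
proof (rule quot_grad_eq)
  have "((\<lambda>x. 0) has_derivative (\<lambda>h. 0)) (at x)" by simp
  then have "(\<eta> has_derivative (\<lambda>h. 0)) (at x)"
    by (rule has_derivative_transform_within_open[of _ _ _ _ "- cball x0 \<rho>"]) (use assms in auto)
  then show "GDERIV \<eta> x :> 0" by (simp add: gderiv_def)
qed

text \<open>
  The integral of the divergence of the compactly supported Lipschitz field \<open>\<eta> W\<close> vanishes, and this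
  divergence is \<open>\<eta> div W + W \<bullet> \<nabla>\<eta>\<close>.
\<close>

lemma divergence_test:
  fixes W :: "real^'n::finite \<Rightarrow> real^'n"
  assumes W: "C-lipschitz_on (ball x0 r) W" and "\<And>x. x \<in> ball x0 r \<Longrightarrow> norm (W x) \<le> M"
    and der: "\<And>x. x \<in> ball x0 r \<Longrightarrow> (W has_derivative DW x) (at x)"
    and div: "\<And>x. x \<in> ball x0 r \<Longrightarrow> (\<Sum>i\<in>UNIV. DW x (axis i 1) $ i) \<le> 0"
    and \<eta>: "K-lipschitz_on UNIV \<eta>" "\<And>x. \<eta> x \<ge> 0" "\<And>x. x \<notin> cball x0 \<rho> \<Longrightarrow> \<eta> x = 0"
    and "0 < \<rho>" "\<rho> < r"
  shows "0 \<le> (LINT x|lborel. (indicat_real (ball x0 r) x *\<^sub>R W x) \<bullet> quot_grad \<eta> x)"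
proof -
  have M0: "M \<ge> 0" using assms(2)[of x0] norm_ge_zero[of "W x0"] \<open>0 < \<rho>\<close> \<open>\<rho> < r\<close> by (auto simp del: norm_ge_zero)
  define R where "R = norm x0 + r"
  have sub: "cball x0 \<rho> \<subseteq> cball 0 R"
  unfolding R_def
    by (rule cball_subset_cball_0) (use \<open>\<rho> < r\<close> in simp)
  have \<eta>R: "\<eta> x = 0" if "x \<notin> cball 0 R" for x using \<eta>(3) sub that by blast
  have \<eta>c: "continuous_on UNIV \<eta>" using \<eta>(1) by (rule lipschitz_on_continuous_on)
  have \<eta>m: "\<eta> \<in> borel_measurable borel" by (rule lipschitz_UNIV_measurable[OF \<eta>(1)])
  obtain B where B: "\<And>x. \<bar>\<eta> x\<bar> \<le> B" "B \<ge> 0" using bounded_support_bounded[OF \<eta>c \<eta>R] by blast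
  define \<zeta> where "\<zeta> i x = (if x \<in> ball x0 r then \<eta> x *\<^sub>R W x $ i else 0)" for i x
  have "\<exists>K'. K'-lipschitz_on UNIV (\<zeta> i)" for i
  proof -
    have Wi: "C-lipschitz_on (ball x0 r) (\<lambda>x. W x $ i)"
    proof (rule lipschitz_onI[OF _ lipschitz_on_nonneg[OF W]])
      fix x y assume "x \<in> ball x0 r" "y \<in> ball x0 r"
      then show "dist (W x $ i) (W y $ i) \<le> C * dist x y"
        using lipschitz_onD[OF W] dist_vec_nth_le order_trans by blast
    qed
    have Wb: "norm (W x $ i) \<le> M" if "x \<in> ball x0 r" for x
      using assms(2)[OF that] component_le_norm_cart[of "W x" i] by simp
    have "(B * C + K * M)-lipschitz_on (ball x0 r) (\<lambda>x. \<eta> x *\<^sub>R (W x $ i))"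
      by (rule lipschitz_on_scaleR_bounded[OF lipschitz_on_subset[OF \<eta>(1)] B(1) Wi Wb B(2) M0]) auto
    moreover have "norm (\<eta> x *\<^sub>R (W x $ i)) \<le> B * M" if "x \<in> ball x0 r" for x
      using B Wb[OF that] M0 by (auto simp: abs_mult intro!: mult_mono)
    ultimately show ?thesis
      unfolding \<zeta>_def using lipschitz_zero_extension[of _ x0 r "\<lambda>x. \<eta> x *\<^sub>R (W x $ i)" "B * M" \<rho>]
        \<eta>(3) \<open>\<rho> < r\<close> B(2) M0 by fastforce
  qed
  then obtain K' where K': "\<And>i. (K' i)-lipschitz_on UNIV (\<zeta> i)" by metis
  have \<zeta>0: "\<zeta> i x = 0" if "x \<notin> cball x0 \<rho>" for i x using \<eta>(3)[OF that] by (simp add: \<zeta>_def)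
  have \<zeta>R: "\<zeta> i x = 0" if "x \<notin> cball 0 R" for i x using \<zeta>0 sub that by blast
  have \<zeta>m: "\<zeta> i \<in> borel_measurable borel" for i by (rule lipschitz_UNIV_measurable[OF K'])
  have Wm: "(\<lambda>x. (indicat_real (ball x0 r) x *\<^sub>R W x) $ i) \<in> borel_measurable borel" for i
  proof -
    have "continuous_on (ball x0 r) (\<lambda>x. W x $ i)"
      by (intro continuous_intros lipschitz_on_continuous_on[OF W])
    then have "(\<lambda>x. indicat_real (ball x0 r) x *\<^sub>R (W x $ i)) \<in> borel_measurable borel"
      by (intro borel_measurable_continuous_on_indicator) auto
    then show ?thesis by simp
  qed
  have int1: "integrable lborel (\<lambda>x. dir_deriv (axis i 1) (\<zeta> i) x)" for i
  proof (rule integrable_AE_bounded_support[where B="K' i" and R=R])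
    show "dir_deriv (axis i 1) (\<zeta> i) \<in> borel_measurable borel" by (rule dir_deriv_measurable[OF \<zeta>m])
    show "AE x in lborel. \<bar>dir_deriv (axis i 1) (\<zeta> i) x\<bar> \<le> K' i \<and> (x \<notin> cball 0 R \<longrightarrow> dir_deriv (axis i 1) (\<zeta> i) x = 0)"
      using lipschitz_AE_dir_deriv[OF K'[of i], of "axis i 1"]
    proof eventually_elim
      case (elim x)
      have "\<bar>dir_deriv (axis i 1) (\<zeta> i) x\<bar> \<le> K' i"
        using dir_deriv_bound[OF K' elim] by (simp add: norm_axis_1)
      moreover have "dir_deriv (axis i 1) (\<zeta> i) x = 0" if "x \<notin> cball 0 R"
        using quot_grad_zero_outside[of x0 \<rho> "\<zeta> i" x] \<zeta>0 sub that
        using subsetD[OF sub, of x] by (auto simp: quot_grad_def vec_eq_iff)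
      ultimately show ?case by blast
    qed
  qed
  have int2: "integrable lborel (\<lambda>x. (indicat_real (ball x0 r) x *\<^sub>R W x) \<bullet> quot_grad \<eta> x)"
  proof (rule integrable_AE_bounded_support[where B="M * K" and R=R])
    have "(\<lambda>x. \<Sum>i\<in>UNIV. (indicat_real (ball x0 r) x *\<^sub>R W x) $ i * quot_grad \<eta> x $ i) \<in> borel_measurable borel"
      by (intro borel_measurable_sum borel_measurable_times Wm quot_grad_component_measurable \<eta>m)
    then show "(\<lambda>x. (indicat_real (ball x0 r) x *\<^sub>R W x) \<bullet> quot_grad \<eta> x) \<in> borel_measurable borel"
      by (simp add: inner_vec_def)
    show "AE x in lborel. \<bar>(indicat_real (ball x0 r) x *\<^sub>R W x) \<bullet> quot_grad \<eta> x\<bar> \<le> M * K \<and>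
        (x \<notin> cball 0 R \<longrightarrow> (indicat_real (ball x0 r) x *\<^sub>R W x) \<bullet> quot_grad \<eta> x = 0)"
      using rademacher[OF \<eta>(1)]
    proof eventually_elim
      case (elim x)
      have "\<bar>(indicat_real (ball x0 r) x *\<^sub>R W x) \<bullet> quot_grad \<eta> x\<bar> \<le> norm (indicat_real (ball x0 r) x *\<^sub>R W x) * norm (quot_grad \<eta> x)"
        by (rule Cauchy_Schwarz_ineq2)
      also have "\<dots> \<le> M * K"
        using gderiv_bound[OF \<eta>(1) elim] assms(2)[of x] M0 by (intro mult_mono) (auto split: split_indicator)
      moreover have "quot_grad \<eta> x = 0" if "x \<notin> cball 0 R"
        using that sub by (intro quot_grad_zero_outside[of x0 \<rho>] \<eta>(3)) auto
      ultimately show ?case by auto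
    qed
  qed
  have "0 = (\<Sum>i\<in>UNIV. LINT x|lborel. dir_deriv (axis i 1) (\<zeta> i) x)"
    using integral_dir_deriv_zero[OF K' \<zeta>R] by simp
  also have "\<dots> = (LINT x|lborel. (\<Sum>i\<in>UNIV. dir_deriv (axis i 1) (\<zeta> i) x))"
    by (rule Bochner_Integration.integral_sum[symmetric]) (rule int1)
  also have "\<dots> \<le> (LINT x|lborel. (indicat_real (ball x0 r) x *\<^sub>R W x) \<bullet> quot_grad \<eta> x)"
  proof (rule integral_mono_AE)
    show "integrable lborel (\<lambda>x. \<Sum>i\<in>UNIV. dir_deriv (axis i 1) (\<zeta> i) x)"
      by (rule Bochner_Integration.integrable_sum) (rule int1)
    show "AE x in lborel. (\<Sum>i\<in>UNIV. dir_deriv (axis i 1) (\<zeta> i) x) \<le> (indicat_real (ball x0 r) x *\<^sub>R W x) \<bullet> quot_grad \<eta> x"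
      using rademacher[OF \<eta>(1)]
    proof eventually_elim
      case (elim x)
      show ?case
      proof (cases "x \<in> ball x0 r")
        case True
        have "(\<zeta> i has_derivative (\<lambda>h. \<eta> x * (DW x h $ i) + (h \<bullet> quot_grad \<eta> x) * W x $ i)) (at x)" for i
        proof -
          have "((\<lambda>x. W x $ i) has_derivative (\<lambda>h. DW x h $ i)) (at x)"
            by (rule bounded_linear.has_derivative[OF bounded_linear_vec_nth der[OF True]])
          from has_derivative_mult[OF elim[unfolded gderiv_def] this]
          show ?thesis
            by (rule has_derivative_transform_within_open[of _ _ _ _ "ball x0 r"]) (use True in \<open>auto simp: \<zeta>_def\<close>)
        qed
        note hd = this
        have "dir_deriv (axis i 1) (\<zeta> i) x = \<eta> x * (DW x (axis i 1) $ i) + quot_grad \<eta> x $ i * W x $ i" for i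
          by (subst dir_deriv_eq[OF hd]) (simp add: inner_axis')
        then have "(\<Sum>i\<in>UNIV. dir_deriv (axis i 1) (\<zeta> i) x) = \<eta> x * (\<Sum>i\<in>UNIV. DW x (axis i 1) $ i) + W x \<bullet> quot_grad \<eta> x"
          by (simp add: sum.distrib sum_distrib_left inner_vec_def mult.commute)
        also have "\<dots> \<le> W x \<bullet> quot_grad \<eta> x"
          using div[OF True] \<eta>(2)[of x] by (simp add: mult_nonneg_nonpos)
        finally show ?thesis using True by simp
      next
        case False
        then have "x \<notin> cball x0 \<rho>" using \<open>\<rho> < r\<close> by auto
        then have "quot_grad (\<zeta> i) x = 0" for i by (intro quot_grad_zero_outside[of x0 \<rho>] \<zeta>0)
        then have "dir_deriv (axis i 1) (\<zeta> i) x = 0" for i by (simp add: quot_grad_def vec_eq_iff)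
        then show ?thesis using False by simp
      qed
    qed
  qed (rule int2)
  finally show ?thesis .
qed

text \<open>
  The inverse of \<open>f' + \<epsilon> id\<close>; for \<open>\<epsilon> = 0\<close> it is the derivative of the conjugate.
\<close>

definition slope_inv :: "(real \<Rightarrow> real) \<Rightarrow> real \<Rightarrow> real \<Rightarrow> real" where
  "slope_inv f \<epsilon> r = (SOME \<rho>. \<rho> \<ge> 0 \<and> hderiv f \<rho> + \<epsilon> * \<rho> = r)"

context
  fixes f :: "real \<Rightarrow> real"
  assumes reg: "regular_strictly_convex f" and zero: "hderiv f 0 = 0"
    and unb: "\<And>M. \<exists>\<rho>>0. hderiv f \<rho> \<ge> M"
begin

lemma slope_inv_solves:
  assumes "\<epsilon> \<ge> 0" "r \<ge> 0"
  shows "slope_inv f \<epsilon> r \<ge> 0" "hderiv f (slope_inv f \<epsilon> r) + \<epsilon> * slope_inv f \<epsilon> r = r"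
proof -
  have "\<exists>\<rho>. \<rho> \<ge> 0 \<and> hderiv f \<rho> + \<epsilon> * \<rho> = r" using slope_solvable[OF reg unb assms(1), of r] zero assms(2) by auto
  from someI_ex[OF this] show "slope_inv f \<epsilon> r \<ge> 0" "hderiv f (slope_inv f \<epsilon> r) + \<epsilon> * slope_inv f \<epsilon> r = r"
    unfolding slope_inv_def by auto
qed

lemma slope_inv_expanding:
  assumes "\<epsilon> \<ge> 0" "0 \<le> r" "r \<le> s"
  shows "slope_inv f \<epsilon> r \<le> slope_inv f \<epsilon> s" "\<epsilon> * (slope_inv f \<epsilon> s - slope_inv f \<epsilon> r) \<le> s - r"
proof -
  let ?a = "slope_inv f \<epsilon> r" and ?b = "slope_inv f \<epsilon> s"
  have a: "?a \<ge> 0" "hderiv f ?a + \<epsilon> * ?a = r" and b: "?b \<ge> 0" "hderiv f ?b + \<epsilon> * ?b = s"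
    using slope_inv_solves assms by auto
  show le: "?a \<le> ?b"
  proof (rule ccontr)
    assume "\<not> ?a \<le> ?b"
    then have "hderiv f ?b < hderiv f ?a" "\<epsilon> * ?b \<le> \<epsilon> * ?a"
      using b(1) assms(1) by (auto intro: hderiv_strict_mono[OF reg] mult_left_mono)
    then show False using a b assms(3) by linarith
  qed
  have "hderiv f ?a \<le> hderiv f ?b"
    using le a(1) hderiv_strict_mono[OF reg, of ?a ?b] by (cases "?a = ?b") auto
  then show "\<epsilon> * (?b - ?a) \<le> s - r" using a b by (simp add: right_diff_distrib)
qed

lemma slope_inv_pos: "\<epsilon> \<ge> 0 \<Longrightarrow> r > 0 \<Longrightarrow> slope_inv f \<epsilon> r > 0"
  using slope_inv_solves[of \<epsilon> r] zero by (cases "slope_inv f \<epsilon> r = 0") auto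

lemma slope_inv_lipschitz:
  assumes "\<epsilon> > 0"
  shows "(1 / \<epsilon>)-lipschitz_on {0..} (slope_inv f \<epsilon>)"
proof (rule lipschitz_on_leI)
  fix x y :: real assume "x \<in> {0..}" "y \<in> {0..}" "x \<le> y"
  then show "dist (slope_inv f \<epsilon> x) (slope_inv f \<epsilon> y) \<le> 1 / \<epsilon> * dist x y"
    using slope_inv_expanding[of \<epsilon> x y] assms by (simp add: dist_real_def field_simps)
qed (use assms in simp)

lemma slope_inv_le_0:
  assumes "\<epsilon> \<ge> 0" "r \<ge> 0"
  shows "slope_inv f \<epsilon> r \<le> slope_inv f 0 r"
proof (rule ccontr)
  assume c: "\<not> ?thesis"
  have "hderiv f (slope_inv f 0 r) < hderiv f (slope_inv f \<epsilon> r)"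
    using c slope_inv_solves[of 0 r] assms by (intro hderiv_strict_mono[OF reg]) auto
  moreover have "\<epsilon> * slope_inv f \<epsilon> r \<ge> 0" using slope_inv_solves[OF assms] assms by simp
  ultimately show False using slope_inv_solves[of 0 r] slope_inv_solves[of \<epsilon> r] assms by linarith
qed

lemma slope_inv_DERIV:
  assumes "\<epsilon> > 0" "r > 0"
  shows "(slope_inv f \<epsilon> has_real_derivative (1 / (deriv (hderiv f) (slope_inv f \<epsilon> r) + \<epsilon>))) (at r)"
proof -
  let ?D = "deriv (hderiv f) (slope_inv f \<epsilon> r) + \<epsilon>"
  have pos: "slope_inv f \<epsilon> r > 0" using slope_inv_pos assms by simp
  have D: "?D > 0" using deriv_hderiv_nonneg[OF reg pos] assms(1) by linarith
  have "(slope_inv f \<epsilon> has_real_derivative inverse ?D) (at r)"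
  proof (rule DERIV_inverse_function[where f="\<lambda>\<rho>. hderiv f \<rho> + \<epsilon> * \<rho>" and a=0 and b="r+1"])
    show "((\<lambda>\<rho>. hderiv f \<rho> + \<epsilon> * \<rho>) has_real_derivative ?D) (at (slope_inv f \<epsilon> r))"
      by (auto intro!: derivative_eq_intros hderiv_deriv[OF reg pos])
    show "hderiv f (slope_inv f \<epsilon> y) + \<epsilon> * slope_inv f \<epsilon> y = y" if "0 < y" "y < r + 1" for y
      using slope_inv_solves[of \<epsilon> y] assms that by simp
    have "continuous_on {0<..} (slope_inv f \<epsilon>)"
      by (rule continuous_on_subset[OF lipschitz_on_continuous_on[OF slope_inv_lipschitz[OF assms(1)]]]) auto
    then show "isCont (slope_inv f \<epsilon>) r" using assms(2) by (simp add: continuous_on_eq_continuous_at)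
  qed (use D assms in auto)
  then show ?thesis by (simp add: inverse_eq_divide)
qed

lemma slope_inv_tendsto:
  assumes "r \<ge> 0" "e \<longlonglongrightarrow> 0" "\<And>k. e k > 0"
  shows "(\<lambda>k. slope_inv f (e k) r) \<longlonglongrightarrow> slope_inv f 0 r"
proof (rule LIMSEQ_I)
  fix \<tau> :: real assume \<tau>: "\<tau> > 0"
  let ?\<rho> = "slope_inv f 0 r"
  have d: "dual_point f r ?\<rho>" using slope_inv_solves[of 0 r] assms(1) by (simp add: dual_point_def)
  have "uniform_limit {0..} (\<lambda>n::nat. f) f sequentially" by (rule uniform_limit_const)
  from slope_inverse_stable[OF reg reg this d \<tau>] obtain N \<epsilon>0 \<delta> where \<epsilon>0: "\<epsilon>0 > 0" "\<delta> > 0"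
    and st: "\<And>n \<epsilon> s \<rho>. n \<ge> (N::nat) \<Longrightarrow> 0 \<le> \<epsilon> \<Longrightarrow> \<epsilon> \<le> \<epsilon>0 \<Longrightarrow> \<bar>s - r\<bar> < \<delta> \<Longrightarrow> \<rho> \<ge> 0 \<Longrightarrow> s \<le> hderiv f \<rho> + \<epsilon> * \<rho> \<Longrightarrow>
      (\<rho> > 0 \<longrightarrow> hderiv f \<rho> + \<epsilon> * \<rho> = s) \<Longrightarrow> \<bar>\<rho> - ?\<rho>\<bar> < \<tau>"
    by blast
  have "\<forall>\<^sub>F k in sequentially. e k < \<epsilon>0" by (rule order_tendstoD(2)[OF assms(2) \<epsilon>0(1)])
  then obtain K where K: "\<And>k. k \<ge> K \<Longrightarrow> e k < \<epsilon>0" by (auto simp: eventually_sequentially)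
  have "norm (slope_inv f (e k) r - ?\<rho>) < \<tau>" if "k \<ge> K" for k
    using slope_inv_solves[of "e k" r] assms(1) assms(3)[of k] K[OF that] \<epsilon>0(2) st[of N "e k" r "slope_inv f (e k) r"] by simp
  then show "\<exists>K. \<forall>k\<ge>K. norm (slope_inv f (e k) r - ?\<rho>) < \<tau>" by blast
qed

end

text \<open>
  The gradient of a radial function \<open>G(|p|)\<close> with \<open>G' = g\<close>; it takes the value \<open>0\<close> at \<open>p = 0\<close>.
\<close>

definition radial_field :: "(real \<Rightarrow> real) \<Rightarrow> real^'n::finite \<Rightarrow> real^'n" where
  "radial_field g p = (g (norm p) / norm p) *\<^sub>R p"

lemma radial_field_has_derivative:
  fixes P :: "real^'n::finite \<Rightarrow> real^'n"
  assumes P: "(P has_derivative (\<lambda>h. H *v h)) (at x)" and nz: "P x \<noteq> 0"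
    and g: "(g has_real_derivative g') (at (norm (P x)))"
  shows "((\<lambda>x. radial_field g (P x)) has_derivative
    (\<lambda>h. (g (norm (P x)) / norm (P x)) *\<^sub>R (H *v h) +
        ((g' * norm (P x) - g (norm (P x))) / (norm (P x))\<^sup>2 * ((H *v h) \<bullet> sgn (P x))) *\<^sub>R P x)) (at x)"
proof -
  let ?s = "norm (P x)"
  have s: "?s > 0" using nz by simp
  have n: "((\<lambda>x. norm (P x)) has_derivative (\<lambda>h. (H *v h) \<bullet> sgn (P x))) (at x)"
    using has_derivative_compose[OF P has_derivative_norm[OF nz]] .
  have "((\<lambda>s. g s / s) has_real_derivative ((g' * ?s - g ?s) / ?s\<^sup>2)) (at ?s)"
    using DERIV_divide[OF g DERIV_ident, of] s by (simp add: power2_eq_square)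
  then have k: "((\<lambda>x. g (norm (P x)) / norm (P x)) has_derivative
      (\<lambda>h. (g' * ?s - g ?s) / ?s\<^sup>2 * ((H *v h) \<bullet> sgn (P x)))) (at x)"
    using has_derivative_compose[OF n, of "\<lambda>s. g s / s"] unfolding has_field_derivative_def by blast
  show ?thesis unfolding radial_field_def by (rule has_derivative_scaleR[OF k P])
qed

text \<open>
  The trace of the derivative in \<open>radial_field_has_derivative\<close>: the flux equation in nondivergence form.
\<close>

lemma radial_field_divergence:
  fixes p :: "real^'n::finite"
  assumes "p \<noteq> 0"
  shows "(\<Sum>i\<in>UNIV. ((g (norm p) / norm p) *\<^sub>R (H *v axis i 1) +
        ((g' * norm p - g (norm p)) / (norm p)\<^sup>2 * ((H *v axis i 1) \<bullet> sgn p)) *\<^sub>R p) $ i) =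
    g (norm p) / norm p * trace H + (g' * norm p - g (norm p)) / (norm p) ^ 3 * ((H *v p) \<bullet> p)"
proof -
  let ?c = "(g' * norm p - g (norm p)) / (norm p)\<^sup>2"
  have col: "(H *v axis i 1) $ j = H $ j $ i" for i j
    by (simp add: matrix_vector_mult_basis column_def)
  have "(\<Sum>i\<in>UNIV. ((H *v axis i 1) \<bullet> sgn p) * p $ i) = ((H *v p) \<bullet> p) / norm p"
  proof -
    have "((H *v axis i 1) \<bullet> sgn p) * p $ i = (\<Sum>j\<in>UNIV. H $ j $ i * p $ i * p $ j / norm p)" for i
      by (simp add: inner_vec_def col sgn_div_norm sum_distrib_right sum_distrib_left divide_inverse algebra_simps)
    then have "(\<Sum>i\<in>UNIV. ((H *v axis i 1) \<bullet> sgn p) * p $ i) = (\<Sum>i\<in>UNIV. \<Sum>j\<in>UNIV. H $ j $ i * p $ i * p $ j / norm p)"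
      by simp
    also have "\<dots> = (\<Sum>j\<in>UNIV. \<Sum>i\<in>UNIV. H $ j $ i * p $ i * p $ j / norm p)" by (rule sum.swap)
    also have "\<dots> = ((H *v p) \<bullet> p) / norm p"
      by (simp add: inner_vec_def matrix_vector_mult_def sum_distrib_right sum_divide_distrib)
    finally show ?thesis .
  qed
  then have "?c * (\<Sum>i\<in>UNIV. ((H *v axis i 1) \<bullet> sgn p) * p $ i) = ?c * (((H *v p) \<bullet> p) / norm p)"
    by (rule arg_cong)
  then have "(\<Sum>i\<in>UNIV. ?c * ((H *v axis i 1) \<bullet> sgn p) * p $ i) = ?c * (((H *v p) \<bullet> p) / norm p)"
    by (simp only: sum_distrib_left mult.assoc)
  moreover have "?c * (((H *v p) \<bullet> p) / norm p) = (g' * norm p - g (norm p)) / (norm p) ^ 3 * ((H *v p) \<bullet> p)"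
    by (simp add: power2_eq_square power3_eq_cube)
  moreover have "(\<Sum>i\<in>UNIV. g (norm p) / norm p * ((H *v axis i 1) $ i)) = g (norm p) / norm p * trace H"
    by (simp add: col trace_def sum_distrib_left)
  ultimately show ?thesis by (simp add: sum.distrib)
qed

lemma C2_gradient_lipschitz:
  assumes "C2_with \<Omega> \<phi> P H" "cball x0 r \<subseteq> \<Omega>"
  obtains C where "C-lipschitz_on (ball x0 r) P"
proof -
  have der: "(P has_derivative (\<lambda>h. H x *v h)) (at x)" if "x \<in> \<Omega>" for x
    using assms(1) that by (auto simp: C2_with_def)
  have "compact (H ` cball x0 r)"
    using assms by (intro compact_continuous_image) (auto simp: C2_with_def intro: continuous_on_subset)
  then obtain B where B: "\<And>x. x \<in> cball x0 r \<Longrightarrow> norm (H x) \<le> B"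
    using compact_imp_bounded[of "H ` cball x0 r"] unfolding bounded_iff by blast
  define C where "C = \<bar>real CARD('a) * real CARD('a) * B\<bar>"
  have on: "onorm (\<lambda>h. H x *v h) \<le> C" if "x \<in> ball x0 r" for x
  proof -
    have "\<bar>H x $ i $ j\<bar> \<le> B" for i j
      using component_le_norm_cart[of "H x $ i" j] Finite_Cartesian_Product.norm_nth_le[of "H x" i] B[of x] that by auto
    then have "onorm ((*v) (H x)) \<le> real CARD('a) * real CARD('a) * B" by (rule onorm_le_matrix_component)
    then show ?thesis by (simp add: C_def)
  qed
  have "C-lipschitz_on (ball x0 r) P"
  proof (rule lipschitz_onI)
    fix x y assume xy: "x \<in> ball x0 r" "y \<in> ball x0 r"
    have "norm (P x - P y) \<le> C * norm (x - y)"
      by (rule differentiable_bound[OF convex_ball _ on xy])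
         (use der assms(2) ball_subset_cball in \<open>blast intro: has_derivative_at_withinI\<close>)
    then show "dist (P x) (P y) \<le> C * dist x y" by (simp add: dist_norm)
  qed (simp add: C_def)
  then show ?thesis by (rule that)
qed

text \<open>
  The function \<open>\<phi>\<close> is a weak supersolution of the equation with flux \<open>radial_field (slope_inv f 0)\<close>.  For
  \<open>\<epsilon> > 0\<close> the flux field along \<open>\<phi>\<close> is differentiable, and the hypothesis \<open>sign\<close> says that its divergence is
  nonpositive: with \<open>s = |\<nabla>\<phi>|\<close> and \<open>g = slope_inv f \<epsilon>\<close> the divergence is
  \<open>g'(s) / s\<^sup>2\<close> times the left-hand side of that inequality.  The bound on the flux is uniform in \<open>\<epsilon>\<close>, so
  the inequality survives the limit \<open>\<epsilon> \<rightarrow> 0\<close>.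
\<close>

lemma slope_flux_nonneg:
  fixes \<phi> :: "real^'n::finite \<Rightarrow> real"
  assumes reg: "regular_strictly_convex f" and zero: "hderiv f 0 = 0"
    and unb: "\<And>M. \<exists>\<rho>>0. hderiv f \<rho> \<ge> M"
    and C2: "C2_with \<Omega> \<phi> P H" and sub: "cball x0 r \<subseteq> \<Omega>"
    and m: "m > 0" "\<And>x. x \<in> ball x0 r \<Longrightarrow> m \<le> norm (P x)"
    and \<epsilon>0: "\<epsilon>0 > 0"
    and sign: "\<And>x \<epsilon> a. x \<in> ball x0 r \<Longrightarrow> 0 < \<epsilon> \<Longrightarrow> \<epsilon> \<le> \<epsilon>0 \<Longrightarrow>
      a = slope_inv f \<epsilon> (norm (P x)) * (deriv (hderiv f) (slope_inv f \<epsilon> (norm (P x))) + \<epsilon>) / norm (P x) \<Longrightarrow>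
      (1 - a) * ((H x *v P x) \<bullet> P x) + (norm (P x))\<^sup>2 * a * trace (H x) \<le> 0"
    and \<eta>: "K-lipschitz_on UNIV \<eta>" "\<And>x. \<eta> x \<ge> 0" "\<And>x. x \<notin> cball x0 \<rho> \<Longrightarrow> \<eta> x = 0"
    and \<rho>: "0 < \<rho>" "\<rho> < r"
  shows "0 \<le> (LINT x|lborel. (indicat_real (ball x0 r) x *\<^sub>R radial_field (slope_inv f 0) (P x)) \<bullet> quot_grad \<eta> x)"
    and "integrable lborel (\<lambda>x. (indicat_real (ball x0 r) x *\<^sub>R radial_field (slope_inv f 0) (P x)) \<bullet> quot_grad \<eta> x)"
proof -
  obtain C where C: "C-lipschitz_on (ball x0 r) P" using C2_gradient_lipschitz[OF C2 sub] .
  have der: "(P has_derivative (\<lambda>h. H x *v h)) (at x)" if "x \<in> ball x0 r" for x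
    using C2 sub that by (auto simp: C2_with_def subset_iff)
  obtain M where M: "\<And>x. x \<in> ball x0 r \<Longrightarrow> norm (P x) \<le> M" "M > 0"
    by (rule lipschitz_on_ball_bounded[OF C]) blast
  define G where "G = slope_inv f 0 M"
  have g_bound: "0 \<le> slope_inv f \<epsilon> (norm (P x))" "slope_inv f \<epsilon> (norm (P x)) \<le> G" if "x \<in> ball x0 r" "\<epsilon> \<ge> 0" for x \<epsilon>
  proof -
    show "0 \<le> slope_inv f \<epsilon> (norm (P x))" using slope_inv_solves(1)[OF reg zero unb] that by simp
    have "slope_inv f \<epsilon> (norm (P x)) \<le> slope_inv f 0 (norm (P x))"
      by (rule slope_inv_le_0[OF reg zero unb]) (use that in auto)
    also have "\<dots> \<le> G" unfolding G_def
      by (rule slope_inv_expanding(1)[OF reg zero unb]) (use M(1)[OF that(1)] in auto)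
    finally show "slope_inv f \<epsilon> (norm (P x)) \<le> G" .
  qed
  have G0: "G \<ge> 0" unfolding G_def using slope_inv_solves(1)[OF reg zero unb, of 0 M] M(2) by simp
  have Wb: "norm (radial_field (slope_inv f \<epsilon>) (P x)) \<le> G" if "x \<in> ball x0 r" "\<epsilon> \<ge> 0" for x \<epsilon>
    using g_bound[OF that] m(1) m(2)[OF that(1)] by (auto simp: radial_field_def)
  have Wlip: "\<exists>C'. C'-lipschitz_on (ball x0 r) (\<lambda>x. radial_field (slope_inv f \<epsilon>) (P x))" if \<epsilon>: "\<epsilon> > 0" for \<epsilon>
  proof -
    have nlip: "C-lipschitz_on (ball x0 r) (\<lambda>x. norm (P x))"
    proof (rule lipschitz_onI[OF _ lipschitz_on_nonneg[OF C]])
      fix x y assume xy: "x \<in> ball x0 r" "y \<in> ball x0 r"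
      have "dist (norm (P x)) (norm (P y)) \<le> dist (P x) (P y)" by (simp add: dist_norm norm_triangle_ineq3)
      also have "\<dots> \<le> C * dist x y" by (rule lipschitz_onD[OF C xy])
      finally show "dist (norm (P x)) (norm (P y)) \<le> C * dist x y" .
    qed
    have 1: "(1 / \<epsilon> * C)-lipschitz_on (ball x0 r) (\<lambda>x. slope_inv f \<epsilon> (norm (P x)))"
    proof (rule lipschitz_on_compose2[OF nlip])
      show "(1 / \<epsilon>)-lipschitz_on ((\<lambda>x. norm (P x)) ` ball x0 r) (slope_inv f \<epsilon>)"
        by (rule lipschitz_on_subset[OF slope_inv_lipschitz[OF reg zero unb \<epsilon>]]) auto
    qed
    have "(1 / m\<^sup>2)-lipschitz_on {m..} inverse"
    proof (rule lipschitz_onI)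
      fix s t :: real assume st: "s \<in> {m..}" "t \<in> {m..}"
      have "dist (inverse s) (inverse t) = dist s t * inverse (s * t)"
        using st m(1) by (simp add: dist_real_def inverse_diff_inverse abs_mult abs_inverse abs_minus_commute field_simps)
      also have "\<dots> \<le> dist s t * inverse (m * m)"
        using st m(1) by (intro mult_left_mono le_imp_inverse_le mult_mono) auto
      finally show "dist (inverse s) (inverse t) \<le> 1 / m\<^sup>2 * dist s t" by (simp add: power2_eq_square field_simps)
    qed simp
    then have 2: "(1 / m\<^sup>2 * C)-lipschitz_on (ball x0 r) (\<lambda>x. inverse (norm (P x)))"
      by (intro lipschitz_on_compose2[OF nlip]) (rule lipschitz_on_subset, use m(2) in auto)
    have inv: "\<bar>inverse (norm (P x))\<bar> \<le> inverse m" if "x \<in> ball x0 r" for x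
      using m(1) m(2)[OF that] by (simp add: le_imp_inverse_le)
    have "(inverse m * C + 1 / m\<^sup>2 * C * M)-lipschitz_on (ball x0 r) (\<lambda>x. inverse (norm (P x)) *\<^sub>R P x)"
      by (rule lipschitz_on_scaleR_bounded[OF 2 inv C M(1)]) (use m(1) M(2) in auto)
    note 3 = this
    have b3: "norm (inverse (norm (P x)) *\<^sub>R P x) \<le> 1" for x
      by (cases "P x = 0") auto
    have "(G * (inverse m * C + 1 / m\<^sup>2 * C * M) + 1 / \<epsilon> * C * 1)-lipschitz_on (ball x0 r)
        (\<lambda>x. slope_inv f \<epsilon> (norm (P x)) *\<^sub>R (inverse (norm (P x)) *\<^sub>R P x))"
      by (rule lipschitz_on_scaleR_bounded[OF 1 _ 3 b3]) (use g_bound \<epsilon> G0 in \<open>auto simp: abs_le_iff\<close>)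
    then show ?thesis by (auto simp: radial_field_def divide_inverse)
  qed
  define e where "e k = \<epsilon>0 / real (Suc k)" for k
  have e: "0 < e k" "e k \<le> \<epsilon>0" for k using \<epsilon>0 by (auto simp: e_def field_simps)
  have e0: "e \<longlonglongrightarrow> 0"
  proof -
    have "(\<lambda>k. \<epsilon>0 * inverse (real (Suc k))) \<longlonglongrightarrow> \<epsilon>0 * 0"
      by (intro tendsto_intros LIMSEQ_inverse_real_of_nat)
    then show ?thesis by (simp add: e_def[abs_def] divide_inverse)
  qed
  let ?I = "\<lambda>\<epsilon> x. (indicat_real (ball x0 r) x *\<^sub>R radial_field (slope_inv f \<epsilon>) (P x)) \<bullet> quot_grad \<eta> x"
  have nonneg: "0 \<le> (LINT x|lborel. ?I (e k) x)" for k
  proof -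
    obtain C' where C': "C'-lipschitz_on (ball x0 r) (\<lambda>x. radial_field (slope_inv f (e k)) (P x))"
      using Wlip[OF e(1)] by blast
    define g' where "g' x = 1 / (deriv (hderiv f) (slope_inv f (e k) (norm (P x))) + e k)" for x
    show ?thesis
    proof (rule divergence_test[OF C' _ _ _ \<eta> \<rho>])
      fix x assume x: "x \<in> ball x0 r"
      have px: "norm (P x) > 0" "P x \<noteq> 0" using m(1) m(2)[OF x] by auto
      let ?s = "norm (P x)" and ?\<rho> = "slope_inv f (e k) (norm (P x))"
      show "norm (radial_field (slope_inv f (e k)) (P x)) \<le> G" using Wb[OF x] e(1)[of k] by simp
      have "(slope_inv f (e k) has_real_derivative g' x) (at ?s)"
        unfolding g'_def by (rule slope_inv_DERIV[OF reg zero unb e(1) px(1)])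
      from radial_field_has_derivative[OF der[OF x] px(2) this]
      show "((\<lambda>x. radial_field (slope_inv f (e k)) (P x)) has_derivative
        (\<lambda>h. (?\<rho> / ?s) *\<^sub>R (H x *v h) + ((g' x * ?s - ?\<rho>) / ?s\<^sup>2 * ((H x *v h) \<bullet> sgn (P x))) *\<^sub>R P x)) (at x)" .
      define a where "a = ?\<rho> * (deriv (hderiv f) ?\<rho> + e k) / ?s"
      have D: "deriv (hderiv f) ?\<rho> + e k > 0"
        using deriv_hderiv_nonneg[OF reg slope_inv_pos[OF reg zero unb _ px(1)]] e(1)[of k]
        by (meson add_nonneg_pos less_imp_le)
      \<comment> \<open>By the inverse function rule \<open>a\<close> is the elasticity \<open>\<rho> / (s g'(s))\<close> of the regularised slope.\<close>
      have \<rho>a: "?\<rho> = a * ?s * g' x" using D px(1) by (simp add: a_def g'_def)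
      have "?\<rho> / ?s * trace (H x) + (g' x * ?s - ?\<rho>) / ?s ^ 3 * ((H x *v P x) \<bullet> P x) =
          g' x / ?s\<^sup>2 * ((1 - a) * ((H x *v P x) \<bullet> P x) + ?s\<^sup>2 * a * trace (H x))"
        unfolding \<rho>a using px(1) by (simp add: field_simps power2_eq_square power3_eq_cube)
      also have "\<dots> \<le> 0"
        using sign[OF x e(1) e(2), of a k] D by (intro mult_nonneg_nonpos) (auto simp: g'_def a_def)
      finally show "(\<Sum>i\<in>UNIV. ((?\<rho> / ?s) *\<^sub>R (H x *v axis i 1) + ((g' x * ?s - ?\<rho>) / ?s\<^sup>2 * ((H x *v axis i 1) \<bullet> sgn (P x))) *\<^sub>R P x) $ i) \<le> 0"
        using radial_field_divergence[OF px(2), of "slope_inv f (e k)" "H x" "g' x"] by simp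
    qed
  qed
  define R where "R = norm x0 + r"
  have csub: "cball x0 \<rho> \<subseteq> cball 0 R"
  unfolding R_def
    by (rule cball_subset_cball_0) (use \<rho> in simp)
  have \<eta>m: "\<eta> \<in> borel_measurable borel" by (rule lipschitz_UNIV_measurable[OF \<eta>(1)])
  have Im: "?I (e k) \<in> borel_measurable lborel" for k
  proof -
    obtain C' where C': "C'-lipschitz_on (ball x0 r) (\<lambda>x. radial_field (slope_inv f (e k)) (P x))"
      using Wlip[OF e(1)] by blast
    have "(\<lambda>x. indicat_real (ball x0 r) x *\<^sub>R radial_field (slope_inv f (e k)) (P x) $ i) \<in> borel_measurable borel" for i
      by (intro borel_measurable_continuous_on_indicator continuous_intros lipschitz_on_continuous_on[OF C']) auto
    then have "(\<lambda>x. \<Sum>i\<in>UNIV. (indicat_real (ball x0 r) x *\<^sub>R radial_field (slope_inv f (e k)) (P x) $ i) * quot_grad \<eta> x $ i) \<in> borel_measurable borel"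
      by (intro borel_measurable_sum borel_measurable_times quot_grad_component_measurable \<eta>m)
    then show ?thesis by (simp add: inner_vec_def)
  qed
  have lim: "(\<lambda>k. ?I (e k) x) \<longlonglongrightarrow> ?I 0 x" for x
    unfolding radial_field_def divide_inverse
    by (intro tendsto_inner tendsto_scaleR tendsto_mult tendsto_const slope_inv_tendsto[OF reg zero unb _ e0 e(1)]) auto
  have Im0: "?I 0 \<in> borel_measurable lborel"
    by (rule borel_measurable_LIMSEQ_real[OF _ Im]) (rule lim)
  have bound: "AE x in lborel. norm (?I \<epsilon> x) \<le> G * K * indicat_real (cball 0 R) x" if "\<epsilon> \<ge> 0" for \<epsilon>
    using rademacher[OF \<eta>(1)]
  proof eventually_elim
    case (elim x)
    have "\<bar>?I \<epsilon> x\<bar> \<le> norm (indicat_real (ball x0 r) x *\<^sub>R radial_field (slope_inv f \<epsilon>) (P x)) * norm (quot_grad \<eta> x)"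
      by (rule Cauchy_Schwarz_ineq2)
    also have "\<dots> \<le> G * K"
      using gderiv_bound[OF \<eta>(1) elim] Wb[of x, OF _ that] G0 by (intro mult_mono) (auto split: split_indicator)
    finally have "norm (?I \<epsilon> x) \<le> G * K" by simp
    moreover have "quot_grad \<eta> x = 0" if "x \<notin> cball 0 R"
      using that csub by (intro quot_grad_zero_outside[of x0 \<rho>] \<eta>(3)) auto
    ultimately show ?case by (cases "x \<in> cball 0 R") auto
  qed
  show "integrable lborel (?I 0)"
  proof (rule Bochner_Integration.integrable_bound[OF integrable_const_cball[of "G * K" R] Im0])
    have "AE x in lborel. norm (?I 0 x) \<le> G * K * indicat_real (cball 0 R) x" by (rule bound) simp
    then show "AE x in lborel. norm (?I 0 x) \<le> norm (G * K * indicat_real (cball 0 R) x)"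
    proof eventually_elim
      case (elim x)
      show ?case by (rule order_trans[OF elim]) (simp only: real_norm_def abs_ge_self)
    qed
  qed
  have "(\<lambda>k. LINT x|lborel. ?I (e k) x) \<longlonglongrightarrow> (LINT x|lborel. ?I 0 x)"
    by (rule integral_dominated_convergence[OF Im0 Im integrable_const_cball[of "G * K" R] AE_I2[OF lim] bound])
       (use e(1) in \<open>simp add: less_imp_le\<close>)
  then show "0 \<le> (LINT x|lborel. ?I 0 x)"
    by (rule LIMSEQ_le_const) (use nonneg in auto)
qed

section \<open>Comparison for the conjugate equation\<close>

text \<open>
  Only the functions \<open>f\<^sub>n\<close> at bounded distance from \<open>f\<close> inherit its superlinear growth, hence the
  restriction to large \<open>n\<close>.
\<close>

lemma eventually_slopes_unbounded:
  assumes adm: "admissible_lagrangean f" and reg: "\<And>n. regular_strictly_convex (fs n)"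
    and lim: "uniform_limit {0..} fs f sequentially"
  shows "\<forall>\<^sub>F n in sequentially. \<forall>M. \<exists>\<rho>>0. hderiv (fs n) \<rho> \<ge> M"
proof -
  have regf: "regular_strictly_convex f" using adm by (auto simp: admissible_lagrangean_def)
  have "\<forall>\<^sub>F n in sequentially. \<forall>\<rho>\<in>{0..}. dist (fs n \<rho>) (f \<rho>) < 1"
    using lim[unfolded uniform_limit_iff, rule_format, of 1] by simp
  then show ?thesis
  proof eventually_elim
    case (elim n)
    show ?case
    proof
      fix M
      obtain \<rho>1 where \<rho>1: "\<rho>1 > 0" "hderiv f \<rho>1 \<ge> M + 2" using hderiv_admissible_unbounded[OF adm] by blast
      define \<rho> where "\<rho> = max \<rho>1 1"
      have \<rho>: "\<rho> \<ge> 1" "hderiv f \<rho> \<ge> M + 2"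
        using hderiv_strict_mono[OF regf, of \<rho>1 \<rho>] \<rho>1 by (cases "\<rho>1 < 1"; auto simp: \<rho>_def max_def)+
      have 1: "f \<rho> + hderiv f \<rho> * (2 * \<rho> - \<rho>) < f (2 * \<rho>)"
        using \<rho>(1) by (intro above_tangent[OF regf]) auto
      have 2: "fs n (2 * \<rho>) + hderiv (fs n) (2 * \<rho>) * (\<rho> - 2 * \<rho>) < fs n \<rho>"
        using \<rho>(1) by (intro above_tangent[OF reg]) auto
      have 3: "\<bar>fs n \<rho> - f \<rho>\<bar> < 1" "\<bar>fs n (2 * \<rho>) - f (2 * \<rho>)\<bar> < 1"
        using elim \<rho>(1) by (auto simp: dist_real_def)
      have "(M + 2) * \<rho> \<le> hderiv f \<rho> * \<rho>" using \<rho> by (intro mult_right_mono) auto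
      then have "(M + 2) * \<rho> - 2 < hderiv (fs n) (2 * \<rho>) * \<rho>" using 1 2 3 by (simp add: algebra_simps)
      moreover have "M * \<rho> \<le> (M + 2) * \<rho> - 2" using \<rho>(1) by (simp add: distrib_right)
      ultimately have "M * \<rho> < hderiv (fs n) (2 * \<rho>) * \<rho>" by linarith
      then have "M < hderiv (fs n) (2 * \<rho>)" using \<rho>(1) by simp
      then show "\<exists>\<rho>>0. M \<le> hderiv (fs n) \<rho>" using \<rho>(1) by (intro exI[of _ "2 * \<rho>"]) auto
    qed
  qed
qed

text \<open>
  The elasticity of \<open>f\<^sub>n' + \<epsilon> id\<close> at \<open>\<rho>\<close> is \<open>\<alpha>\<^sub>n \<rho> + (\<epsilon> \<rho> / r) (1 - \<alpha>\<^sub>n \<rho>)\<close>, where \<open>r\<close> is the slope there.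
  It is close to \<open>\<alpha>\<^sub>n \<rho>\<close> for small \<open>\<epsilon>\<close>, uniformly for \<open>r\<close> near \<open>r\<^sub>0 > 0\<close>; moreover \<open>\<alpha>\<^sub>n\<close> is close to \<open>\<alpha>\<close>, the
  point \<open>\<rho>\<close> is close to \<open>\<rho>\<^sub>0\<close>, and \<open>\<alpha>\<close> is continuous as a locally uniform limit of continuous functions.
\<close>

lemma regularized_elasticity_limit:
  assumes adm: "admissible_lagrangean f" and reg: "\<And>n. regular_strictly_convex (fs n)"
    and zero: "\<And>n. hderiv (fs n) 0 = 0" and lim: "uniform_limit {0..} fs f sequentially"
    and el0: "\<And>n. \<exists>c. (elasticity (fs n) \<longlongrightarrow> c) (at_right 0)"
    and \<alpha>s: "\<And>n \<rho>. \<rho> > 0 \<Longrightarrow> \<alpha>s n \<rho> = elasticity (fs n) \<rho>" "\<And>n. \<alpha>s n 0 = Lim (at_right 0) (elasticity (fs n))"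
    and \<alpha>: "\<And>K. compact K \<Longrightarrow> K \<subseteq> {0..} \<Longrightarrow> uniform_limit K \<alpha>s \<alpha> sequentially"
    and r0: "r0 > 0" and d: "dual_point f r0 \<rho>0" and \<kappa>: "\<kappa> > 0"
  shows "\<exists>N \<epsilon>0 \<delta>. \<epsilon>0 > 0 \<and> \<delta> > 0 \<and> (\<forall>n\<ge>N. \<forall>\<epsilon> r \<rho>. 0 < \<epsilon> \<and> \<epsilon> \<le> \<epsilon>0 \<and> \<bar>r - r0\<bar> < \<delta> \<and> \<rho> > 0 \<and>
     hderiv (fs n) \<rho> + \<epsilon> * \<rho> = r \<longrightarrow> \<bar>\<rho> * (deriv (hderiv (fs n)) \<rho> + \<epsilon>) / r - \<alpha> \<rho>0\<bar> < \<kappa>)"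
proof -
  have regf: "regular_strictly_convex f" using adm by (auto simp: admissible_lagrangean_def)
  have \<rho>0: "\<rho>0 \<ge> 0" using d by (simp add: dual_point_def)
  define R where "R = \<rho>0 + 1"
  define K where "K = {0..R}"
  have K: "compact K" "K \<subseteq> {0..}" "\<rho>0 \<in> K" using \<rho>0 by (auto simp: K_def R_def)
  have cont_n: "continuous_on {0..} (\<alpha>s n)" for n
    unfolding continuous_on_eq_continuous_within
  proof
    fix \<rho> :: real assume "\<rho> \<in> {0..}"
    then consider "\<rho> > 0" | "\<rho> = 0" by fastforce
    then show "continuous (at \<rho> within {0..}) (\<alpha>s n)"
    proof cases
      case 1
      have "\<forall>\<^sub>F x in nhds \<rho>. x \<in> {0<..}" using 1 by (intro eventually_nhds_in_open) auto
      then have "\<forall>\<^sub>F x in nhds \<rho>. \<alpha>s n x = elasticity (fs n) x"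
        by eventually_elim (simp add: \<alpha>s(1))
      then have "isCont (\<alpha>s n) \<rho> \<longleftrightarrow> isCont (elasticity (fs n)) \<rho>" by (rule isCont_cong)
      then show ?thesis
        using elasticity_continuous[OF reg zero 1, of n] continuous_at_imp_continuous_within by blast
    next
      case 2
      obtain c where c: "(elasticity (fs n) \<longlongrightarrow> c) (at_right 0)" using el0 by blast
      then have c0: "\<alpha>s n 0 = c" using \<alpha>s(2)[of n] tendsto_Lim[OF _ c] by simp
      have "\<forall>\<^sub>F x in at_right 0. \<alpha>s n x = elasticity (fs n) x"
        using eventually_at_right_less[of "0::real"] by eventually_elim (simp add: \<alpha>s(1))
      then have "(\<alpha>s n \<longlongrightarrow> c) (at_right 0)" using c by (simp add: tendsto_cong)
      moreover have "at (0::real) within {0..} = at_right 0"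
        by (rule at_within_nhd[of 0 UNIV]) auto
      ultimately show ?thesis using 2 c0 by (simp add: continuous_within)
    qed
  qed
  have cont: "continuous_on K \<alpha>"
    by (rule uniform_limit_theorem[OF _ \<alpha>[OF K(1,2)]])
       (use continuous_on_subset[OF cont_n K(2)] in auto)
  obtain A where A: "\<And>\<rho>. \<rho> \<in> K \<Longrightarrow> \<bar>\<alpha> \<rho>\<bar> \<le> A" "A \<ge> 0"
  proof -
    have "bounded (\<alpha> ` K)" by (intro compact_imp_bounded compact_continuous_image cont K)
    then obtain A where "A > 0" "\<forall>y\<in>\<alpha> ` K. norm y \<le> A" unfolding bounded_pos by blast
    then show ?thesis using that[of A] by auto
  qed
  obtain \<tau>0 where \<tau>0: "\<tau>0 > 0" "\<And>\<rho>. \<rho> \<in> K \<Longrightarrow> \<bar>\<rho> - \<rho>0\<bar> < \<tau>0 \<Longrightarrow> \<bar>\<alpha> \<rho> - \<alpha> \<rho>0\<bar> < \<kappa> / 3"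
    using cont[unfolded continuous_on_iff, rule_format, OF K(3), of "\<kappa> / 3"] \<kappa> by (auto simp: dist_real_def)
  define \<tau> where "\<tau> = min \<tau>0 1"
  have \<tau>: "\<tau> > 0" "\<tau> \<le> 1" "\<tau> \<le> \<tau>0" using \<tau>0 by (auto simp: \<tau>_def)
  obtain N1 \<epsilon>1 \<delta>1 where st: "\<epsilon>1 > 0" "\<delta>1 > 0" "\<And>n \<epsilon> r \<rho>. n \<ge> N1 \<Longrightarrow> 0 \<le> \<epsilon> \<Longrightarrow> \<epsilon> \<le> \<epsilon>1 \<Longrightarrow> \<bar>r - r0\<bar> < \<delta>1 \<Longrightarrow> \<rho> \<ge> 0 \<Longrightarrow>
     hderiv (fs n) \<rho> + \<epsilon> * \<rho> = r \<Longrightarrow> \<bar>\<rho> - \<rho>0\<bar> < \<tau>"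
    using slope_inverse_stable[OF reg regf lim d \<tau>(1)] by (metis order_refl)
  have "\<forall>\<^sub>F n in sequentially. \<forall>\<rho>\<in>K. dist (\<alpha>s n \<rho>) (\<alpha> \<rho>) < \<kappa> / 3"
    using \<alpha>[OF K(1,2), unfolded uniform_limit_iff, rule_format, of "\<kappa> / 3"] \<kappa> by simp
  then obtain N2 where N2: "\<And>n \<rho>. n \<ge> N2 \<Longrightarrow> \<rho> \<in> K \<Longrightarrow> \<bar>\<alpha>s n \<rho> - \<alpha> \<rho>\<bar> < \<kappa> / 3"
    by (auto simp: eventually_sequentially dist_real_def)
  define B where "B = 1 + A + \<kappa>"
  have B: "B > 0" using A(2) \<kappa> by (simp add: B_def)
  have R: "R > 0" using \<rho>0 by (simp add: R_def)
  \<comment> \<open>Makes the regularisation term \<open>(\<epsilon> \<rho> / r) |1 - \<alpha>\<^sub>n \<rho>|\<close> at most \<open>\<kappa> / 6\<close>, given \<open>r \<ge> r0 / 2\<close>, \<open>\<rho> \<le> R\<close>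
    and the bound \<open>B\<close> for \<open>|1 - \<alpha>\<^sub>n \<rho>|\<close>.\<close>
  define \<epsilon>0 where "\<epsilon>0 = min \<epsilon>1 (\<kappa> * r0 / (12 * R * B))"
  define \<delta> where "\<delta> = min \<delta>1 (r0 / 2)"
  have \<epsilon>0: "\<epsilon>0 > 0" "\<epsilon>0 * (R * B) \<le> \<kappa> * r0 / 12"
  proof -
    show "\<epsilon>0 > 0" using st(1) \<kappa> r0 R B by (simp add: \<epsilon>0_def)
    have "\<epsilon>0 * (R * B) \<le> \<kappa> * r0 / (12 * R * B) * (R * B)"
      using R B by (intro mult_right_mono) (auto simp: \<epsilon>0_def)
    also have "\<dots> = \<kappa> * r0 / 12" using R B by (simp add: field_simps)
    finally show "\<epsilon>0 * (R * B) \<le> \<kappa> * r0 / 12" .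
  qed
  have "\<bar>\<rho> * (deriv (hderiv (fs n)) \<rho> + \<epsilon>) / r - \<alpha> \<rho>0\<bar> < \<kappa>"
    if n: "n \<ge> max N1 N2" and \<epsilon>: "0 < \<epsilon>" "\<epsilon> \<le> \<epsilon>0" and r: "\<bar>r - r0\<bar> < \<delta>" and \<rho>: "\<rho> > 0"
      "hderiv (fs n) \<rho> + \<epsilon> * \<rho> = r" for n \<epsilon> r \<rho>
  proof -
    have close: "\<bar>\<rho> - \<rho>0\<bar> < \<tau>"
      by (rule st(3)[of n \<epsilon> r \<rho>]) (use n \<epsilon> r \<rho> in \<open>auto simp: \<epsilon>0_def \<delta>_def\<close>)
    then have \<rho>K: "\<rho> \<in> K" using \<tau>(2) \<rho>(1) by (auto simp: K_def R_def)
    have rr: "r > r0 / 2" using r unfolding \<delta>_def min_less_iff_conj by (auto simp: abs_if split: if_splits)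
    have F: "hderiv (fs n) \<rho> > 0" using hderiv_strict_mono[OF reg, of 0 \<rho> n] zero \<rho>(1) by simp
    have el: "\<rho> * deriv (hderiv (fs n)) \<rho> = \<alpha>s n \<rho> * hderiv (fs n) \<rho>"
      using F \<alpha>s(1)[OF \<rho>(1), of n] by (simp add: elasticity_def)
    have "\<rho> * (deriv (hderiv (fs n)) \<rho> + \<epsilon>) = \<alpha>s n \<rho> * (r - \<epsilon> * \<rho>) + \<epsilon> * \<rho>"
    proof -
      have "r - \<epsilon> * \<rho> = hderiv (fs n) \<rho>" using \<rho>(2) by simp
      then show ?thesis using el by (simp add: distrib_left mult.commute)
    qed
    then have eq: "\<rho> * (deriv (hderiv (fs n)) \<rho> + \<epsilon>) / r = \<alpha>s n \<rho> + \<epsilon> * \<rho> / r * (1 - \<alpha>s n \<rho>)"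
      using rr r0 by (simp add: field_simps)
    have a1: "\<bar>\<alpha>s n \<rho> - \<alpha> \<rho>\<bar> < \<kappa> / 3" using N2 n \<rho>K by simp
    have a2: "\<bar>\<alpha> \<rho> - \<alpha> \<rho>0\<bar> < \<kappa> / 3" using \<tau>0(2)[OF \<rho>K] close \<tau>(3) by simp
    have a3: "\<bar>1 - \<alpha>s n \<rho>\<bar> \<le> B" using a1 A(1)[OF \<rho>K] \<kappa> unfolding B_def by linarith
    have "\<bar>\<epsilon> * \<rho> / r * (1 - \<alpha>s n \<rho>)\<bar> = \<epsilon> * \<rho> * \<bar>1 - \<alpha>s n \<rho>\<bar> / r"
      using \<epsilon> \<rho> rr r0 by (simp add: abs_mult)
    also have "\<dots> \<le> (\<epsilon>0 * R * B) / (r0 / 2)"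
      using \<epsilon> \<rho> \<rho>K a3 rr r0 \<epsilon>0(1) R by (intro frac_le mult_mono) (auto simp: K_def)
    also have "\<dots> \<le> \<kappa> / 6" using \<epsilon>0(2) r0 by (simp add: field_simps)
    finally have a4: "\<bar>\<epsilon> * \<rho> / r * (1 - \<alpha>s n \<rho>)\<bar> \<le> \<kappa> / 6" .
    show ?thesis unfolding eq using a1 a2 a4 \<kappa> by linarith
  qed
  then show ?thesis using \<epsilon>0(1) st(2) r0
    by (intro exI[of _ "max N1 N2"] exI[of _ \<epsilon>0] exI[of _ \<delta>]) (auto simp: \<delta>_def)
qed

text \<open>
  By the Cauchy-Schwarz inequality the left-hand side is at least
  \<open>(g |p| - g |q|) (|p| - |q|)\<close>, which settles the case \<open>|p| \<noteq> |q|\<close>.  For equal norms the two values are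
  the same positive multiple of \<open>p\<close> and \<open>q\<close>.
\<close>

lemma radial_field_strict_mono:
  fixes p q :: "real^'n::finite"
  assumes mono: "\<And>r s. 0 \<le> r \<Longrightarrow> r < s \<Longrightarrow> g r < g s" and g0: "g 0 = 0" and "p \<noteq> q"
  shows "(radial_field g p - radial_field g q) \<bullet> (p - q) > 0"
proof -
  have gn: "g r \<ge> 0" if "r \<ge> 0" for r using mono[of 0 r] g0 that by (cases "r = 0") auto
  have self: "radial_field g p \<bullet> p = g (norm p) * norm p" for p :: "real^'n"
    by (simp add: radial_field_def dot_square_norm power2_eq_square)
  have cross: "radial_field g p \<bullet> q \<le> g (norm p) * norm q" for p q :: "real^'n"
  proof -
    have "radial_field g p \<bullet> q \<le> norm (radial_field g p) * norm q" by (rule norm_cauchy_schwarz)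
    also have "\<dots> \<le> g (norm p) * norm q"
      using gn[of "norm p"] by (intro mult_right_mono) (auto simp: radial_field_def)
    finally show ?thesis .
  qed
  show ?thesis
  proof (cases "norm p = norm q")
    case True
    have pos: "norm p > 0"
    proof (rule ccontr)
      assume "\<not> norm p > 0"
      then have "p = 0" "q = 0" using True by auto
      then show False using \<open>p \<noteq> q\<close> by simp
    qed
    have "radial_field g p - radial_field g q = (g (norm p) / norm p) *\<^sub>R (p - q)"
      using True by (simp add: radial_field_def scaleR_right_diff_distrib)
    then have "(radial_field g p - radial_field g q) \<bullet> (p - q) = g (norm p) / norm p * (norm (p - q))\<^sup>2"
      by (simp add: dot_square_norm)
    also have "\<dots> > 0" using pos mono[of 0 "norm p"] g0 \<open>p \<noteq> q\<close> by (intro mult_pos_pos) auto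
    finally show ?thesis .
  next
    case False
    have "0 < (g (norm p) - g (norm q)) * (norm p - norm q)"
    proof (cases "norm p < norm q")
      case True
      then show ?thesis using mono[of "norm p" "norm q"] by (intro mult_neg_neg) auto
    next
      case F: False
      then show ?thesis using False mono[of "norm q" "norm p"] by (intro mult_pos_pos) auto
    qed
    also have "\<dots> \<le> (radial_field g p - radial_field g q) \<bullet> (p - q)"
      using cross[of p q] cross[of q p] by (simp add: inner_diff_left inner_diff_right self algebra_simps)
    finally show ?thesis .
  qed
qed

definition rot :: "real^2 \<Rightarrow> real^2" where
  "rot q = vector [- q $ 2, q $ 1]"

lemma rot_simps [simp]: "rot q $ 1 = - q $ 2" "rot q $ 2 = q $ 1" "norm (rot q) = norm q" "rot 0 = 0"
proof -
  show "rot q $ 1 = - q $ 2" "rot q $ 2 = q $ 1" by (simp_all add: rot_def)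
  then show "norm (rot q) = norm q" by (simp add: norm_vec_def L2_set_def sum_2 add.commute)
  show "rot 0 = 0" by (simp add: vec_eq_iff forall_2 rot_def)
qed

lemma inner_rot: "rot q \<bullet> w = q $ 1 * w $ 2 - q $ 2 * w $ 1"
  by (simp add: inner_vec_def sum_2)

lemma rot_minus: "rot (- q) = - rot q"
  by (simp add: vec_eq_iff forall_2)

text \<open>
  The right-hand side of the system for \<open>v\<^sub>n\<close> as a function of \<open>q = \<nabla>u\<^sub>n\<close>, including the convention that
  it is \<open>0\<close> where \<open>q = 0\<close>.
\<close>

definition conj_grad :: "(real \<Rightarrow> real) \<Rightarrow> real^2 \<Rightarrow> real^2" where
  "conj_grad f q = radial_field (hderiv f) (rot q)"

lemma radial_field_inverse:
  fixes p :: "real^'n::finite"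
  assumes "\<And>s. s > 0 \<Longrightarrow> h s > 0 \<and> g (h s) = s"
  shows "radial_field g (radial_field h p) = p"
proof (cases "p = 0")
  case False
  then have s: "norm p > 0" by simp
  have "norm (radial_field h p) = h (norm p)"
    using assms[OF s] s by (simp add: radial_field_def)
  then show ?thesis using assms[OF s] s by (simp add: radial_field_def[of g]) (simp add: radial_field_def)
qed (simp add: radial_field_def)

context
  fixes f :: "real \<Rightarrow> real"
  assumes reg: "regular_strictly_convex f" and zero: "hderiv f 0 = 0"
    and unb: "\<And>M. \<exists>\<rho>>0. hderiv f \<rho> \<ge> M"
begin

lemma slope_inv_0_hderiv: "s \<ge> 0 \<Longrightarrow> slope_inv f 0 (hderiv f s) = s"
proof -
  assume s: "s \<ge> 0"
  have "hderiv f s \<ge> 0" using hderiv_strict_mono[OF reg, of 0 s] zero s by (cases "s = 0") auto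
  then have "slope_inv f 0 (hderiv f s) \<ge> 0" "hderiv f (slope_inv f 0 (hderiv f s)) = hderiv f s"
    using slope_inv_solves[OF reg zero unb, of 0 "hderiv f s"] by auto
  then show ?thesis using hderiv_less_iff[OF reg] s by (metis less_irrefl linorder_neqE_linordered_idom)
qed

lemma slope_inv_0_strict_mono: "0 \<le> r \<Longrightarrow> r < s \<Longrightarrow> slope_inv f 0 r < slope_inv f 0 s"
  using slope_inv_solves[OF reg zero unb, of 0 r] slope_inv_solves[OF reg zero unb, of 0 s]
    hderiv_less_iff[OF reg, of "slope_inv f 0 r" "slope_inv f 0 s"] by simp

text \<open>
  The system solved for \<open>\<nabla>u\<close>: the flux along \<open>v\<close> is the quarter turn of \<open>\<nabla>u\<close>.
\<close>

lemma radial_field_conj_grad: "radial_field (slope_inv f 0) (conj_grad f q) = rot q"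
  unfolding conj_grad_def
proof (rule radial_field_inverse)
  fix s :: real assume "s > 0"
  then show "hderiv f s > 0 \<and> slope_inv f 0 (hderiv f s) = s"
    using hderiv_strict_mono[OF reg, of 0 s] zero slope_inv_0_hderiv[of s] by simp
qed

text \<open>
  Extended by \<open>0\<close>, the positive part \<open>\<eta>\<close> of \<open>v - \<phi>\<close> on the ball is a Lipschitz test function.  The flux
  along \<open>v\<close> is the quarter turn of \<open>\<nabla>u\<close>, so its integral against \<open>\<nabla>\<eta>\<close> vanishes, while the flux along
  \<open>\<phi>\<close> gives a nonnegative integral.  As \<open>\<nabla>\<eta> = \<nabla>v - \<nabla>\<phi>\<close> where \<open>\<eta> > 0\<close>, strict monotonicity of the flux
  forces \<open>\<nabla>\<eta> = 0\<close> almost everywhere.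
\<close>

lemma conjugate_comparison:
  fixes u v \<phi> :: "real^2 \<Rightarrow> real"
  assumes \<Omega>: "open \<Omega>" and u: "Lu-lipschitz_on \<Omega> u" and v: "Lv-lipschitz_on \<Omega> v"
    and conj: "AE x in lborel. x \<in> \<Omega> \<longrightarrow> (\<exists>q. GDERIV u x :> q \<and> GDERIV v x :> conj_grad f q)"
    and C2: "C2_with \<Omega> \<phi> P H" and sub: "cball x0 r \<subseteq> \<Omega>"
    and m: "m > 0" "\<And>x. x \<in> ball x0 r \<Longrightarrow> m \<le> norm (P x)"
    and \<epsilon>0: "\<epsilon>0 > 0"
    and sign: "\<And>x \<epsilon> a. x \<in> ball x0 r \<Longrightarrow> 0 < \<epsilon> \<Longrightarrow> \<epsilon> \<le> \<epsilon>0 \<Longrightarrow>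
      a = slope_inv f \<epsilon> (norm (P x)) * (deriv (hderiv f) (slope_inv f \<epsilon> (norm (P x))) + \<epsilon>) / norm (P x) \<Longrightarrow>
      (1 - a) * ((H x *v P x) \<bullet> P x) + (norm (P x))\<^sup>2 * a * trace (H x) \<le> 0"
    and \<rho>: "0 < \<rho>" "\<rho> < r"
    and bdry: "\<And>x. x \<in> ball x0 r \<Longrightarrow> x \<notin> cball x0 \<rho> \<Longrightarrow> v x \<le> \<phi> x"
    and x: "x \<in> ball x0 r"
  shows "v x \<le> \<phi> x"
proof -
  have bsub: "ball x0 r \<subseteq> \<Omega>" using sub ball_subset_cball by blast
  have \<phi>der: "GDERIV \<phi> y :> P y" if "y \<in> \<Omega>" for y using C2 that by (auto simp: C2_with_def)
  obtain CP where CP: "CP-lipschitz_on (ball x0 r) P" using C2_gradient_lipschitz[OF C2 sub] .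
  obtain M where M: "\<And>x. x \<in> ball x0 r \<Longrightarrow> norm (P x) \<le> M" "M > 0"
    by (rule lipschitz_on_ball_bounded[OF CP]) blast
  have \<phi>lip: "M-lipschitz_on (ball x0 r) \<phi>"
  proof (rule lipschitz_onI)
    fix y z assume yz: "y \<in> ball x0 r" "z \<in> ball x0 r"
    have der: "(\<phi> has_derivative (\<lambda>h. h \<bullet> P w)) (at w within ball x0 r)" if "w \<in> ball x0 r" for w
      by (rule has_derivative_at_withinI[OF \<phi>der[unfolded gderiv_def]]) (use that bsub in blast)
    have on: "onorm (\<lambda>h. h \<bullet> P w) \<le> M" if "w \<in> ball x0 r" for w
    proof (rule onorm_bound)
      fix h
      have "norm (h \<bullet> P w) \<le> norm h * norm (P w)" using Cauchy_Schwarz_ineq2[of h "P w"] by simp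
      also have "\<dots> \<le> norm h * M" using M(1)[OF that] by (intro mult_left_mono) auto
      finally show "norm (h \<bullet> P w) \<le> M * norm h" by (simp add: mult.commute)
    qed (use M(2) in simp)
    show "dist (\<phi> y) (\<phi> z) \<le> M * dist y z"
      using differentiable_bound[OF convex_ball der on yz] by (simp add: dist_norm)
  qed (use M(2) in simp)
  have dlip: "(Lv + M)-lipschitz_on (ball x0 r) (\<lambda>x. max 0 (v x - \<phi> x))"
  proof (rule lipschitz_onI)
    fix y z assume yz: "y \<in> ball x0 r" "z \<in> ball x0 r"
    have "\<bar>v y - v z\<bar> \<le> Lv * dist y z" "\<bar>\<phi> y - \<phi> z\<bar> \<le> M * dist y z"
      using lipschitz_onD[OF v subsetD[OF bsub yz(1)] subsetD[OF bsub yz(2)]] lipschitz_onD[OF \<phi>lip yz]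
      by (simp_all add: dist_real_def)
    then show "dist (max 0 (v y - \<phi> y)) (max 0 (v z - \<phi> z)) \<le> (Lv + M) * dist y z"
      unfolding dist_real_def distrib_right by linarith
  qed (use lipschitz_on_nonneg[OF v] M(2) in simp)
  define \<eta> where "\<eta> x = (if x \<in> ball x0 r then max 0 (v x - \<phi> x) else 0)" for x
  obtain B where B: "\<And>x. x \<in> ball x0 r \<Longrightarrow> norm (max 0 (v x - \<phi> x)) \<le> B" "B > 0"
    by (rule lipschitz_on_ball_bounded[OF dlip]) blast
  define K where "K = Lv + M + B / (r - \<rho>)"
  have \<eta>lip: "K-lipschitz_on UNIV \<eta>"
    unfolding K_def \<eta>_def
    by (rule lipschitz_zero_extension[OF dlip B(1) _ \<rho>(2)]) (use bdry B(2) in auto)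
  have \<eta>0: "\<eta> x \<ge> 0" for x by (simp add: \<eta>_def)
  have \<eta>out: "\<eta> x = 0" if "x \<notin> cball x0 \<rho>" for x
    using bdry[of x] that by (auto simp: \<eta>_def)
  define R where "R = norm x0 + r"
  have csub: "cball x0 \<rho> \<subseteq> cball 0 R"
  unfolding R_def
    by (rule cball_subset_cball_0) (use \<rho> in simp)
  have \<eta>R: "\<eta> x = 0" if "x \<notin> cball 0 R" for x using \<eta>out csub that by blast
  obtain U where U: "Lu-lipschitz_on UNIV U" "\<And>x. x \<in> \<Omega> \<Longrightarrow> U x = u x"
    using lipschitz_extension[OF u] by blast
  have mU: "U \<in> borel_measurable borel" "\<eta> \<in> borel_measurable borel"
    using lipschitz_UNIV_measurable[OF U(1)] lipschitz_UNIV_measurable[OF \<eta>lip] .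
  have int: "integrable lborel (\<lambda>x. quot_grad U x $ i * quot_grad \<eta> x $ j)" for i j
  proof (rule integrable_AE_bounded_support[where B="Lu * K" and R=R])
    show "(\<lambda>x. quot_grad U x $ i * quot_grad \<eta> x $ j) \<in> borel_measurable borel"
      by (intro borel_measurable_times quot_grad_component_measurable mU)
    show "AE x in lborel. \<bar>quot_grad U x $ i * quot_grad \<eta> x $ j\<bar> \<le> Lu * K \<and>
        (x \<notin> cball 0 R \<longrightarrow> quot_grad U x $ i * quot_grad \<eta> x $ j = 0)"
      using rademacher[OF U(1)] rademacher[OF \<eta>lip]
    proof eventually_elim
      case (elim x)
      have "\<bar>quot_grad U x $ i\<bar> \<le> Lu" "\<bar>quot_grad \<eta> x $ j\<bar> \<le> K"
        using gderiv_bound[OF U(1) elim(1)] gderiv_bound[OF \<eta>lip elim(2)]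
          component_le_norm_cart[of "quot_grad U x" i] component_le_norm_cart[of "quot_grad \<eta> x" j] by linarith+
      then have "\<bar>quot_grad U x $ i * quot_grad \<eta> x $ j\<bar> \<le> Lu * K"
        unfolding abs_mult using lipschitz_on_nonneg[OF u] by (intro mult_mono) auto
      moreover have "quot_grad \<eta> x = 0" if "x \<notin> cball 0 R"
        using that csub by (intro quot_grad_zero_outside[of x0 \<rho>] \<eta>out) auto
      ultimately show ?case by auto
    qed
  qed
  let ?T1 = "\<lambda>x. rot (quot_grad U x) \<bullet> quot_grad \<eta> x"
  let ?T2 = "\<lambda>x. (indicat_real (ball x0 r) x *\<^sub>R radial_field (slope_inv f 0) (P x)) \<bullet> quot_grad \<eta> x"
  have T1: "integrable lborel ?T1" "(LINT x|lborel. ?T1 x) = 0"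
  proof -
    show "integrable lborel ?T1" unfolding inner_rot by (intro Bochner_Integration.integrable_diff int)
    have "(LINT x|lborel. ?T1 x) = (LINT x|lborel. quot_grad U x $ 1 * quot_grad \<eta> x $ 2) - (LINT x|lborel. quot_grad U x $ 2 * quot_grad \<eta> x $ 1)"
      unfolding inner_rot by (rule Bochner_Integration.integral_diff[OF int int])
    then show "(LINT x|lborel. ?T1 x) = 0"
      using integral_curl_free[OF U(1) \<eta>lip, where R=R and i=1 and j=2] \<eta>R by simp
  qed
  have T2: "integrable lborel ?T2" "0 \<le> (LINT x|lborel. ?T2 x)"
    by (rule slope_flux_nonneg[OF reg zero unb C2 sub m(1) _ \<epsilon>0 _ \<eta>lip \<eta>0 _ \<rho>];
      (rule m(2), assumption | rule sign, assumption+ | rule \<eta>out, assumption)+)+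
  \<comment> \<open>Where \<open>\<eta>\<close> vanishes it has a minimum, so its gradient is \<open>0\<close> at points of differentiability.\<close>
  have key: "AE x in lborel. quot_grad \<eta> x = 0 \<or> ?T1 x - ?T2 x > 0"
    using rademacher[OF U(1)] rademacher[OF \<eta>lip] conj
  proof eventually_elim
    case (elim x)
    show ?case
    proof (cases "x \<in> ball x0 r \<and> v x > \<phi> x")
      case True
      then have x: "x \<in> ball x0 r" "x \<in> \<Omega>" "v x > \<phi> x" using bsub by auto
      obtain q where q: "GDERIV u x :> q" "GDERIV v x :> conj_grad f q" using elim(3) x(2) by blast
      have "quot_grad U x = q"
        by (rule gderiv_unique[OF gderiv_transform_open[OF elim(1) \<Omega> x(2) U(2)] q(1)])
      have contd: "continuous_on (ball x0 r) (\<lambda>y. v y - \<phi> y)"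
        by (intro continuous_intros lipschitz_on_continuous_on[OF \<phi>lip]
            continuous_on_subset[OF lipschitz_on_continuous_on[OF v] bsub])
      define S where "S = ball x0 r \<inter> (\<lambda>y. v y - \<phi> y) -` {0<..}"
      have S: "open S" "x \<in> S"
        unfolding S_def using continuous_open_preimage[OF contd open_ball open_greaterThan, of 0] x by auto
      have "GDERIV (\<lambda>y. v y - \<phi> y) x :> conj_grad f q - P x"
        using has_derivative_diff[OF q(2)[unfolded gderiv_def] \<phi>der[OF x(2), unfolded gderiv_def]]
        by (simp add: gderiv_def inner_diff_right)
      then have "GDERIV \<eta> x :> conj_grad f q - P x"
        by (rule gderiv_transform_open[OF _ S]) (auto simp: S_def \<eta>_def)
      then have g: "quot_grad \<eta> x = conj_grad f q - P x" by (rule quot_grad_eq)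
      have g0: "slope_inv f 0 0 = 0" using slope_inv_0_hderiv[of 0] zero by simp
      have "?T1 x - ?T2 x = (radial_field (slope_inv f 0) (conj_grad f q) - radial_field (slope_inv f 0) (P x)) \<bullet> (conj_grad f q - P x)"
        using x(1) by (simp add: g \<open>quot_grad U x = q\<close> radial_field_conj_grad inner_diff_left)
      then show ?thesis
        using radial_field_strict_mono[of "slope_inv f 0" "conj_grad f q" "P x", OF slope_inv_0_strict_mono g0] g
        by (cases "conj_grad f q = P x") auto
    next
      case False
      then have "\<eta> x = 0" by (auto simp: \<eta>_def)
      then have "(\<lambda>h. h \<bullet> quot_grad \<eta> x) = (\<lambda>h. 0)"
        using differential_zero_maxmin[of x UNIV \<eta> "\<lambda>h. h \<bullet> quot_grad \<eta> x"] elim(2) \<eta>0 by (auto simp: gderiv_def)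
      then have "quot_grad \<eta> x \<bullet> quot_grad \<eta> x = 0" by (rule fun_cong)
      then show ?thesis by simp
    qed
  qed
  have "AE x in lborel. ?T1 x - ?T2 x = 0"
  proof -
    have i: "integrable lborel (\<lambda>x. ?T1 x - ?T2 x)" by (intro Bochner_Integration.integrable_diff T1 T2)
    have n: "AE x in lborel. 0 \<le> ?T1 x - ?T2 x" using key by eventually_elim auto
    have "(LINT x|lborel. ?T1 x - ?T2 x) \<le> 0"
      using Bochner_Integration.integral_diff[OF T1(1) T2(1)] T1(2) T2(2) by simp
    moreover have "(LINT x|lborel. ?T1 x - ?T2 x) \<ge> 0" using n by (rule integral_nonneg_AE)
    ultimately have "(LINT x|lborel. ?T1 x - ?T2 x) = 0" by simp
    then show ?thesis using integral_nonneg_eq_0_iff_AE[OF i n] by simp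
  qed
  then have "AE x in lborel. quot_grad \<eta> x = 0" using key by eventually_elim auto
  then have "\<eta> x = 0" using zero_gradient_imp_zero[OF \<eta>lip, where R=R] \<eta>R \<eta>0 by blast
  then show ?thesis using x by (simp add: \<eta>_def max_def split: if_splits)
qed

end

section \<open>Stability under uniform limits\<close>

text \<open>
  Joint continuity in the coefficient \<open>a\<close> and the point \<open>x\<close>, which vary independently in the
  comparison argument.
\<close>

lemma negative_near:
  fixes b t :: "'a::metric_space \<Rightarrow> real"
  assumes "isCont b x0" "isCont t x0" "(1 - A) * b x0 + A * t x0 < 0"
  shows "\<exists>d>0. \<forall>a x. \<bar>a - A\<bar> < d \<and> dist x x0 < d \<longrightarrow> (1 - a) * b x + a * t x < 0"
proof -
  let ?h = "\<lambda>z. (1 - fst z) * b (snd z) + fst z * t (snd z)"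
  have "(?h \<longlongrightarrow> ?h (A, x0)) (nhds (A, x0))"
  proof -
    have b: "(b \<longlongrightarrow> b x0) (nhds x0)" and t: "(t \<longlongrightarrow> t x0) (nhds x0)"
      using assms(1,2) by (auto simp: isCont_def tendsto_at_iff_tendsto_nhds)
    have f: "(fst \<longlongrightarrow> A) (nhds (A, x0))" and s: "(snd \<longlongrightarrow> x0) (nhds (A, x0))"
      using tendsto_fst[OF filterlim_ident[of "nhds (A, x0)"]] tendsto_snd[OF filterlim_ident[of "nhds (A, x0)"]] by simp_all
    have "(?h \<longlongrightarrow> (1 - A) * b x0 + A * t x0) (nhds (A, x0))"
      by (intro tendsto_intros f filterlim_compose[OF b s] filterlim_compose[OF t s])
    then show ?thesis by simp
  qed
  then have "\<forall>\<^sub>F z in nhds (A, x0). ?h z < 0"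
    by (rule order_tendstoD(2)) (use assms(3) in simp)
  then obtain e where e: "e > 0" "\<And>z. dist z (A, x0) < e \<Longrightarrow> ?h z < 0"
    by (auto simp: eventually_nhds_metric)
  have "(1 - a) * b x + a * t x < 0" if "\<bar>a - A\<bar> < e / 2" "dist x x0 < e / 2" for a x
  proof -
    have "dist (a, x) (A, x0) \<le> dist a A + dist x x0"
      unfolding dist_Pair_Pair by (rule sqrt_sum_squares_le_sum) auto
    also have "\<dots> < e" using that by (simp add: dist_real_def)
    finally show ?thesis using e(2)[of "(a, x)"] by simp
  qed
  then show ?thesis using e(1) by (intro exI[of _ "e / 2"]) auto
qed

lemma C2_with_add_quadratic:
  fixes \<phi> :: "real^'n::finite \<Rightarrow> real"
  assumes "C2_with \<Omega> \<phi> P H"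
  shows "C2_with \<Omega> (\<lambda>x. \<phi> x + \<gamma> * (norm (x - x0))\<^sup>2 + c) (\<lambda>x. P x + (2 * \<gamma>) *\<^sub>R (x - x0)) (\<lambda>x. H x + mat (2 * \<gamma>))"
  unfolding C2_with_def
proof (intro conjI ballI)
  fix x assume x: "x \<in> \<Omega>"
  have P: "(\<phi> has_derivative (\<lambda>h. h \<bullet> P x)) (at x)" "(P has_derivative (\<lambda>h. H x *v h)) (at x)"
    using assms x by (auto simp: C2_with_def gderiv_def)
  have "((\<lambda>x. \<phi> x + \<gamma> * ((x - x0) \<bullet> (x - x0)) + c) has_derivative
      (\<lambda>h. h \<bullet> P x + \<gamma> * ((x - x0) \<bullet> h + h \<bullet> (x - x0)))) (at x)"
    by (auto intro!: derivative_eq_intros P)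
  then show "GDERIV (\<lambda>x. \<phi> x + \<gamma> * (norm (x - x0))\<^sup>2 + c) x :> P x + (2 * \<gamma>) *\<^sub>R (x - x0)"
    by (simp add: gderiv_def dot_square_norm inner_add_right inner_commute algebra_simps)
  have "((\<lambda>x. P x + (2 * \<gamma>) *\<^sub>R (x - x0)) has_derivative (\<lambda>h. H x *v h + (2 * \<gamma>) *\<^sub>R h)) (at x)"
    by (auto intro!: derivative_eq_intros P)
  moreover have "mat (2 * \<gamma>) *v h = (2 * \<gamma>) *\<^sub>R h" for h :: "real^'n"
    by (simp add: vec_eq_iff matrix_vector_mult_def mat_def if_distrib[of "\<lambda>c. c * _"] cong: if_cong)
  ultimately show "((\<lambda>x. P x + (2 * \<gamma>) *\<^sub>R (x - x0)) has_derivative (\<lambda>h. (H x + mat (2 * \<gamma>)) *v h)) (at x)"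
    by (simp add: matrix_vector_mult_add_rdistrib)
next
  show "continuous_on \<Omega> (\<lambda>x. H x + mat (2 * \<gamma>))"
    using assms by (auto simp: C2_with_def intro!: continuous_intros)
qed

lemma C2_with_minus:
  fixes \<phi> :: "real^'n::finite \<Rightarrow> real"
  assumes "C2_with \<Omega> \<phi> P H"
  shows "C2_with \<Omega> (\<lambda>x. - \<phi> x) (\<lambda>x. - P x) (\<lambda>x. - H x)"
  unfolding C2_with_def
proof (intro conjI ballI)
  fix x assume x: "x \<in> \<Omega>"
  have P: "(\<phi> has_derivative (\<lambda>h. h \<bullet> P x)) (at x)" "(P has_derivative (\<lambda>h. H x *v h)) (at x)"
    using assms x by (auto simp: C2_with_def gderiv_def)
  show "GDERIV (\<lambda>x. - \<phi> x) x :> - P x"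
    using has_derivative_minus[OF P(1)] by (simp add: gderiv_def)
  have "- H x *v h = - (H x *v h)" for h
    by (simp add: vec_eq_iff matrix_vector_mult_def sum_negf)
  then show "((\<lambda>x. - P x) has_derivative (\<lambda>h. - H x *v h)) (at x)"
    using has_derivative_minus[OF P(2)] by simp
next
  show "continuous_on \<Omega> (\<lambda>x. - H x)"
    using assms by (auto simp: C2_with_def intro!: continuous_intros)
qed

text \<open>
  The subsolution half of the theorem.  It is stated for pairs whose gradients are related by the system
  almost everywhere, a condition inherited by \<open>(- u\<^sub>n, - v\<^sub>n)\<close>; the change of sign turns touching
  from below into touching from above.
\<close>

lemma touching_from_above:
  fixes us vs :: "nat \<Rightarrow> real^2 \<Rightarrow> real" and v :: "real^2 \<Rightarrow> real"
  assumes \<Omega>: "open \<Omega>"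
    and adm: "admissible_lagrangean f" and reg: "\<And>n. regular_strictly_convex (fs n)"
    and zero: "\<And>n. hderiv (fs n) 0 = 0" and lim: "uniform_limit {0..} fs f sequentially"
    and el0: "\<And>n. \<exists>c. (elasticity (fs n) \<longlongrightarrow> c) (at_right 0)"
    and \<alpha>s: "\<And>n \<rho>. \<rho> > 0 \<Longrightarrow> \<alpha>s n \<rho> = elasticity (fs n) \<rho>" "\<And>n. \<alpha>s n 0 = Lim (at_right 0) (elasticity (fs n))"
    and \<alpha>: "\<And>K. compact K \<Longrightarrow> K \<subseteq> {0..} \<Longrightarrow> uniform_limit K \<alpha>s \<alpha> sequentially"
    and us: "\<And>n. \<exists>L. L-lipschitz_on \<Omega> (us n)" and vs: "\<And>n. \<exists>L. L-lipschitz_on \<Omega> (vs n)"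
    and conj: "\<And>n. AE x in lborel. x \<in> \<Omega> \<longrightarrow> (\<exists>q. GDERIV (us n) x :> q \<and> GDERIV (vs n) x :> conj_grad (fs n) q)"
    and v: "strict_mono s" "uniform_limit \<Omega> (\<lambda>k. vs (s k)) v sequentially"
    and C2: "C2_with \<Omega> \<phi> P H" and x0: "x0 \<in> \<Omega>"
    and touch: "\<forall>\<^sub>F x in at x0. v x - \<phi> x \<le> v x0 - \<phi> x0"
  defines "A \<equiv> \<alpha> (hderiv (conjugate_halfline f) (norm (P x0)))"
  shows "0 \<le> (1 - A) * ((H x0 *v P x0) \<bullet> P x0) + (norm (P x0))\<^sup>2 * A * trace (H x0)"
proof (rule ccontr)
  assume neg: "\<not> ?thesis"
  then have p0: "P x0 \<noteq> 0" by auto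
  define r0 where "r0 = norm (P x0)"
  have r0: "r0 > 0" using p0 by (simp add: r0_def)
  obtain \<rho>0 where d: "dual_point f r0 \<rho>0" using dual_point_exists[OF adm] by blast
  have A: "A = \<alpha> \<rho>0" using hderiv_conjugate[OF adm r0 d] by (simp add: A_def r0_def)
  define E where "E = - ((1 - A) * ((H x0 *v P x0) \<bullet> P x0) + r0\<^sup>2 * A * trace (H x0))"
  have E: "E > 0" using neg by (simp add: E_def r0_def)
  \<comment> \<open>Adding \<open>\<gamma> |x - x0|\<^sup>2\<close> to \<open>\<phi>\<close> changes the operator at \<open>x0\<close> by at most \<open>\<gamma> Q\<close>, in absolute value.\<close>
  define Q where "Q = 2 * r0\<^sup>2 * (\<bar>1 - A\<bar> + 2 * \<bar>A\<bar>) + 1"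
  have Q: "Q > 0" by (simp add: Q_def add_nonneg_pos)
  define \<gamma> where "\<gamma> = E / (2 * Q)"
  have \<gamma>: "\<gamma> > 0" "\<gamma> * Q < E" using E Q by (auto simp: \<gamma>_def)
  define P2 where "P2 x = P x + (2 * \<gamma>) *\<^sub>R (x - x0)" for x
  define H2 where "H2 x = H x + mat (2 * \<gamma>)" for x
  define b where "b x = (H2 x *v P2 x) \<bullet> P2 x" for x
  define t where "t x = (norm (P2 x))\<^sup>2 * trace (H2 x)" for x
  have matv: "mat c *v h = c *\<^sub>R h" for c and h :: "real^2"
    by (simp add: vec_eq_iff matrix_vector_mult_def mat_def if_distrib[of "\<lambda>c. c * _"] cong: if_cong)
  have tr: "trace (H2 x) = trace (H x) + 4 * \<gamma>" for x
    by (simp add: H2_def trace_def mat_def sum_2)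
  have cP: "isCont P2 x0" and cH: "isCont H2 x0"
  proof -
    have "isCont P x0"
      using C2 x0 unfolding C2_with_def by (intro has_derivative_continuous) auto
    then show "isCont P2 x0" unfolding P2_def by (intro continuous_intros)
    have "isCont H x0" using C2 x0 \<Omega> by (auto simp: C2_with_def continuous_on_eq_continuous_at)
    then show "isCont H2 x0" unfolding H2_def by (intro continuous_intros)
  qed
  have cb: "isCont b x0"
  proof -
    have "isCont (\<lambda>x. \<Sum>i\<in>UNIV. (\<Sum>j\<in>UNIV. H2 x $ i $ j * P2 x $ j) * P2 x $ i) x0"
      by (intro continuous_intros cP cH)
    then show ?thesis by (simp add: b_def[abs_def] inner_vec_def matrix_vector_mult_def)
  qed
  have ct: "isCont t x0"
  proof -
    have "isCont (\<lambda>x. H2 x $ i $ i) x0" for i by (intro continuous_intros cH)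
    then have "isCont (\<lambda>x. trace (H2 x)) x0" unfolding trace_def by (intro continuous_sum)
    moreover have "isCont (\<lambda>x. (norm (P2 x))\<^sup>2) x0" by (intro continuous_intros cP)
    ultimately show ?thesis unfolding t_def by (intro continuous_mult)
  qed
  have "(1 - A) * b x0 + A * t x0 < 0"
  proof -
    have "b x0 = (H x0 *v P x0) \<bullet> P x0 + 2 * \<gamma> * r0\<^sup>2"
      by (simp add: b_def P2_def H2_def matrix_vector_mult_add_rdistrib matv inner_add_left dot_square_norm r0_def)
    moreover have "t x0 = r0\<^sup>2 * trace (H x0) + 4 * \<gamma> * r0\<^sup>2"
      by (simp add: t_def tr P2_def r0_def algebra_simps)
    ultimately have "(1 - A) * b x0 + A * t x0 = - E + \<gamma> * (2 * r0\<^sup>2 * ((1 - A) + 2 * A))"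
      by (simp add: E_def algebra_simps)
    also have "\<dots> \<le> - E + \<gamma> * Q"
    proof -
      have "2 * r0\<^sup>2 * ((1 - A) + 2 * A) \<le> 2 * r0\<^sup>2 * (\<bar>1 - A\<bar> + 2 * \<bar>A\<bar>)"
        by (intro mult_left_mono) auto
      then have "2 * r0\<^sup>2 * ((1 - A) + 2 * A) \<le> Q" by (simp add: Q_def)
      then show ?thesis using \<gamma>(1) by simp
    qed
    also have "\<dots> < 0" using \<gamma>(2) by simp
    finally show ?thesis .
  qed
  from negative_near[OF cb ct this] obtain \<kappa> where \<kappa>: "\<kappa> > 0"
    "\<And>a x. \<bar>a - A\<bar> < \<kappa> \<Longrightarrow> dist x x0 < \<kappa> \<Longrightarrow> (1 - a) * b x + a * t x < 0" by blast
  obtain N1 \<epsilon>0 \<delta>1 where N1: "\<epsilon>0 > 0" "\<delta>1 > 0"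
    "\<And>n \<epsilon> r \<rho>. n \<ge> N1 \<Longrightarrow> 0 < \<epsilon> \<Longrightarrow> \<epsilon> \<le> \<epsilon>0 \<Longrightarrow> \<bar>r - r0\<bar> < \<delta>1 \<Longrightarrow> \<rho> > 0 \<Longrightarrow>
      hderiv (fs n) \<rho> + \<epsilon> * \<rho> = r \<Longrightarrow> \<bar>\<rho> * (deriv (hderiv (fs n)) \<rho> + \<epsilon>) / r - \<alpha> \<rho>0\<bar> < \<kappa>"
    using regularized_elasticity_limit[OF adm reg zero lim el0 \<alpha>s \<alpha> r0 d \<kappa>(1)] by blast
  have "isCont (\<lambda>x. norm (P2 x)) x0" using cP by (intro continuous_intros)
  then have "((\<lambda>x. norm (P2 x)) \<longlongrightarrow> norm (P2 x0)) (nhds x0)"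
    using tendsto_at_iff_tendsto_nhds[of "\<lambda>x. norm (P2 x)" x0] by (simp add: isCont_def)
  then have "\<forall>\<^sub>F x in nhds x0. dist (norm (P2 x)) (norm (P2 x0)) < min \<delta>1 (r0 / 2)"
    by (rule tendstoD) (use N1(2) r0 in simp)
  then obtain \<delta>2 where \<delta>2: "\<delta>2 > 0" "\<And>x. dist x x0 < \<delta>2 \<Longrightarrow> dist (norm (P2 x)) (norm (P2 x0)) < min \<delta>1 (r0 / 2)"
    by (auto simp: eventually_nhds_metric)
  have P20: "norm (P2 x0) = r0" by (simp add: P2_def r0_def)
  obtain \<delta>3 where \<delta>3: "\<delta>3 > 0" "\<And>x. x \<noteq> x0 \<Longrightarrow> dist x x0 < \<delta>3 \<Longrightarrow> v x - \<phi> x \<le> v x0 - \<phi> x0"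
    using touch by (auto simp: eventually_at)
  obtain \<delta>4 where \<delta>4: "\<delta>4 > 0" "cball x0 \<delta>4 \<subseteq> \<Omega>" using \<Omega> x0 open_contains_cball by blast
  define r where "r = Min {\<kappa>, \<delta>2, \<delta>3, \<delta>4}"
  have r: "r > 0" "r \<le> \<kappa>" "r \<le> \<delta>2" "r \<le> \<delta>3" "r \<le> \<delta>4"
    using \<kappa>(1) \<delta>2(1) \<delta>3(1) \<delta>4(1) by (auto simp: r_def)
  have sub: "cball x0 r \<subseteq> \<Omega>" using \<delta>4(2) r(5) by (meson subset_cball order_trans)
  have "\<forall>\<^sub>F k in sequentially. \<forall>x\<in>\<Omega>. dist (vs (s k) x) (v x) < \<gamma> * r\<^sup>2 / 16"
    using v(2)[unfolded uniform_limit_iff, rule_format, of "\<gamma> * r\<^sup>2 / 16"] \<gamma>(1) r(1) by simp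
  moreover have "\<forall>\<^sub>F k in sequentially. \<forall>M. \<exists>\<rho>>0. hderiv (fs (s k)) \<rho> \<ge> M"
    using eventually_slopes_unbounded[OF adm reg lim] filterlim_subseq[OF v(1)] by (rule eventually_compose_filterlim)
  moreover have "\<forall>\<^sub>F k in sequentially. s k \<ge> N1"
    using filterlim_subseq[OF v(1)] by (simp add: filterlim_at_top)
  ultimately have "\<forall>\<^sub>F k in sequentially. (\<forall>x\<in>\<Omega>. dist (vs (s k) x) (v x) < \<gamma> * r\<^sup>2 / 16) \<and>
      (\<forall>M. \<exists>\<rho>>0. hderiv (fs (s k)) \<rho> \<ge> M) \<and> s k \<ge> N1"
    by eventually_elim blast
  then obtain k where k: "\<And>x. x \<in> \<Omega> \<Longrightarrow> \<bar>vs (s k) x - v x\<bar> < \<gamma> * r\<^sup>2 / 16"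
      "\<And>M. \<exists>\<rho>>0. hderiv (fs (s k)) \<rho> \<ge> M" "s k \<ge> N1"
    by (auto simp: eventually_sequentially dist_real_def)
  let ?n = "s k"
  \<comment> \<open>The comparison function is below \<open>v\<^sub>n\<close> by \<open>\<gamma> r\<^sup>2 / 4\<close> at \<open>x0\<close>.  Outside the ball of radius \<open>3 r / 4\<close> the
    quadratic term contributes at least \<open>9 \<gamma> r\<^sup>2 / 16\<close>, which exceeds this deficit plus twice the
    distance \<open>\<gamma> r\<^sup>2 / 16\<close> between \<open>v\<^sub>n\<close> and \<open>v\<close>.\<close>
  define c where "c = vs ?n x0 - \<phi> x0 - \<gamma> * r\<^sup>2 / 4"
  define \<phi>2 where "\<phi>2 x = \<phi> x + \<gamma> * (norm (x - x0))\<^sup>2 + c" for x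
  have C22: "C2_with \<Omega> \<phi>2 P2 H2"
    unfolding \<phi>2_def P2_def H2_def by (rule C2_with_add_quadratic[OF C2])
  obtain Lu where Lu: "Lu-lipschitz_on \<Omega> (us ?n)" using us by blast
  obtain Lv where Lv: "Lv-lipschitz_on \<Omega> (vs ?n)" using vs by blast
  have near: "r0 / 2 < norm (P2 x)" "\<bar>norm (P2 x) - r0\<bar> < \<delta>1" if "x \<in> ball x0 r" for x
    using \<delta>2(2)[of x] that r(3) P20 by (auto simp: dist_commute dist_real_def abs_if split: if_splits)
  have "vs ?n x0 \<le> \<phi>2 x0"
  proof (rule conjugate_comparison[OF reg zero k(2) \<Omega> Lu Lv conj C22 sub _ _ N1(1), where m="r0 / 2" and \<rho>="3 * r / 4"])
    show "r0 / 2 > 0" "0 < 3 * r / 4" "3 * r / 4 < r" "x0 \<in> ball x0 r" using r0 N1(1) r(1) by auto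
    show "r0 / 2 \<le> norm (P2 x)" if "x \<in> ball x0 r" for x using near(1)[OF that] by simp
  next
    fix x \<epsilon> a
    assume x: "x \<in> ball x0 r" and \<epsilon>: "0 < \<epsilon>" "\<epsilon> \<le> \<epsilon>0"
      and a: "a = slope_inv (fs ?n) \<epsilon> (norm (P2 x)) * (deriv (hderiv (fs ?n)) (slope_inv (fs ?n) \<epsilon> (norm (P2 x))) + \<epsilon>) / norm (P2 x)"
    have pos: "norm (P2 x) > 0" using near(1)[OF x] r0 by linarith
    have "\<bar>a - \<alpha> \<rho>0\<bar> < \<kappa>"
      unfolding a using slope_inv_solves[OF reg zero k(2), of \<epsilon> "norm (P2 x)"] slope_inv_pos[OF reg zero k(2), of \<epsilon>, OF _ pos] \<epsilon>
      by (intro N1(3)[OF k(3) \<epsilon> near(2)[OF x]]) auto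
    then have "(1 - a) * b x + a * t x < 0"
      using x r(2) A by (intro \<kappa>(2)) (auto simp: dist_commute)
    then show "(1 - a) * ((H2 x *v P2 x) \<bullet> P2 x) + (norm (P2 x))\<^sup>2 * a * trace (H2 x) \<le> 0"
      by (simp add: b_def t_def algebra_simps)
  next
    fix x assume x: "x \<in> ball x0 r" "x \<notin> cball x0 (3 * r / 4)"
    have xO: "x \<in> \<Omega>" using x(1) sub ball_subset_cball by blast
    have nx: "norm (x - x0) > 3 * r / 4" using x(2) by (simp add: dist_norm norm_minus_commute)
    then have "x \<noteq> x0" using r(1) by auto
    then have 1: "v x - \<phi> x \<le> v x0 - \<phi> x0" using x(1) r(4) by (intro \<delta>3(2)) (auto simp: dist_commute)
    have "(3 * r / 4)\<^sup>2 \<le> (norm (x - x0))\<^sup>2" using nx r(1) by (intro power_mono) auto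
    then have "\<gamma> * (3 * r / 4)\<^sup>2 \<le> \<gamma> * (norm (x - x0))\<^sup>2" using \<gamma>(1) by simp
    moreover have "\<gamma> * (3 * r / 4)\<^sup>2 = 9 / 16 * (\<gamma> * r\<^sup>2)" by (simp add: power_divide power_mult_distrib)
    ultimately show "vs ?n x \<le> \<phi>2 x"
      using 1 k(1)[OF xO] k(1)[OF x0] unfolding \<phi>2_def c_def by linarith
  qed
  then have "\<gamma> * r\<^sup>2 / 4 \<le> 0" by (simp add: \<phi>2_def c_def)
  then show False using \<gamma>(1) r(1) by (simp add: mult_le_0_iff)
qed

theorem corollary3p9:
  fixes \<Omega> :: "(real^2) set" and \<psi> :: "real^2 \<Rightarrow> real"
    and f :: "real \<Rightarrow> real" and fs :: "nat \<Rightarrow> real \<Rightarrow> real"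
    and us vs :: "nat \<Rightarrow> real^2 \<Rightarrow> real" and v :: "real^2 \<Rightarrow> real"
    and \<alpha>s :: "nat \<Rightarrow> real \<Rightarrow> real" and \<alpha> \<beta> :: "real \<Rightarrow> real"
    and s :: "nat \<Rightarrow> nat"
  assumes \<Omega>: "open \<Omega>" "connected \<Omega>" "\<Omega> \<noteq> {}" "bounded \<Omega>" "simply_connected \<Omega>"
    and \<psi>: "continuous_on (frontier \<Omega>) \<psi>" "bounded_slope_condition \<Omega> \<psi>"
    and f: "admissible_lagrangean f"
    and fs: "\<And>n. regular_strictly_convex (fs n)" "\<And>n. hderiv (fs n) 0 = 0"
      "uniform_limit {0..} fs f sequentially"
    and us: "\<And>n. minimizes_gradient_integral \<Omega> \<psi> (fs n) (us n)"
    and vs: "\<And>n. vs n \<in> Lip \<Omega>" "\<And>n. (LINT x:\<Omega>|lebesgue. vs n x) = 0"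
      "\<And>n. distributional_partial \<Omega> 1 (vs n) (\<lambda>x. if grad (us n) x = 0 then 0
          else - hderiv (fs n) (norm (grad (us n) x)) * (grad (us n) x $ 2 / norm (grad (us n) x)))"
      "\<And>n. distributional_partial \<Omega> 2 (vs n) (\<lambda>x. if grad (us n) x = 0 then 0
          else hderiv (fs n) (norm (grad (us n) x)) * (grad (us n) x $ 1 / norm (grad (us n) x)))"
    and elasticity_0: "\<And>n. \<exists>c>0. (elasticity (fs n) \<longlongrightarrow> c) (at_right 0)"
    and \<alpha>s: "\<And>n \<rho>. \<rho> > 0 \<Longrightarrow> \<alpha>s n \<rho> = elasticity (fs n) \<rho>"
      "\<And>n. \<alpha>s n 0 = Lim (at_right 0) (elasticity (fs n))"
    and \<beta>: "\<And>K. compact K \<Longrightarrow> K \<subseteq> {0..} \<Longrightarrow>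
      uniform_limit K (\<lambda>n. \<alpha>s n \<circ> inv_into {0..} (hderiv (fs n))) \<beta> sequentially"
    and v: "strict_mono s" "uniform_limit \<Omega> (\<lambda>k. vs (s k)) v sequentially"
    and \<alpha>: "\<And>\<rho>. \<rho> > 0 \<Longrightarrow> \<alpha> \<rho> = elasticity f \<rho>" "\<alpha> 0 = 0"
      "\<And>K. compact K \<Longrightarrow> K \<subseteq> {0..} \<Longrightarrow> uniform_limit K \<alpha>s \<alpha> sequentially"
  shows "viscosity_solution \<Omega>
    (\<lambda>p X. - (1 - \<alpha> (hderiv (conjugate_halfline f) (norm p))) * ((X *v p) \<bullet> p)
           - (norm p)\<^sup>2 * \<alpha> (hderiv (conjugate_halfline f) (norm p)) * trace X) v"
proof -
  have usL: "\<exists>L. L-lipschitz_on \<Omega> (us n)" for n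
    using us[of n] closure_subset[of \<Omega>] unfolding minimizes_gradient_integral_def Lip_def
    by (auto intro: lipschitz_on_subset)
  have vsL: "\<exists>L. L-lipschitz_on \<Omega> (vs n)" for n
    using vs(1)[of n] by (simp add: Lip_def)
  have el0: "\<exists>c. (elasticity (fs n) \<longlongrightarrow> c) (at_right 0)" for n
    using elasticity_0 by blast
  have conj: "AE x in lborel. x \<in> \<Omega> \<longrightarrow> (\<exists>q. GDERIV (us n) x :> q \<and> GDERIV (vs n) x :> conj_grad (fs n) q)" for n
  proof -
    obtain Lu where Lu: "Lu-lipschitz_on \<Omega> (us n)" using usL by blast
    obtain Lv where Lv: "Lv-lipschitz_on \<Omega> (vs n)" using vsL by blast
    from lipschitz_AE_gderiv[OF \<Omega>(1) Lu] lipschitz_AE_gderiv[OF \<Omega>(1) Lv]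
      distributional_partial_lipschitz[OF \<Omega>(1) Lv vs(3)] distributional_partial_lipschitz[OF \<Omega>(1) Lv vs(4)]
    show ?thesis
    proof eventually_elim
      case (elim x)
      show ?case
      proof
        assume x: "x \<in> \<Omega>"
        have "grad (vs n) x = conj_grad (fs n) (grad (us n) x)"
          using elim(3,4) x
          by (auto simp: vec_eq_iff forall_2 conj_grad_def radial_field_def split: if_splits)
        then show "\<exists>q. GDERIV (us n) x :> q \<and> GDERIV (vs n) x :> conj_grad (fs n) q"
          using elim(1,2) x by auto
      qed
    qed
  qed
  have contv: "continuous_on \<Omega> v"
  proof (rule uniform_limit_theorem[OF _ v(2)])
    have "continuous_on \<Omega> (vs (s k))" for k
      using vsL[of "s k"] lipschitz_on_continuous_on by blast
    then show "\<forall>\<^sub>F k in sequentially. continuous_on \<Omega> (vs (s k))" by simp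
  qed simp
  note above = touching_from_above[OF \<Omega>(1) f fs el0 \<alpha>s \<alpha>(3)]
  show ?thesis
    unfolding viscosity_solution_def
  proof (intro conjI contv allI impI ballI)
    fix \<phi> P H x0
    assume C2: "C2_with \<Omega> \<phi> P H" and x0: "x0 \<in> \<Omega>"
    let ?A = "\<alpha> (hderiv (conjugate_halfline f) (norm (P x0)))"
    show "- (1 - ?A) * ((H x0 *v P x0) \<bullet> P x0) - (norm (P x0))\<^sup>2 * ?A * trace (H x0) \<le> 0"
      if "\<forall>\<^sub>F x in at x0. v x - \<phi> x \<le> v x0 - \<phi> x0"
      using above[OF _ _ _ usL vsL conj v C2 x0 that] by (simp add: algebra_simps)
    show "- (1 - ?A) * ((H x0 *v P x0) \<bullet> P x0) - (norm (P x0))\<^sup>2 * ?A * trace (H x0) \<ge> 0"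
      if touch: "\<forall>\<^sub>F x in at x0. v x - \<phi> x \<ge> v x0 - \<phi> x0"
    proof -
      have conj': "AE x in lborel. x \<in> \<Omega> \<longrightarrow>
          (\<exists>q. GDERIV (\<lambda>x. - us n x) x :> q \<and> GDERIV (\<lambda>x. - vs n x) x :> conj_grad (fs n) q)" for n
        using conj[of n]
      proof eventually_elim
        case (elim x)
        show ?case
        proof
          assume "x \<in> \<Omega>"
          then obtain q where q: "GDERIV (us n) x :> q" "GDERIV (vs n) x :> conj_grad (fs n) q" using elim by blast
          have "conj_grad (fs n) (- q) = - conj_grad (fs n) q"
            by (simp add: conj_grad_def radial_field_def rot_minus)
          then have "GDERIV (\<lambda>x. - us n x) x :> - q \<and> GDERIV (\<lambda>x. - vs n x) x :> conj_grad (fs n) (- q)"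
            using GDERIV_minus[OF q(1)] GDERIV_minus[OF q(2)] by simp
          then show "\<exists>q. GDERIV (\<lambda>x. - us n x) x :> q \<and> GDERIV (\<lambda>x. - vs n x) x :> conj_grad (fs n) q" by blast
        qed
      qed
      have usL': "\<exists>L. L-lipschitz_on \<Omega> (\<lambda>x. - us n x)" and vsL': "\<exists>L. L-lipschitz_on \<Omega> (\<lambda>x. - vs n x)" for n
        using usL[of n] vsL[of n] by simp_all
      have v': "uniform_limit \<Omega> (\<lambda>k x. - vs (s k) x) (\<lambda>x. - v x) sequentially"
        by (rule uniform_limit_uminus[OF v(2)])
      have touch': "\<forall>\<^sub>F x in at x0. - v x - - \<phi> x \<le> - v x0 - - \<phi> x0"
        using touch by eventually_elim simp
      have "(- H x0 *v - P x0) \<bullet> - P x0 = - ((H x0 *v P x0) \<bullet> P x0)"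
        by (simp add: inner_vec_def matrix_vector_mult_def sum_negf)
      moreover have "trace (- H x0) = - trace (H x0)" by (simp add: trace_def sum_negf)
      ultimately show ?thesis
        using above[OF _ _ _ usL' vsL' conj' v(1) v' C2_with_minus[OF C2] x0 touch'] by (simp add: algebra_simps)
    qed
  qed
qed

end
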